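(* Let $f(z)=f_1(z)E_2(z)+f_0(z)$ be a quasimodular form of weight $k$ and depth $\le 1$ on $\mathrm{SL}(2,\mathbb Z)$, not identically zero, where $f_0$ and $f_1$ are modular forms on $\mathrm{SL}(2,\mathbb Z)$ of weight $k$ and $k-2$, respectively. Let $$W_f(z)=\det\begin{pmatrix} zf(z)+\frac{6}{\pi i}f_1(z) & f(z)\\ \left(zf(z)+\frac{6}{\pi i}f_1(z)\right)' & f'(z)\end{pmatrix},\qquad g_1(z)=\frac{zf(z)+\frac{6}{\pi i}f_1(z)}{\sqrt{W_f(z)}},\quad g_2(z)=\frac{f(z)}{\sqrt{W_f(z)}},$$ and $$Q(z)=-\frac1{4\pi^2}\frac{g_1''(z)}{g_1(z)}=-\frac1{4\pi^2}\frac{g_2''(z)}{g_2(z)},$$ which is a single-valued meromorphic function on the upper half-plane $\mathbb H$. Then $Q(z)$ is a meromorphic modular form of weight $4$ on $\mathrm{SL}(2,\mathbb Z)$. Moreover, for the differential equation $y''=-4\pi^2Q(z)y$ on $\mathbb H$ the following hold. (i) The equation is Fuchsian on $\mathbb H\cup\{\text{cusps}\}$. (ii) Any pole of $Q$ on $\mathbb H$ is an apparent singularity of the equation. (iii) The cusp $\infty$ is not apparent. (iv) Let $1/2\pm\kappa_i$ and $1/2\pm\kappa_\rho$, $\kappa_i,\kappa_\rho\in\frac12\mathbb N$, be the local exponents of the equation at $i=\sqrt{-1}$ and $\rho=(1+\sqrt{-3})/2$, respectively. Then $\gcd(2\kappa_i,2)=\gcd(2\kappa_\rho,3)=1$.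
   Context: $\mathbb N=\{1,2,3,\dots\}$; primes denote $d/dz$; $q=e^{2\pi iz}$; $E_2(z)=1-24\sum_{n\ge1}\sigma_1(n)q^n$ is the Eisenstein series of weight 2. For a meromorphic function $Q$ on $\mathbb H$ consider $y''=-4\pi^2Q(z)y$. The equation is Fuchsian on $\mathbb H$ if every pole of $Q$ on $\mathbb H$ has order $\le2$. If $Q(z)=A(z-z_0)^{-2}+O((z-z_0)^{-1})$ near $z_0\in\mathbb H$, the local exponents at $z_0$ are the two roots of $x(x-1)=-4\pi^2A$, written $1/2\pm\kappa_{z_0}$. A singular point $z_0$ is apparent if $\kappa_{z_0}\in\frac12\mathbb Z_{\ge0}$ and no solution of the equation has a logarithmic singularity at $z_0$. When $Q$ is a meromorphic modular form of weight 4 on $\mathrm{SL}(2,\mathbb Z)$, the equation near the cusp $\infty$ reads $(q\,d/dq)^2y=Qy$; it is Fuchsian at $\infty$ if and only if $Q$ is holomorphic at $\infty$, and then the local exponents at $\infty$ are $\pm\kappa_\infty$ with $\kappa_\infty=\sqrt{Q(\infty)}$. The cusp $\infty$ is not apparent if $\kappa_\infty\in\frac12\mathbb Z_{\ge0}$ and some solution has a logarithmic singularity at $q=0$. In that case, with $y_+$ the solution of the form $q^{\kappa_\infty}(1+\sum_{j\ge1}c_jq^j)$, every solution independent of $y_+$ is of the form $ezy_+(z)+m(z)$ with $e\ne0$ and $m(z)$ equal to $q^{-\kappa_\infty}$ times a power series in $q$. *)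

theory Defs
  imports "HOL-Complex_Analysis.Complex_Analysis" "HOL-Library.Landau_Symbols"
begin

definition uhp :: "complex set" where
  "uhp = {z. Im z > 0}"

definition qpar :: "complex \<Rightarrow> complex" where
  "qpar z = exp (2 * of_real pi * \<i> * z)"

text \<open>
  \<open>f\<close>, as a function of \<open>q\<close>, is \<open>F\<close> near the cusp \<open>\<infinity>\<close>. The function \<open>f\<close> is holomorphic
  (meromorphic) at \<open>\<infinity>\<close> if \<open>F\<close> can be chosen analytic (meromorphic) at \<open>0\<close>;
  in the first case \<open>f(\<infinity>) = F 0\<close>.
\<close>
definition q_expansion :: "(complex \<Rightarrow> complex) \<Rightarrow> (complex \<Rightarrow> complex) \<Rightarrow> bool" where
  "q_expansion f F \<longleftrightarrow> (\<exists>M. \<forall>z. Im z > M \<longrightarrow> f z = F (qpar z))"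

definition holomorphic_at_cusp :: "(complex \<Rightarrow> complex) \<Rightarrow> bool" where
  "holomorphic_at_cusp f \<longleftrightarrow> (\<exists>F. F analytic_on {0} \<and> q_expansion f F)"

definition meromorphic_at_cusp :: "(complex \<Rightarrow> complex) \<Rightarrow> bool" where
  "meromorphic_at_cusp f \<longleftrightarrow> (\<exists>F. F meromorphic_on {0} \<and> q_expansion f F)"

definition weakly_modular :: "int \<Rightarrow> (complex \<Rightarrow> complex) \<Rightarrow> bool" where
  "weakly_modular k f \<longleftrightarrow>
     (\<forall>a b c d :: int. a * d - b * c = 1 \<longrightarrow>
       (\<forall>z\<in>uhp. f ((of_int a * z + of_int b) / (of_int c * z + of_int d)) =
                 (of_int c * z + of_int d) powi k * f z))"

definition modular_form :: "int \<Rightarrow> (complex \<Rightarrow> complex) \<Rightarrow> bool" where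
  "modular_form k f \<longleftrightarrow>
     f holomorphic_on uhp \<and> weakly_modular k f \<and> holomorphic_at_cusp f"

text \<open>
  A nicely meromorphic function is analytic outside its poles and takes the value \<open>0\<close> at its
  poles, so the transformation law can be required at every point.
\<close>
definition meromorphic_modular_form :: "int \<Rightarrow> (complex \<Rightarrow> complex) \<Rightarrow> bool" where
  "meromorphic_modular_form k f \<longleftrightarrow>
     f nicely_meromorphic_on uhp \<and> weakly_modular k f \<and> meromorphic_at_cusp f"

definition sigma1 :: "nat \<Rightarrow> nat" where
  "sigma1 n = (\<Sum>d | d dvd n. d)"

definition E2 :: "complex \<Rightarrow> complex" where
  "E2 z = 1 - 24 * (\<Sum>n. of_nat (sigma1 (Suc n)) * qpar z ^ Suc n)"

definition h_fun :: "(complex \<Rightarrow> complex) \<Rightarrow> (complex \<Rightarrow> complex) \<Rightarrow> complex \<Rightarrow> complex" where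
  "h_fun f1 f z = z * f z + 6 / (of_real pi * \<i>) * f1 z"

definition W_fun :: "(complex \<Rightarrow> complex) \<Rightarrow> (complex \<Rightarrow> complex) \<Rightarrow> complex \<Rightarrow> complex" where
  "W_fun f1 f z = h_fun f1 f z * deriv f z - f z * deriv (h_fun f1 f) z"

text \<open>
  The square root of \<open>W\<close> is multivalued, so \<open>Q\<close> is specified through all local holomorphic
  branches \<open>s\<close>. Where \<open>W \<noteq> 0\<close>, at least one of \<open>g1\<close> and \<open>g2\<close> is nonzero, which fixes the value
  of \<open>Q\<close> there; at the zeros of \<open>W\<close> it is fixed by \<open>Q\<close> being nicely meromorphic.
\<close>
definition is_Q_of ::
    "(complex \<Rightarrow> complex) \<Rightarrow> (complex \<Rightarrow> complex) \<Rightarrow> (complex \<Rightarrow> complex) \<Rightarrow> bool" where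
  "is_Q_of f1 f Q \<longleftrightarrow>
     Q nicely_meromorphic_on uhp \<and>
     (\<forall>U s. open U \<and> U \<subseteq> uhp \<and> s holomorphic_on U \<and>
            (\<forall>z\<in>U. W_fun f1 f z \<noteq> 0 \<and> (s z)\<^sup>2 = W_fun f1 f z) \<longrightarrow>
        (let g1 = (\<lambda>z. h_fun f1 f z / s z); g2 = (\<lambda>z. f z / s z) in
          \<forall>z\<in>U. (g1 z \<noteq> 0 \<longrightarrow> Q z = - 1 / (4 * of_real pi ^ 2) * ((deriv ^^ 2) g1 z / g1 z)) \<and>
                (g2 z \<noteq> 0 \<longrightarrow> Q z = - 1 / (4 * of_real pi ^ 2) * ((deriv ^^ 2) g2 z / g2 z))))"

definition solution_on :: "(complex \<Rightarrow> complex) \<Rightarrow> complex set \<Rightarrow> (complex \<Rightarrow> complex) \<Rightarrow> bool" where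
  "solution_on Q S y \<longleftrightarrow>
     y holomorphic_on S \<and> (\<forall>z\<in>S. (deriv ^^ 2) y z = - 4 * of_real pi ^ 2 * Q z * y z)"

definition fuchsian_on_uhp :: "(complex \<Rightarrow> complex) \<Rightarrow> bool" where
  "fuchsian_on_uhp Q \<longleftrightarrow> (\<forall>z\<in>uhp. is_pole Q z \<longrightarrow> zorder Q z \<ge> - 2)"

text \<open>
  The cusps are the points \<open>\<gamma>\<infinity>\<close> with \<open>\<gamma>\<close> in \<open>SL(2,\<int>)\<close>. The substitution \<open>\<gamma>\<close> moves the
  cusp \<open>\<gamma>\<infinity>\<close> to \<open>\<infinity>\<close> and replaces \<open>Q\<close> by its weight 4 transform under \<open>\<gamma>\<close>.
\<close>
definition fuchsian_at_cusps :: "(complex \<Rightarrow> complex) \<Rightarrow> bool" where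
  "fuchsian_at_cusps Q \<longleftrightarrow>
     (\<forall>a b c d :: int. a * d - b * c = 1 \<longrightarrow>
       holomorphic_at_cusp (\<lambda>z. (of_int c * z + of_int d) powi (-4) *
         Q ((of_int a * z + of_int b) / (of_int c * z + of_int d))))"

text \<open>The set is empty if \<open>Q\<close> has a pole of order greater than 2 at \<open>z0\<close>.\<close>
definition local_exponents :: "(complex \<Rightarrow> complex) \<Rightarrow> complex \<Rightarrow> complex set" where
  "local_exponents Q z0 =
     {x. \<exists>A. (\<lambda>z. Q z - A / (z - z0)\<^sup>2) \<in> O[at z0](\<lambda>z. 1 / (z - z0)) \<and>
             x * (x - 1) = - 4 * of_real pi ^ 2 * A}"

definition slit_ball :: "complex \<Rightarrow> real \<Rightarrow> complex set" where
  "slit_ball z0 r = {z \<in> ball z0 r. z - z0 \<notin> \<real>\<^sub>\<le>\<^sub>0}"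

text \<open>
  Near \<open>z0\<close> the multivalued solutions are represented by their branches on a disc slit along the
  branch cut of \<open>Ln (z - z0)\<close>. A logarithmic singularity is one where the logarithm genuinely
  occurs in the Frobenius expansion.
\<close>
definition has_log_solution :: "(complex \<Rightarrow> complex) \<Rightarrow> complex \<Rightarrow> bool" where
  "has_log_solution Q z0 \<longleftrightarrow>
     (\<exists>r>0. \<exists>y \<alpha> u v. solution_on Q (slit_ball z0 r) y \<and>
        u holomorphic_on ball z0 r \<and> v holomorphic_on ball z0 r \<and> (\<exists>z\<in>ball z0 r. u z \<noteq> 0) \<and>
        (\<forall>z\<in>slit_ball z0 r. y z = (z - z0) powr \<alpha> * (Ln (z - z0) * u z + v z)))"

definition apparent_at :: "(complex \<Rightarrow> complex) \<Rightarrow> complex \<Rightarrow> bool" where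
  "apparent_at Q z0 \<longleftrightarrow>
     (\<exists>n::nat. local_exponents Q z0 = {1/2 + of_nat n / 2, 1/2 - of_nat n / 2}) \<and>
     \<not> has_log_solution Q z0"

text \<open>The same at \<open>q = 0\<close>, where \<open>log q = 2 \<pi> \<i> z\<close> and \<open>q\<^sup>\<alpha> = exp (2 \<pi> \<i> \<alpha> z)\<close>.\<close>
definition has_log_solution_at_cusp :: "(complex \<Rightarrow> complex) \<Rightarrow> bool" where
  "has_log_solution_at_cusp Q \<longleftrightarrow>
     (\<exists>r>0. \<exists>y \<alpha> u v. solution_on Q {z \<in> uhp. qpar z \<in> ball 0 r} y \<and>
        u holomorphic_on ball 0 r \<and> v holomorphic_on ball 0 r \<and> (\<exists>w\<in>ball 0 r. u w \<noteq> 0) \<and>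
        (\<forall>z\<in>uhp. qpar z \<in> ball 0 r \<longrightarrow>
           y z = exp (2 * of_real pi * \<i> * \<alpha> * z) * (z * u (qpar z) + v (qpar z))))"

text \<open>The number \<open>n\<close> is \<open>2 \<kappa>\<close>, where \<open>\<kappa>\<^sup>2 = Q(\<infinity>)\<close>.\<close>
definition cusp_not_apparent :: "(complex \<Rightarrow> complex) \<Rightarrow> bool" where
  "cusp_not_apparent Q \<longleftrightarrow>
     (\<exists>F. \<exists>n::nat. F analytic_on {0} \<and> q_expansion Q F \<and> F 0 = (of_nat n / 2)\<^sup>2) \<and>
     has_log_solution_at_cusp Q"

end

theory Submission
  imports Defs
begin

text \<open>
  Let \<open>h = z f + 6 f1 / (\<pi> \<i>)\<close>. The quasimodularity of \<open>E2\<close> says that the pair \<open>(h, f)\<close> transforms under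
  \<open>SL(2,\<int>)\<close> by the standard representation with the factor \<open>j\<^bsup>k-1\<^esup>\<close>, where \<open>j = c z + d\<close>; hence its
  Wronskian \<open>W\<close> is modular of weight \<open>2 k\<close>. For every \<open>y\<close> in the span of \<open>h\<close> and \<open>f\<close>, the function
  \<open>y / \<surd>W\<close> solves the same equation \<open>g'' = R g\<close> with \<open>R = - 4 \<pi>\<^sup>2 Q\<close>, so the single-valued logarithmic
  derivative \<open>L = y' / y - W' / (2 W)\<close> satisfies the Riccati equation \<open>L' + L\<^sup>2 = R\<close>. All claims are read
  off from \<open>L\<close>: its transformation rule gives the weight 4 of \<open>R\<close>, and its residue
  \<open>x = ord y - ord W / 2\<close> gives the exponents \<open>x\<close> and \<open>1 - x\<close>. The solutions near \<open>z0\<close> are holomorphic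
  functions divided by \<open>\<surd>W\<close>, so no logarithm occurs, whereas at the cusp \<open>h / \<surd>W\<close> contains the factor
  \<open>z\<close>. At the elliptic points the stabilizer fixes \<open>ord W\<close> modulo 2 or 3 and, at \<open>\<rho>\<close>, also the order of
  the eigenvector \<open>h - \<rho> f\<close>.
\<close>

subsection \<open>Partial fractions\<close>

text \<open>\<open>E2\<close> is given only by its q-series, so its transformation law has to be
  derived. The Lambert series turns each row of the lattice sum over \<open>1 / (m z + n)^2\<close>
  into a multiple of \<open>1 / sin^2\<close>, and exchanging rows and columns exchanges
  \<open>z\<close> with \<open>- 1 / z\<close>. The defect of the resulting law is
  \<open>6 c (c z + d) / (\<pi> \<i>)\<close>; this is the origin of the constant in
  \<open>h\<close>.

  A branch of \<open>sqrt W\<close> has no global meaning and may change sign under the group; its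
  logarithmic derivative \<open>W' / (2 W)\<close> has neither defect. The quotient
  \<open>y / sqrt W\<close> has weight \<open>(k - 1) - k = -1\<close>, the one weight for which the
  second derivative transforms without correction terms, and this produces the weight 4.

  Twice the number kappa at a point is \<open>|2 ord y - ord W - 1|\<close>. Modulo 2 the choice of
  \<open>y\<close> is irrelevant, so at \<open>\<i>\<close> only \<open>ord W\<close> matters.
  Modulo 3 it is not, so at \<open>rho\<close> a \<open>y\<close> of controlled order is required,
  namely an eigenvector of the stabilizer.\<close>

lemma cot_reflection:
  fixes w :: complex
  assumes "w \<notin> \<int>"
  shows "Digamma (1 - w) - Digamma w = of_real pi * cot (of_real pi * w)"
proof -
  have w: "w \<notin> \<int>\<^sub>\<le>\<^sub>0" "1 - w \<notin> \<int>\<^sub>\<le>\<^sub>0"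
    using assms nonpos_Ints_Int by (auto dest: Ints_diff[OF Ints_1])
  have sin: "sin (of_real pi * w) \<noteq> 0"
    using assms by (auto simp: sin_eq_0 mult.commute)
  \<comment> \<open>The product rule for the reflection formula
    \<open>rGamma w * rGamma (1 - w) = sin (\<pi> w) / \<pi>\<close>, using that the derivative of
    \<open>rGamma\<close> is \<open>- rGamma * Digamma\<close>.\<close>
  define D where "D = - rGamma w * Digamma w * rGamma (1 - w) + rGamma w * (rGamma (1 - w) * Digamma (1 - w))"
  have "((\<lambda>w. rGamma w * rGamma (1 - w)) has_field_derivative D) (at w)"
    unfolding D_def using w
    by (auto intro!: derivative_eq_intros has_field_derivative_rGamma_no_nonpos_int)
  also have "(\<lambda>w. rGamma w * rGamma (1 - w)) = (\<lambda>w::complex. sin (of_real pi * w) / of_real pi)"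
    by (simp add: rGamma_reflection_complex fun_eq_iff)
  finally have 1: "((\<lambda>w. sin (of_real pi * w) / of_real pi) has_field_derivative D) (at w)" .
  have 2: "((\<lambda>w. sin (of_real pi * w) / of_real pi) has_field_derivative cos (of_real pi * w)) (at w)"
    by (auto intro!: derivative_eq_intros)
  have "D = cos (of_real pi * w)"
    using 1 2 by (rule DERIV_unique)
  moreover have "D = (rGamma w * rGamma (1 - w)) * (Digamma (1 - w) - Digamma w)"
    by (simp add: D_def algebra_simps)
  ultimately show ?thesis
    using sin by (simp add: rGamma_reflection_complex cot_def field_simps)
qed

text \<open>In the difference of the two Digamma series the Euler constant and the terms
  \<open>1 / (n + 1)\<close> cancel.\<close>

lemma cot_partial_fractions_sums:
  fixes w :: complex
  assumes "w \<notin> \<int>"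
  shows "(\<lambda>n. inverse (w + of_nat n) - inverse (1 - w + of_nat n)) sums (of_real pi * cot (of_real pi * w))"
proof -
  have "w \<noteq> 0" "1 - w \<noteq> 0" using assms by auto
  from this[THEN summable_Digamma, THEN summable_sums] show ?thesis
    unfolding cot_reflection[OF assms, symmetric]
    by (auto simp: Digamma_def dest: sums_diff)
qed

lemma trigamma_reflection:
  fixes w :: complex
  assumes "w \<notin> \<int>"
  shows "Polygamma 1 w + Polygamma 1 (1 - w) = of_real pi ^ 2 / sin (of_real pi * w) ^ 2"
proof -
  have w: "w \<notin> \<int>\<^sub>\<le>\<^sub>0" "1 - w \<notin> \<int>\<^sub>\<le>\<^sub>0"
    using assms nonpos_Ints_Int by (auto dest: Ints_diff[OF Ints_1])
  have sin: "sin (of_real pi * w) \<noteq> 0"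
    using assms by (auto simp: sin_eq_0 mult.commute)
  have op: "open (- \<int> :: complex set)"
    using closed_Ints by (simp add: open_Compl)
  have "((\<lambda>w. Digamma (1 - w) - Digamma w) has_field_derivative - Polygamma 1 (1 - w) - Polygamma 1 w) (at w)"
    using w by (auto intro!: derivative_eq_intros has_field_derivative_Polygamma)
  then have 1: "((\<lambda>w. of_real pi * cot (of_real pi * w)) has_field_derivative - Polygamma 1 (1 - w) - Polygamma 1 w) (at w)"
    by (rule has_field_derivative_transform_within_open[OF _ op])
       (use assms in \<open>auto simp: cot_reflection\<close>)
  have 2: "((\<lambda>w. of_real pi * cot (of_real pi * w)) has_field_derivative
              - (of_real pi ^ 2 / sin (of_real pi * w) ^ 2)) (at w)"
    using sin
    by (auto intro!: derivative_eq_intros DERIV_cot[THEN DERIV_chain2] simp: power2_eq_square field_simps)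
  from DERIV_unique[OF 1 2] show ?thesis
    by (simp add: algebra_simps minus_equation_iff)
qed

section \<open>Unconditional sums over the integers\<close>

lemma norm_lattice_point_ge:
  assumes "Im z \<noteq> 0"
  obtains d where "d > 0" "\<And>x y. d * (\<bar>x\<bar> + \<bar>y\<bar>) \<le> norm (of_real x * z + of_real y)"
proof
  define d where "d = 1 / (1 + (1 + norm z) / \<bar>Im z\<bar>)"
  have pos: "1 + (1 + norm z) / \<bar>Im z\<bar> > 0"
    using assms by (intro add_pos_nonneg) auto
  then show "d > 0" by (simp add: d_def)
  fix x y :: real
  define N where "N = norm (of_real x * z + of_real y)"
  \<comment> \<open>The imaginary part bounds \<open>x\<close>; subtracting \<open>x z\<close> then
    bounds \<open>y\<close>.\<close>
  have "\<bar>x\<bar> * \<bar>Im z\<bar> \<le> N"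
    using abs_Im_le_cmod[of "of_real x * z + of_real y"] by (simp add: N_def abs_mult)
  then have x: "\<bar>x\<bar> \<le> N / \<bar>Im z\<bar>" using assms by (simp add: field_simps)
  have "\<bar>y\<bar> = norm ((of_real x * z + of_real y) - of_real x * z)" by simp
  also have "\<dots> \<le> N + \<bar>x\<bar> * norm z"
    unfolding N_def by (rule order.trans[OF norm_triangle_ineq4]) (simp add: norm_mult)
  also have "\<dots> \<le> N + N / \<bar>Im z\<bar> * norm z"
    using x by (intro add_left_mono mult_right_mono) auto
  finally have "\<bar>x\<bar> + \<bar>y\<bar> \<le> N * (1 + (1 + norm z) / \<bar>Im z\<bar>)"
    using x by (simp add: algebra_simps add_divide_distrib)
  then show "d * (\<bar>x\<bar> + \<bar>y\<bar>) \<le> norm (of_real x * z + of_real y)"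
    using pos by (simp add: d_def N_def field_simps)
qed

text \<open>Enumerating the negative integers as \<open>- n - 1\<close> makes the two ranges a
  partition. Convergence of the one-sided series does not give an unconditional sum; summability is
  what identifies each limit with the sum over its range.\<close>

lemma has_sum_int:
  fixes f :: "int \<Rightarrow> 'a :: banach"
  assumes "f summable_on UNIV"
    and "(\<lambda>n. f (int n)) sums a" and "(\<lambda>n. f (- int n - 1)) sums b"
  shows "(f has_sum (a + b)) UNIV"
proof -
  have inj: "inj int" "inj (\<lambda>n. - int n - 1)" by (auto simp: inj_on_def)
  have s: "f summable_on range int" "f summable_on range (\<lambda>n. - int n - 1)"
    using assms(1) by (auto intro: summable_on_subset_banach)
  have "((f \<circ> int) has_sum (infsum f (range int))) UNIV"
    using s(1) inj(1) by (metis has_sum_reindex has_sum_infsum)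
  then have "infsum f (range int) = a"
    using assms(2) has_sum_imp_sums sums_unique2 by (fastforce simp: o_def)
  then have a: "(f has_sum a) (range int)" using s(1) by auto
  have "((f \<circ> (\<lambda>n. - int n - 1)) has_sum (infsum f (range (\<lambda>n. - int n - 1)))) UNIV"
    using s(2) inj(2) by (metis has_sum_reindex has_sum_infsum)
  then have "infsum f (range (\<lambda>n. - int n - 1)) = b"
    using assms(3) has_sum_imp_sums sums_unique2 by (fastforce simp: o_def)
  then have b: "(f has_sum b) (range (\<lambda>n. - int n - 1))" using s(2) by auto
  have "range int \<union> range (\<lambda>n. - int n - 1) = UNIV"
  proof -
    have "n \<in> range int \<union> range (\<lambda>n. - int n - 1)" for n
    proof (cases "n \<ge> 0")
      case True then show ?thesis by (auto intro!: image_eqI[of _ int "nat n"])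
    next
      case False then show ?thesis by (auto intro!: image_eqI[of _ "\<lambda>n. - int n - 1" "nat (- n - 1)"])
    qed
    then show ?thesis by blast
  qed
  moreover have "range int \<inter> range (\<lambda>n. - int n - 1) = {}" by auto
  ultimately show ?thesis using has_sum_Un_disjoint[OF a b] by simp
qed

lemma summable_on_int_powr:
  assumes "p > 1"
  shows "(\<lambda>n::int. (1 + \<bar>real_of_int n\<bar>) powr (-p)) summable_on UNIV"
proof -
  have sm: "summable (\<lambda>n. (1 + real n) powr (-p))"
    using summable_Suc_iff[of "\<lambda>n. real n powr (-p)"] assms by (simp add: summable_real_powr_iff)
  then have s1: "(\<lambda>n::nat. (1 + real n) powr (-p)) summable_on UNIV"
    by (subst summable_on_UNIV_nonneg_real_iff) auto
  have 1: "(\<lambda>n::int. (1 + \<bar>real_of_int n\<bar>) powr (-p)) summable_on range int"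
    using s1 by (subst summable_on_reindex) (auto simp: o_def inj_on_def)
  have 2: "(\<lambda>n::int. (1 + \<bar>real_of_int n\<bar>) powr (-p)) summable_on range (\<lambda>n. - int n)"
    using s1 by (subst summable_on_reindex) (auto simp: o_def inj_on_def)
  have "n \<in> range int \<union> range (\<lambda>n. - int n)" for n
    by (cases n rule: int_cases2) auto
  then have "range int \<union> range (\<lambda>n. - int n) = UNIV" by blast
  then show ?thesis using summable_on_union[OF 1 2] by simp
qed

lemma norm_inverse_square_le:
  assumes d: "0 < d" and c: "0 < c" "d * c \<le> norm w"
  shows "norm (1 / w ^ 2 :: complex) \<le> 1 / d\<^sup>2 * c powr (-2)"
proof -
  have "(d * c)\<^sup>2 \<le> norm w ^ 2" using assms by (intro power_mono) auto
  moreover have "0 < (d * c)\<^sup>2" "0 < norm w" using assms by (simp, smt (verit) mult_pos_pos)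
  ultimately have "1 / norm w ^ 2 \<le> 1 / (d * c)\<^sup>2"
    by (intro divide_left_mono) auto
  then show ?thesis using c
    by (simp add: norm_divide norm_power powr_minus power_mult_distrib divide_simps)
qed

lemma inverse_square_summable_int:
  assumes "Im z \<noteq> 0"
  shows "(\<lambda>n::int. 1 / (z + of_int n) ^ 2) summable_on UNIV"
proof -
  obtain d where d: "d > 0" "\<And>x y. d * (\<bar>x\<bar> + \<bar>y\<bar>) \<le> norm (of_real x * z + of_real y)"
    using norm_lattice_point_ge[OF assms] by metis
  have "(\<lambda>n::int. norm (1 / (z + of_int n) ^ 2)) summable_on UNIV"
  proof (rule summable_on_comparison_test)
    show "(\<lambda>n::int. 1 / d\<^sup>2 * (1 + \<bar>real_of_int n\<bar>) powr (-2)) summable_on UNIV"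
      by (intro summable_on_cmult_right summable_on_int_powr) auto
    fix n :: int
    show "norm (1 / (z + of_int n) ^ 2) \<le> 1 / d\<^sup>2 * (1 + \<bar>real_of_int n\<bar>) powr (-2)"
      using d(2)[of 1 "of_int n"] d(1) by (intro norm_inverse_square_le) auto
  qed auto
  then show ?thesis by (rule abs_summable_summable)
qed

text \<open>The terms with \<open>n \<ge> 0\<close> form the trigamma series at \<open>z\<close>,
  those with \<open>n < 0\<close> the one at \<open>1 - z\<close>, and trigamma reflection adds
  them.\<close>

lemma inverse_square_has_sum_int:
  assumes "Im z \<noteq> 0"
  shows "((\<lambda>n::int. 1 / (z + of_int n) ^ 2) has_sum (of_real pi ^ 2 / sin (of_real pi * z) ^ 2)) UNIV"
proof -
  have z: "z \<notin> \<int>" using assms by (auto elim!: Ints_cases)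
  then have z': "z \<noteq> 0" "1 - z \<noteq> 0" by auto
  have "(\<lambda>n. 1 / (z + of_int (int n)) ^ 2) sums Polygamma 1 z"
    using Polygamma_LIMSEQ[OF z'(1), of 1] by (simp add: divide_inverse power2_eq_square)
  moreover have "(\<lambda>n. 1 / (z + of_int (- int n - 1)) ^ 2) sums Polygamma 1 (1 - z)"
  proof -
    have "(z + of_int (- int n - 1)) ^ 2 = (1 - z + of_nat n)\<^sup>2" for n
      by (simp add: power2_eq_square algebra_simps)
    then show ?thesis
      using Polygamma_LIMSEQ[OF z'(2), of 1] by (simp add: divide_inverse power2_eq_square)
  qed
  ultimately show ?thesis
    using has_sum_int[OF inverse_square_summable_int[OF assms]]
    by (simp add: trigamma_reflection[OF z, symmetric])
qed

subsection \<open>The transformation law of the Eisenstein series of weight 2\<close>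

lemma norm_qpar: "norm (qpar z) = exp (- 2 * pi * Im z)"
  by (simp add: qpar_def norm_exp_eq_Re)

lemma norm_qpar_less_1_iff: "norm (qpar z) < 1 \<longleftrightarrow> z \<in> uhp"
  by (simp add: norm_qpar uhp_def zero_less_mult_iff)

lemma qpar_nonzero [simp]: "qpar z \<noteq> 0"
  by (simp add: qpar_def)

lemma qpar_of_nat_mult: "qpar (of_nat n * z) = qpar z ^ n"
  by (simp add: qpar_def exp_of_nat_mult [symmetric] algebra_simps)

text \<open>The left side is the sum of \<open>d q^d\<close> over \<open>d \<ge> 1\<close>, so this
  is the bridge from the Lambert series of \<open>E2\<close> to partial fractions.\<close>

lemma qpar_over_square:
  assumes "z \<in> uhp"
  shows "qpar z / (1 - qpar z)\<^sup>2 = - 1 / (4 * sin (of_real pi * z) ^ 2)"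
proof -
  define E where "E = exp (\<i> * (of_real pi * z))"
  have E: "E \<noteq> 0" "E * exp (- (\<i> * (of_real pi * z))) = 1"
    by (simp_all add: E_def flip: exp_add)
  have q: "qpar z = E\<^sup>2"
    by (simp add: qpar_def E_def flip: exp_of_nat_mult) (simp add: algebra_simps)
  have "sin (of_real pi * z) = (E - 1 / E) / (2 * \<i>)"
    unfolding sin_exp_eq using E by (simp add: E_def exp_minus field_simps)
  also have "\<dots> = (E\<^sup>2 - 1) / (2 * \<i> * E)"
    using E by (simp add: power2_eq_square field_simps)
  finally have s: "sin (of_real pi * z) = (E\<^sup>2 - 1) / (2 * \<i> * E)" .
  have "norm (qpar z) < 1" using assms norm_qpar_less_1_iff by simp
  then have "E\<^sup>2 \<noteq> 1" using q by auto
  then have "E\<^sup>2 - 1 \<noteq> 0" by simp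
  moreover have "(1 - E\<^sup>2)\<^sup>2 = (E\<^sup>2 - 1)\<^sup>2" by (simp add: power2_eq_square algebra_simps)
  ultimately show ?thesis
    unfolding q s by (simp add: power_divide power_mult_distrib power2_eq_square[of \<i>])
qed

text \<open>Lambert's rearrangement: a pair \<open>(m, d)\<close> of positive integers is the number
  \<open>n = m d\<close> with a marked divisor \<open>d\<close>. All indices except the divisor in
  \<open>G\<close> are shifted down by one.\<close>

lemma sum_divisors_double_series:
  fixes q :: complex
  assumes "norm q < 1"
  shows "((\<lambda>(m, d). of_nat (Suc d) * q ^ (Suc m * Suc d)) has_sum
           (\<Sum>n. of_nat (sigma1 (Suc n)) * q ^ Suc n)) (UNIV \<times> UNIV)"
    and "summable (\<lambda>n. of_nat (sigma1 (Suc n)) * q ^ Suc n)"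
proof -
  define r where "r = norm q"
  have r: "0 \<le> r" "r < 1" using assms by (auto simp: r_def)
  define F where "F = (\<lambda>(m, d). of_nat (Suc d) * q ^ (Suc m * Suc d))"
  define G where "G = (\<lambda>(n, d). of_nat d * q ^ Suc n)"
  define I where "I = (SIGMA n:UNIV. {d. d dvd Suc n})"
  have "(\<lambda>(m, d). real (Suc d) * (r ^ m * r ^ d)) summable_on (UNIV \<times> UNIV)"
  proof (rule summable_on_SigmaI)
    fix m :: nat
    have "(\<lambda>d. r ^ m * (real (Suc d) * r ^ d)) sums (r ^ m * (1 / (1 - r)\<^sup>2))"
      using r by (intro sums_mult geometric_deriv_sums) auto
    then have "((\<lambda>d. r ^ m * (real (Suc d) * r ^ d)) has_sum (r ^ m * (1 / (1 - r)\<^sup>2))) UNIV"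
      using r by (intro sums_nonneg_imp_has_sum) auto
    then show "((\<lambda>d. case (m, d) of (m, d) \<Rightarrow> real (Suc d) * (r ^ m * r ^ d)) has_sum r ^ m * (1 / (1 - r)\<^sup>2)) UNIV"
      by (simp add: mult_ac)
  next
    show "(\<lambda>m. r ^ m * (1 / (1 - r)\<^sup>2)) summable_on UNIV"
      using r by (intro summable_on_cmult_left summable_nonneg_imp_summable_on summable_geometric) auto
  qed (use r in auto)
  moreover have "norm (F x) \<le> (case x of (m, d) \<Rightarrow> real (Suc d) * (r ^ m * r ^ d))" for x
  proof (cases x)
    case (Pair m d)
    \<comment> \<open>Since \<open>(m + 1) (d + 1) \<ge> m + d\<close>, the double series is
      dominated by a product of one-variable series.\<close>
    have "r ^ (Suc m * Suc d) \<le> r ^ (m + d)"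
      using r by (intro power_decreasing) auto
    then have "real (Suc d) * r ^ (Suc m * Suc d) \<le> real (Suc d) * (r ^ m * r ^ d)"
      unfolding power_add by (rule mult_left_mono) auto
    then show ?thesis
      by (simp add: Pair F_def norm_mult norm_power r_def del: of_nat_Suc mult_Suc power_Suc)
  qed
  ultimately have "(\<lambda>x. norm (F x)) summable_on (UNIV \<times> UNIV)"
    by (rule summable_on_comparison_test) auto
  then have F: "(F has_sum infsum F (UNIV \<times> UNIV)) (UNIV \<times> UNIV)"
    by (rule has_sum_infsum[OF abs_summable_summable])
  also have "?this \<longleftrightarrow> (G has_sum infsum F (UNIV \<times> UNIV)) I"
  proof (rule has_sum_reindex_bij_witness[where j = "\<lambda>(m, d). (Suc m * Suc d - 1, Suc d)"
          and i = "\<lambda>(n, d). (Suc n div d - 1, d - 1)"])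
    have S: "Suc (Suc m * Suc d - 1) = Suc m * Suc d" for m d by simp
    fix a :: "nat \<times> nat"
    obtain m d where a: "a = (m, d)" by force
    show "(case case a of (m, d) \<Rightarrow> (Suc m * Suc d - 1, Suc d) of (n, d) \<Rightarrow> (Suc n div d - 1, d - 1)) = a"
      unfolding a prod.case S by (subst nonzero_mult_div_cancel_right) auto
    show "(case a of (m, d) \<Rightarrow> (Suc m * Suc d - 1, Suc d)) \<in> I"
      unfolding a prod.case I_def mem_Sigma_iff mem_Collect_eq S by (simp only: dvd_triv_right UNIV_I simp_thms)
    show "G (case a of (m, d) \<Rightarrow> (Suc m * Suc d - 1, Suc d)) = F a"
      unfolding a prod.case G_def F_def S by simp
  next
    fix b assume "b \<in> I"
    then obtain n d where b: "b = (n, d)" "d dvd Suc n" by (auto simp: I_def)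
    then obtain e where e: "Suc n = d * e" by (auto elim: dvdE)
    then have "d > 0" "e > 0" by (auto intro: Nat.gr0I)
    then have "Suc (e - 1) = e" "Suc (d - 1) = d" "Suc n div d = e" by (simp_all add: e)
    then show "(case case b of (n, d) \<Rightarrow> (Suc n div d - 1, d - 1) of (m, d) \<Rightarrow> (Suc m * Suc d - 1, Suc d)) = b"
      unfolding b prod.case using e by (metis diff_Suc_1 mult.commute)
  qed auto
  finally have *: "(G has_sum infsum F (UNIV \<times> UNIV)) I" .
  have "((\<lambda>n. of_nat (sigma1 (Suc n)) * q ^ Suc n) has_sum infsum F (UNIV \<times> UNIV)) UNIV"
    using *[unfolded I_def]
  proof (rule has_sum_SigmaD)
    fix n :: nat
    have "finite {d. d dvd Suc n}" by simp
    then show "((\<lambda>d. G (n, d)) has_sum of_nat (sigma1 (Suc n)) * q ^ Suc n) {d. d dvd Suc n}"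
      by (intro has_sum_finiteI) (simp_all add: G_def sigma1_def sum_distrib_right)
  qed
  then have "(\<lambda>n. of_nat (sigma1 (Suc n)) * q ^ Suc n) sums infsum F (UNIV \<times> UNIV)"
    by (rule has_sum_imp_sums)
  then have "summable (\<lambda>n. of_nat (sigma1 (Suc n)) * q ^ Suc n)"
    and "(\<Sum>n. of_nat (sigma1 (Suc n)) * q ^ Suc n) = infsum F (UNIV \<times> UNIV)"
    by (auto simp only: sums_iff)
  with F show "((\<lambda>(m, d). of_nat (Suc d) * q ^ (Suc m * Suc d)) has_sum
           (\<Sum>n. of_nat (sigma1 (Suc n)) * q ^ Suc n)) (UNIV \<times> UNIV)"
    and "summable (\<lambda>n. of_nat (sigma1 (Suc n)) * q ^ Suc n)" by (simp_all only: F_def)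
qed

text \<open>For fixed \<open>m\<close> the sum over \<open>d\<close> is a differentiated geometric
  series in \<open>qpar ((m + 1) z)\<close>. The factor \<open>\<pi>^2 / 6\<close> is
  \<open>- 4 \<pi>^2\<close> from the sine formula divided by the \<open>- 24\<close> in
  \<open>E2\<close>.\<close>

lemma E2_sin_has_sum_nat:
  assumes "z \<in> uhp"
  shows "((\<lambda>m. of_real pi ^ 2 / sin (of_real pi * (of_nat (Suc m) * z)) ^ 2) has_sum
           of_real pi ^ 2 / 6 * (E2 z - 1)) UNIV"
proof -
  define S where "S = (\<Sum>n. of_nat (sigma1 (Suc n)) * qpar z ^ Suc n)"
  have "norm (qpar z) < 1" using assms norm_qpar_less_1_iff by simp
  from sum_divisors_double_series(1)[OF this]
  have "((\<lambda>m. - 1 / (4 * sin (of_real pi * (of_nat (Suc m) * z)) ^ 2)) has_sum S) UNIV"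
    unfolding S_def [symmetric]
  proof (rule has_sum_SigmaD)
    fix m :: nat
    define x where "x = qpar (of_nat (Suc m) * z)"
    have u: "of_nat (Suc m) * z \<in> uhp" using assms
      by (simp add: uhp_def mult_pos_pos del: of_nat_Suc)
    then have x: "norm x < 1" using norm_qpar_less_1_iff by (simp add: x_def)
    have "((\<lambda>d. x * (of_nat (Suc d) * x ^ d)) has_sum (x * (1 / (1 - x)\<^sup>2))) UNIV"
    proof (intro has_sum_cmult_right norm_summable_imp_has_sum geometric_deriv_sums x)
      show "summable (\<lambda>d. norm (of_nat (Suc d) * x ^ d))"
        using sums_summable[OF geometric_deriv_sums[of "norm x"]] x
        by (simp add: norm_mult norm_power del: of_nat_Suc)
    qed
    also have "x * (1 / (1 - x)\<^sup>2) = - 1 / (4 * sin (of_real pi * (of_nat (Suc m) * z)) ^ 2)"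
      using qpar_over_square[OF u] by (simp add: x_def)
    also have "(\<lambda>d. x * (of_nat (Suc d) * x ^ d)) = (\<lambda>d. of_nat (Suc d) * qpar z ^ (Suc m * Suc d))"
      unfolding x_def qpar_of_nat_mult power_mult by (simp add: mult_ac)
    finally show "((\<lambda>d. case (m, d) of (m, d) \<Rightarrow> of_nat (Suc d) * qpar z ^ (Suc m * Suc d)) has_sum
        - 1 / (4 * sin (of_real pi * (of_nat (Suc m) * z)) ^ 2)) UNIV" by simp
  qed
  then have "((\<lambda>m. - 4 * of_real pi ^ 2 * (- 1 / (4 * sin (of_real pi * (of_nat (Suc m) * z)) ^ 2)))
      has_sum (- 4 * of_real pi ^ 2 * S)) UNIV"
    by (rule has_sum_cmult_right)
  also have "- 4 * of_real pi ^ 2 * S = of_real pi ^ 2 / 6 * (E2 z - 1)"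
    by (simp add: E2_def S_def)
  finally show ?thesis by (simp del: of_nat_Suc)
qed

lemma has_sum_even_int_nonzero:
  fixes f :: "int \<Rightarrow> 'a :: banach"
  assumes even: "\<And>n. f (- n) = f n"
    and S: "((\<lambda>n. f (int (Suc n))) has_sum S) UNIV"
  shows "(f has_sum (S + S)) (UNIV - {0})"
proof -
  have i: "inj (\<lambda>m. int (Suc m))" "inj (\<lambda>m. - int (Suc m))" by (auto simp: inj_on_def)
  have "((\<lambda>n. f (- int (Suc n))) has_sum S) UNIV" using S by (simp only: even)
  then have "(f has_sum S) (range (\<lambda>m. int (Suc m)))" "(f has_sum S) (range (\<lambda>m. - int (Suc m)))"
    using S by (auto simp: has_sum_reindex[OF i(1)] has_sum_reindex[OF i(2)] o_def simp del: of_nat_Suc)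
  then have "(f has_sum (S + S)) (range (\<lambda>m. int (Suc m)) \<union> range (\<lambda>m. - int (Suc m)))"
    by (rule has_sum_Un_disjoint) auto
  also have "range (\<lambda>m. int (Suc m)) \<union> range (\<lambda>m. - int (Suc m)) = UNIV - {0}"
  proof -
    have "n \<in> range (\<lambda>m. int (Suc m)) \<union> range (\<lambda>m. - int (Suc m))" if "n \<noteq> 0" for n
    proof (cases "n > 0")
      case True
      then have "n = int (Suc (nat (n - 1)))" by simp
      then show ?thesis by blast
    next
      case False
      with that have "n = - int (Suc (nat (- n - 1)))" by simp
      then show ?thesis by blast
    qed
    then show ?thesis by auto
  qed
  finally show ?thesis .
qed

text \<open>Each summand is row \<open>m\<close> of the sum of \<open>1 / (m z + n)^2\<close>, and
  \<open>\<pi>^2 / 3\<close> is \<open>2 zeta(2)\<close>: apart from the row \<open>m = 0\<close>,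
  this is \<open>E2\<close> as an iterated sum with rows first.\<close>

lemma E2_sin_has_sum:
  assumes "z \<in> uhp"
  shows "((\<lambda>m::int. of_real pi ^ 2 / sin (of_real pi * (of_int m * z)) ^ 2) has_sum
           of_real pi ^ 2 / 3 * (E2 z - 1)) (UNIV - {0})"
proof -
  have "((\<lambda>m. of_real pi ^ 2 / sin (of_real pi * (of_int (int (Suc m)) * z)) ^ 2) has_sum
           of_real pi ^ 2 / 6 * (E2 z - 1)) UNIV"
    using E2_sin_has_sum_nat[OF assms] by simp
  then have "((\<lambda>m::int. of_real pi ^ 2 / sin (of_real pi * (of_int m * z)) ^ 2) has_sum
           (of_real pi ^ 2 / 6 * (E2 z - 1) + of_real pi ^ 2 / 6 * (E2 z - 1))) (UNIV - {0})"
    by (intro has_sum_even_int_nonzero) simp_all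
  also have "of_real pi ^ 2 / 6 * (E2 z - 1) + of_real pi ^ 2 / 6 * (E2 z - 1) =
      of_real pi ^ 2 / 3 * (E2 z - 1)" by simp
  finally show ?thesis .
qed

text \<open>The difference of reciprocals is what the telescoping correction leaves after summation
  over \<open>- N \<le> n < N\<close>. Summed over \<open>m\<close>, it is the cotangent series at
  \<open>w = N / z\<close> without its term \<open>1 / w\<close>.\<close>

lemma cot_double_coset_sum:
  fixes z :: complex and N :: nat
  assumes z: "z \<in> uhp" and N: "N > 0"
    and S: "((\<lambda>m. 1 / (of_int m * z - of_nat N) - 1 / (of_int m * z + of_nat N)) has_sum S) (UNIV - {0})"
  shows "S = 2 / z * (z / of_nat N - of_real pi * cot (of_real pi * (of_nat N / z)))"
proof -
  define w where "w = of_nat N / z"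
  have z0: "z \<noteq> 0" using z by (auto simp: uhp_def)
  have w0: "w \<noteq> 0" using z0 N by (simp add: w_def)
  have "Im w \<noteq> 0"
    using z N by (auto simp: w_def uhp_def Im_divide complex_eq_iff sum_power2_eq_zero_iff)
  then have w: "w \<notin> \<int>" by (auto elim!: Ints_cases)
  have nz: "of_int m * z - of_nat N \<noteq> 0" "of_int m * z + of_nat N \<noteq> 0" if "m \<noteq> 0" for m
    using that z by (auto simp: complex_eq_iff uhp_def)
  define f where "f = (\<lambda>m. 1 / (of_int m * z - of_nat N) - 1 / (of_int m * z + of_nat N))"
  have even: "f (- m) = f m" for m
  proof -
    have "f (- m) = 1 / (- (of_int m * z + of_nat N)) - 1 / (- (of_int m * z - of_nat N))"
      by (simp add: f_def algebra_simps)
    then show ?thesis by (simp add: f_def del: minus_add_distrib minus_diff_eq)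
  qed
  define T where "T = - (of_real pi * cot (of_real pi * w) - 1 / w) / z"
  have T: "(\<lambda>n. f (int (Suc n))) sums T"
  proof -
    define h where "h = (\<lambda>n. inverse (w + of_nat n) - inverse (1 - w + of_nat n))"
    have "h sums (of_real pi * cot (of_real pi * w))"
      unfolding h_def by (rule cot_partial_fractions_sums[OF w])
    then have "(\<lambda>n. \<Sum>i<n. h i) \<longlonglongrightarrow> of_real pi * cot (of_real pi * w)"
      by (simp add: sums_def)
    moreover have "(\<lambda>n. inverse (w + of_nat n)) \<longlonglongrightarrow> 0"
      by (intro tendsto_inverse_0[THEN filterlim_compose]
          tendsto_add_filterlim_at_infinity[OF tendsto_const] tendsto_of_nat)
    ultimately have "(\<lambda>n. - ((\<Sum>i<n. h i) - 1 / w + inverse (w + of_nat n)) / z) \<longlonglongrightarrow>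
        - (of_real pi * cot (of_real pi * w) - 1 / w + 0) / z"
      by (intro tendsto_intros z0)
    \<comment> \<open>The cotangent series pairs \<open>1 - w + i\<close> with \<open>w + i\<close>,
      whereas \<open>f\<close> pairs it with \<open>w + (i + 1)\<close>. The shift accounts for the
      terms \<open>1 / w\<close> and \<open>1 / (w + n)\<close>; the latter vanishes in the
      limit.\<close>
    moreover have "(\<Sum>i<n. f (int (Suc i))) = - ((\<Sum>i<n. h i) - 1 / w + inverse (w + of_nat n)) / z" for n
    proof (induction n)
      case 0
      then show ?case by (simp add: inverse_eq_divide)
    next
      case (Suc n)
      have a: "w + of_nat n \<noteq> 0" "1 - w + of_nat n \<noteq> 0" "w + of_nat (Suc n) \<noteq> 0"
        using w by (metis Ints_of_nat add.commute add.inverse_inverse eq_neg_iff_add_eq_0 Ints_minus,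
           metis Ints_1 Ints_add Ints_of_nat add_diff_eq eq_iff_diff_eq_0 add.commute,
           metis Ints_of_nat add.commute add.inverse_inverse eq_neg_iff_add_eq_0 Ints_minus)
      have "f (int (Suc n)) = (1 / (of_nat (Suc n) - w) - 1 / (of_nat (Suc n) + w)) / z"
      proof -
        have "of_nat (Suc n) * z - of_nat N = (of_nat (Suc n) - w) * z"
          "of_nat (Suc n) * z + of_nat N = (of_nat (Suc n) + w) * z"
          using z0 by (simp_all add: w_def algebra_simps)
        then show ?thesis
          by (simp add: f_def diff_divide_distrib del: of_nat_Suc)
      qed
      also have "\<dots> = - (h n + inverse (w + of_nat (Suc n)) - inverse (w + of_nat n)) / z"
        using z0 by (simp add: h_def inverse_eq_divide algebra_simps)
      finally show ?case
        using Suc by (simp add: add_divide_distrib diff_divide_distrib)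
    qed
    ultimately show ?thesis by (simp add: sums_def T_def)
  qed
  have sm: "f summable_on UNIV - {0}" using S by (auto simp: f_def summable_on_def)
  have i: "inj (\<lambda>m. int (Suc m))" by (auto simp: inj_on_def)
  have "f summable_on range (\<lambda>m. int (Suc m))"
    using sm by (rule summable_on_subset_banach) auto
  then have "(\<lambda>m. f (int (Suc m))) summable_on UNIV"
    using summable_on_reindex[OF i, of f] by (simp add: o_def)
  then have "((\<lambda>m. f (int (Suc m))) has_sum T) UNIV"
    using T by (metis has_sum_imp_sums has_sum_infsum sums_unique2)
  then have "(f has_sum (T + T)) (UNIV - {0})"
    by (intro has_sum_even_int_nonzero even)
  then have "S = T + T" using S unfolding f_def by (rule has_sum_unique[rotated])
  moreover have "1 / w = z / of_nat N" by (simp add: w_def)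
  ultimately show ?thesis by (simp add: T_def diff_divide_distrib w_def algebra_simps)
qed

text \<open>With \<open>r = exp (- 2 \<pi> \<i> u)\<close> the cotangent is
  \<open>\<i> (1 + r^N) / (1 - r^N)\<close>, and \<open>|r| < 1\<close> because
  \<open>Im u < 0\<close>. It is applied to \<open>u = 1 / z\<close>.\<close>

lemma cot_limit_lower:
  fixes u :: complex
  assumes "Im u < 0"
  shows "(\<lambda>N. cot (of_real pi * (of_nat N * u))) \<longlonglongrightarrow> \<i>"
proof -
  define r where "r = exp (- 2 * \<i> * of_real pi * u)"
  have "norm r < 1" using assms by (simp add: r_def mult_pos_neg)
  then have lim: "(\<lambda>N. r ^ N) \<longlonglongrightarrow> 0" by (rule LIMSEQ_power_zero)
  have "(\<lambda>N. \<i> * (1 + r ^ N) / (1 - r ^ N)) \<longlonglongrightarrow> \<i> * (1 + 0) / (1 - 0)"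
    by (intro tendsto_intros lim) auto
  moreover have "cot (of_real pi * (of_nat N * u)) = \<i> * (1 + r ^ N) / (1 - r ^ N)" for N
  proof -
    define x where "x = of_real pi * (of_nat N * u)"
    define E where "E = exp (\<i> * x)"
    have E: "E \<noteq> 0" "exp (- (\<i> * x)) = 1 / E" by (simp_all add: E_def exp_minus inverse_eq_divide)
    have r: "r ^ N = 1 / E\<^sup>2"
    proof -
      have "r ^ N = exp (of_nat N * (- 2 * \<i> * of_real pi * u))"
        by (simp only: r_def exp_of_nat_mult)
      also have "of_nat N * (- 2 * \<i> * of_real pi * u) = - (\<i> * x) + - (\<i> * x)"
        by (simp add: x_def algebra_simps)
      also have "exp \<dots> = 1 / E * (1 / E)" by (simp only: exp_add E(2))
      finally show ?thesis by (simp add: power2_eq_square)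
    qed
    have "cot x = (E + 1 / E) / 2 / ((E - 1 / E) / (2 * \<i>))"
      unfolding cot_def cos_exp_eq sin_exp_eq using E(2) by (simp add: E_def)
    also have "\<dots> = \<i> * (1 + 1 / E\<^sup>2) / (1 - 1 / E\<^sup>2)"
    proof -
      have "E + 1 / E = E * (1 + 1 / E\<^sup>2)" "E - 1 / E = E * (1 - 1 / E\<^sup>2)"
        using E(1) by (simp_all add: field_simps power2_eq_square)
      moreover have "(E * a) / 2 / ((E * b) / (2 * \<i>)) = \<i> * a / b" for a b
        using E(1) by (cases "b = 0") (simp_all add: field_simps)
      ultimately show ?thesis by (simp only:)
    qed
    finally show ?thesis by (simp add: r x_def)
  qed
  ultimately show ?thesis by simp
qed

text \<open>
  The series of \<open>1 / (m z + n)\<^sup>2\<close> converges only conditionally. Subtracting the telescoping term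
  \<open>1 / (m z + n) - 1 / (m z + n + 1)\<close> makes it absolutely convergent; the row sums of this term vanish,
  while its column sums add up to \<open>- 2 \<pi> \<i> / z\<close>, which is the defect of modularity of \<open>E2\<close>.
\<close>
lemma E2_correction_summable:
  assumes z: "z \<in> uhp"
  shows "(\<lambda>(m::int, n::int). 1 / (of_int m * z + of_int n) ^ 2
            - (1 / (of_int m * z + of_int n) - 1 / (of_int m * z + of_int (n + 1))))
          summable_on ((UNIV - {0}) \<times> UNIV)"
proof -
  have imz: "Im z \<noteq> 0" using z by (auto simp: uhp_def)
  obtain d where d: "d > 0" "\<And>x y. d * (\<bar>x\<bar> + \<bar>y\<bar>) \<le> norm (of_real x * z + of_real y)"
    using norm_lattice_point_ge[OF imz] by metis
  define K where "K = 2 / d ^ 3"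
  define b where "b = (\<lambda>n::int. (1 + \<bar>real_of_int n\<bar>) powr (-(3/2)))"
  have b: "b summable_on A" for A
    unfolding b_def by (rule summable_on_subset_banach[OF summable_on_int_powr]) auto
  have "(\<lambda>(m, n). K * (2 powr (3/2)) * (b m * b n)) summable_on ((UNIV - {0}) \<times> UNIV)"
  proof (rule summable_on_SigmaI)
    fix m :: int
    show "((\<lambda>n. case (m, n) of (m, n) \<Rightarrow> K * (2 powr (3/2)) * (b m * b n)) has_sum
              K * (2 powr (3/2)) * (b m * infsum b UNIV)) UNIV"
      unfolding prod.case by (intro has_sum_cmult_right has_sum_infsum b)
    show "(\<lambda>m. K * (2 powr (3/2)) * (b m * infsum b UNIV)) summable_on UNIV - {0}"
      by (intro summable_on_cmult_right summable_on_cmult_left b)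
  qed (use d in \<open>auto simp: K_def b_def\<close>)
  then have "(\<lambda>x. norm (case x of (m::int, n::int) \<Rightarrow> 1 / (of_int m * z + of_int n) ^ 2
            - (1 / (of_int m * z + of_int n) - 1 / (of_int m * z + of_int (n + 1)))))
          summable_on ((UNIV - {0}) \<times> UNIV)"
  proof (rule summable_on_comparison_test)
    fix x :: "int \<times> int" assume "x \<in> (UNIV - {0}) \<times> UNIV"
    then obtain m n where x: "x = (m, n)" "m \<noteq> 0" by auto
    define p where "p = of_int m * z + of_int n"
    define M where "M = \<bar>real_of_int m\<bar>"
    define N where "N = \<bar>real_of_int n\<bar>"
    have M: "M \<ge> 1" using x(2) by (simp add: M_def)
    have N: "N \<ge> 0" by (simp add: N_def)
    have p: "d * (M + N) \<le> norm p"
      using d(2)[of "of_int m" "of_int n"] by (simp add: p_def M_def N_def)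
    have "d * (M + \<bar>real_of_int (n + 1)\<bar>) \<le> norm (p + 1)"
      using d(2)[of "of_int m" "of_int (n + 1)"] by (simp add: p_def M_def add.assoc)
    \<comment> \<open>Passing to \<open>n + 1\<close> loses at most 1 in \<open>N\<close>;
      \<open>M \<ge> 1\<close> compensates for this at the cost of a factor 2.\<close>
    moreover have "(M + N) / 2 \<le> M + \<bar>real_of_int (n + 1)\<bar>"     proof -
      have "(M + N) / 2 \<le> M + X" if "N \<le> X + 1" "0 \<le> X" for X
        using that M by (simp add: field_simps)
      moreover have "N \<le> \<bar>real_of_int (n + 1)\<bar> + 1" unfolding N_def by simp
      ultimately show ?thesis by (meson abs_ge_zero)
    qed
    ultimately have p1: "d * ((M + N) / 2) \<le> norm (p + 1)"
      using d(1) by (meson mult_left_mono less_imp_le order.trans)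
    have pos: "0 < d * (M + N)" "0 < d * ((M + N) / 2)"
      using d(1) M N by (auto intro!: mult_pos_pos)
    then have nz: "p \<noteq> 0" "p + 1 \<noteq> 0" using p p1 by auto
    \<comment> \<open>The correction raises the decay from order 2 to order 3, which suffices on a
      lattice of rank 2.\<close>
    have "1 / p\<^sup>2 - (1 / p - 1 / (p + 1)) = 1 / (p\<^sup>2 * (p + 1))"
      using nz by (simp add: divide_simps power2_eq_square)
    then have "norm (1 / p\<^sup>2 - (1 / p - 1 / (p + 1))) = 1 / (norm p ^ 2 * norm (p + 1))"
      by (simp add: norm_divide norm_mult norm_power)
    also have "\<dots> \<le> 1 / ((d * (M + N))\<^sup>2 * (d * ((M + N) / 2)))"
      using p p1 pos nz d(1) M N by (intro divide_left_mono mult_mono power_mono mult_pos_pos zero_less_power) auto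
    also have "\<dots> = K / (M + N) ^ 3"
      by (simp add: K_def power2_eq_square power3_eq_cube field_simps)
    also have "\<dots> = K * ((M + N) powr (-(3/2)) * (M + N) powr (-(3/2)))"
      using M N by (simp add: powr_minus_divide flip: powr_add powr_numeral)
    \<comment> \<open>The cube is split into two powers \<open>3 / 2 > 1\<close>, one bounded
      through \<open>M\<close> and one through \<open>N\<close>, to reach a product of summable
      functions. Both bounds \<open>M + N \<ge> (1 + M) / 2\<close> and
      \<open>M + N \<ge> 1 + N\<close> come from \<open>M \<ge> 1\<close>.\<close>
    also have "\<dots> \<le> K * ((((1 + M) / 2) powr (-(3/2))) * ((1 + N) powr (-(3/2))))"
      using M N d(1) by (intro mult_left_mono mult_mono powr_mono2') (auto simp: K_def)
    also have "((1 + M) / 2) powr (-(3/2)) = 2 powr (3/2) * (1 + M) powr (-(3/2))"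
      using M by (simp add: powr_divide powr_minus_divide)
    finally show "norm (case x of (m::int, n::int) \<Rightarrow> 1 / (of_int m * z + of_int n) ^ 2
            - (1 / (of_int m * z + of_int n) - 1 / (of_int m * z + of_int (n + 1))))
        \<le> (case x of (m, n) \<Rightarrow> K * (2 powr (3/2)) * (b m * b n))"
      by (simp add: x p_def b_def M_def N_def add.assoc mult_ac)
  qed auto
  then show ?thesis by (rule abs_summable_summable)
qed

text \<open>The window is half-open because the correction joins \<open>n\<close> to
  \<open>n + 1\<close>: over it the telescoping sum leaves exactly the end points \<open>- N\<close>
  and \<open>N\<close>.\<close>

lemma filterlim_symmetric_int_interval:
  "filterlim (\<lambda>N::nat. {- int N..<int N}) (finite_subsets_at_top UNIV) sequentially"
proof (rule filterlim_finite_subsets_at_top[THEN iffD2, rule_format])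
  fix X :: "int set" assume "finite X \<and> X \<subseteq> UNIV"
  then obtain B where B: "\<And>x. x \<in> X \<Longrightarrow> \<bar>x\<bar> \<le> B"
    by (metis Max_ge finite_imageI image_eqI)
  have "eventually (\<lambda>N. N \<ge> nat (B + 1)) sequentially" by (rule eventually_ge_at_top)
  then show "\<forall>\<^sub>F N in sequentially. finite {- int N..<int N} \<and> X \<subseteq> {- int N..<int N} \<and> {- int N..<int N} \<subseteq> UNIV"
    by eventually_elim (use B in force)
qed

text \<open>The value \<open>2 zeta(2)\<close>. It enters twice below: as the column
  \<open>n = 0\<close>, up to the factor \<open>1 / z^2\<close>, and as the total of the points with
  \<open>m = 0\<close>, which are absent from the other columns.\<close>

lemma inverse_squares_has_sum_int:
  "((\<lambda>n::int. 1 / of_int n ^ 2 :: complex) has_sum (of_real pi ^ 2 / 3)) (UNIV - {0})"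
proof -
  have "(\<lambda>n. 1 / real (n + 1) ^ 2) sums (pi ^ 2 / 6)"
    using inverse_squares_sums by (simp add: add.commute)
  then have "((\<lambda>n. 1 / real (n + 1) ^ 2) has_sum (pi ^ 2 / 6)) UNIV"
    by (rule sums_nonneg_imp_has_sum) auto
  then have "((\<lambda>n. of_real (1 / real (n + 1) ^ 2) :: complex) has_sum (of_real (pi ^ 2 / 6))) UNIV"
    by (rule has_sum_of_real)
  then have h: "((\<lambda>n. 1 / of_int (int (Suc n)) ^ 2 :: complex) has_sum (of_real pi ^ 2 / 6)) UNIV"
    by simp
  have "((\<lambda>n::int. 1 / of_int n ^ 2 :: complex) has_sum
      (of_real pi ^ 2 / 6 + of_real pi ^ 2 / 6)) (UNIV - {0})"
    by (rule has_sum_even_int_nonzero[OF _ h]) simp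
  then show ?thesis by simp
qed

lemma has_sum_diff:
  fixes f g :: "'a \<Rightarrow> 'b :: topological_ab_group_add"
  assumes "(f has_sum a) A" "(g has_sum b) A"
  shows "((\<lambda>x. f x - g x) has_sum (a - b)) A"
  using has_sum_add[OF assms(1), of "\<lambda>x. - g x" "- b"] assms(2) by (simp add: has_sum_uminus)

lemma has_sum_sum:
  fixes f :: "'i \<Rightarrow> 'a \<Rightarrow> 'b :: topological_comm_monoid_add"
  assumes "\<And>i. (f i has_sum S i) A"
  shows "((\<lambda>x. \<Sum>i\<in>I. f i x) has_sum (\<Sum>i\<in>I. S i)) A"
  by (induction I rule: infinite_finite_induct) (auto intro: has_sum_add assms)

text \<open>The corrected sum \<open>E\<close> over \<open>m \<noteq> 0\<close> converges absolutely
  and is evaluated in both orders. Rows express it by \<open>E2 z\<close>, columns by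
  \<open>E2 (- 1 / z)\<close> and the total of the correction.\<close>

lemma E2_transform_S:
  assumes z: "z \<in> uhp"
  shows "E2 (- 1 / z) = z ^ 2 * E2 z + 6 * z / (of_real pi * \<i>)"
proof -
  have imz: "Im z > 0" using z by (simp add: uhp_def)
  have z0: "z \<noteq> 0" using imz by auto
  have z': "- 1 / z \<in> uhp"
    using imz by (simp add: uhp_def Im_divide zero_less_divide_iff sum_power2_gt_zero_iff)
  define a where "a = (\<lambda>m n::int. 1 / (of_int m * z + of_int n) ^ 2)"
  define c where "c = (\<lambda>m n::int. 1 / (of_int m * z + of_int n) - 1 / (of_int m * z + of_int (n + 1)))"
  define e where "e = (\<lambda>(m, n). a m n - c m n)"
  define E where "E = infsum e ((UNIV - {0}) \<times> UNIV)"
  have e: "e summable_on ((UNIV - {0}) \<times> UNIV)"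
    using E2_correction_summable[OF z] by (simp add: e_def a_def c_def)
  then have E: "(e has_sum E) ((UNIV - {0}) \<times> UNIV)" by (simp add: E_def)

  have row_a: "(a m has_sum of_real pi ^ 2 / sin (of_real pi * (of_int m * z)) ^ 2) UNIV"
    if "m \<noteq> 0" for m
    unfolding a_def using that imz by (intro inverse_square_has_sum_int) auto
  have row_e: "(\<lambda>n. e (m, n)) summable_on UNIV" if "m \<noteq> 0" for m
    using summable_on_SigmaD1[of "\<lambda>m n. e (m, n)" "UNIV - {0}" "\<lambda>_. UNIV" m] e that by simp
  \<comment> \<open>The two half-lines telescope to \<open>1 / (m z)\<close> and
    \<open>- 1 / (m z)\<close>. Unconditional summability is inherited from the main and the
    corrected terms.\<close>
  have row_c: "(c m has_sum 0) UNIV" if m: "m \<noteq> 0" for m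
  proof -
    have "(\<lambda>n. a m n - e (m, n)) summable_on UNIV"
      by (rule has_sum_imp_summable[OF has_sum_diff[OF row_a[OF m] has_sum_infsum[OF row_e[OF m]]]])
    then have s: "c m summable_on UNIV" by (simp add: e_def)
    have inf: "filterlim (\<lambda>k. of_int m * z + of_nat k) at_infinity sequentially"
      "filterlim (\<lambda>k. of_int m * z - of_nat k) at_infinity sequentially"
    proof -
      show "filterlim (\<lambda>k. of_int m * z + of_nat k) at_infinity sequentially"
        by (intro tendsto_add_filterlim_at_infinity[OF tendsto_const] tendsto_of_nat)
      have "filterlim (\<lambda>k. - (- of_int m * z + of_nat k)) at_infinity sequentially"
        unfolding filterlim_at_infinity_conv_norm_at_top norm_minus_cancel
        unfolding filterlim_at_infinity_conv_norm_at_top [symmetric]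
        by (intro tendsto_add_filterlim_at_infinity[OF tendsto_const] tendsto_of_nat)
      then show "filterlim (\<lambda>k. of_int m * z - of_nat k) at_infinity sequentially" by simp
    qed
    have "(\<lambda>k. - inverse (of_int m * z + of_nat (Suc k)) - - inverse (of_int m * z + of_nat k)) sums
        (- 0 - - inverse (of_int m * z + of_nat 0))"
      by (intro telescope_sums tendsto_minus filterlim_compose[OF tendsto_inverse_0 inf(1)])
    then have 1: "(\<lambda>k. c m (int k)) sums (1 / (of_int m * z))"
      by (simp add: c_def inverse_eq_divide add_ac)
    have "(\<lambda>k. inverse (of_int m * z - of_nat (Suc k)) - inverse (of_int m * z - of_nat k)) sums
        (0 - inverse (of_int m * z - of_nat 0))"
      by (intro telescope_sums filterlim_compose[OF tendsto_inverse_0 inf(2)])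
    then have 2: "(\<lambda>k. c m (- int k - 1)) sums (- (1 / (of_int m * z)))"
      by (simp add: c_def inverse_eq_divide algebra_simps)
    show ?thesis using has_sum_int[OF s 1 2] by simp
  qed
  have "((\<lambda>m. of_real pi ^ 2 / sin (of_real pi * (of_int m * z)) ^ 2) has_sum E) (UNIV - {0})"
  proof (rule has_sum_SigmaD[OF E])
    fix m :: int assume "m \<in> UNIV - {0}"
    then show "((\<lambda>n. e (m, n)) has_sum of_real pi ^ 2 / sin (of_real pi * (of_int m * z)) ^ 2) UNIV"
      using has_sum_diff[OF row_a row_c, of m m] by (simp add: e_def)
  qed
  then have E_eq: "E = of_real pi ^ 2 / 3 * (E2 z - 1)"
    using E2_sin_has_sum[OF z] by (rule has_sum_unique)

  \<comment> \<open>Column sums of the main terms. Pulling out \<open>z^2\<close> turns column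
    \<open>n\<close> into a row sum at \<open>n / z\<close>, from which the point
    \<open>m = 0\<close> is removed. The squared sine is even, so \<open>n / z\<close> may be
    replaced by \<open>n (- 1 / z)\<close>, the form in which \<open>E2 (- 1 / z)\<close>
    appears.\<close>
  define A where "A = (\<lambda>n::int. if n = 0 then 1 / z ^ 2 * (of_real pi ^ 2 / 3)
      else 1 / z ^ 2 * (of_real pi ^ 2 / sin (of_real pi * (of_int n * (- 1 / z))) ^ 2) - 1 / of_int n ^ 2)"
  have col_a: "((\<lambda>m. a m n) has_sum A n) (UNIV - {0})" for n
  proof (cases "n = 0")
    case True
    have "((\<lambda>m. 1 / z ^ 2 * (1 / of_int m ^ 2)) has_sum 1 / z ^ 2 * (of_real pi ^ 2 / 3)) (UNIV - {0::int})"
      by (intro has_sum_cmult_right inverse_squares_has_sum_int)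
    then show ?thesis by (simp add: True A_def a_def power_mult_distrib mult_ac)
  next
    case False
    have "Im (of_int n / z) \<noteq> 0"
      using imz False by (auto simp: Im_divide sum_power2_eq_zero_iff)
    from inverse_square_has_sum_int[OF this]
    have "((\<lambda>m::int. 1 / z ^ 2 * (1 / (of_int n / z + of_int m) ^ 2)) has_sum
        1 / z ^ 2 * (of_real pi ^ 2 / sin (of_real pi * (of_int n / z)) ^ 2)) UNIV"
      by (rule has_sum_cmult_right)
    moreover have "1 / z ^ 2 * (1 / (of_int n / z + of_int m) ^ 2) = a m n" for m
    proof -
      have "of_int m * z + of_int n = z * (of_int n / z + of_int m)" using z0 by (simp add: field_simps)
      then show ?thesis unfolding a_def by (simp add: power_mult_distrib)
    qed
    ultimately have "((\<lambda>m. a m n) has_sum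
        1 / z ^ 2 * (of_real pi ^ 2 / sin (of_real pi * (of_int n / z)) ^ 2)) UNIV" by simp
    moreover have "((\<lambda>m. a m n) has_sum a 0 n) {0}"
      using has_sum_finite[of "{0}" "\<lambda>m. a m n"] by simp
    ultimately have "((\<lambda>m. a m n) has_sum
        (1 / z ^ 2 * (of_real pi ^ 2 / sin (of_real pi * (of_int n / z)) ^ 2) - a 0 n)) (UNIV - {0})"
      by (rule has_sum_Diff) auto
    then show ?thesis using False by (simp add: A_def a_def)
  qed
  have "((\<lambda>n::int. 1 / z ^ 2 * (of_real pi ^ 2 / sin (of_real pi * (of_int n * (- 1 / z))) ^ 2) - 1 / of_int n ^ 2)
      has_sum (1 / z ^ 2 * (of_real pi ^ 2 / 3 * (E2 (- 1 / z) - 1)) - of_real pi ^ 2 / 3)) (UNIV - {0})"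
    by (intro has_sum_diff has_sum_cmult_right E2_sin_has_sum z' inverse_squares_has_sum_int)
  then have "(A has_sum (1 / z ^ 2 * (of_real pi ^ 2 / 3 * (E2 (- 1 / z) - 1)) - of_real pi ^ 2 / 3)) (UNIV - {0})"
    by (rule has_sum_cong[THEN iffD1, rotated]) (simp add: A_def)
  then have "(A has_sum (A 0 + (1 / z ^ 2 * (of_real pi ^ 2 / 3 * (E2 (- 1 / z) - 1)) - of_real pi ^ 2 / 3)))
      (insert 0 (UNIV - {0}))"
    by (intro has_sum_insert) auto
  then have A: "(A has_sum (1 / z ^ 2 * (of_real pi ^ 2 / 3) * E2 (- 1 / z) - of_real pi ^ 2 / 3)) UNIV"
    by (simp add: A_def insert_absorb algebra_simps insert_UNIV diff_divide_distrib)

  \<comment> \<open>Column sums of the correction. What is evaluated is their sum over symmetric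
    windows, by telescoping in \<open>n\<close> before summing over \<open>m\<close>.\<close>
  define C where "C = (\<lambda>n. infsum (\<lambda>m. c m n) (UNIV - {0}))"
  have e': "(\<lambda>(n, m). e (m, n)) summable_on (UNIV \<times> (UNIV - {0}))"
    using e summable_on_swap by blast
  have col_e: "(\<lambda>m. e (m, n)) summable_on UNIV - {0}" for n
    using summable_on_SigmaD1[OF e', of n] by simp
  have col_c: "((\<lambda>m. c m n) has_sum C n) (UNIV - {0})" for n
  proof -
    have "(\<lambda>m. a m n - e (m, n)) summable_on UNIV - {0}"
      by (rule has_sum_imp_summable[OF has_sum_diff[OF col_a has_sum_infsum[OF col_e]]])
    then show ?thesis unfolding C_def by (intro has_sum_infsum) (simp add: e_def)
  qed
  have "((\<lambda>(n, m). e (m, n)) has_sum E) (UNIV \<times> (UNIV - {0}))"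
    using E has_sum_swap by blast
  then have "((\<lambda>n. A n - C n) has_sum E) UNIV"
  proof (rule has_sum_SigmaD)
    fix n :: int
    show "((\<lambda>m. case (n, m) of (n, m) \<Rightarrow> e (m, n)) has_sum A n - C n) (UNIV - {0})"
      using has_sum_diff[OF col_a col_c, of n n] by (simp add: e_def)
  qed
  then have "((\<lambda>n. A n - (A n - C n)) has_sum
      ((1 / z ^ 2 * (of_real pi ^ 2 / 3) * E2 (- 1 / z) - of_real pi ^ 2 / 3) - E)) UNIV"
    by (intro has_sum_diff A)
  then have "(sum C \<longlongrightarrow> (1 / z ^ 2 * (of_real pi ^ 2 / 3) * E2 (- 1 / z) - of_real pi ^ 2 / 3) - E)
      (finite_subsets_at_top UNIV)"
    by (simp add: has_sum_def)
  from filterlim_compose[OF this filterlim_symmetric_int_interval]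
  have lim1: "(\<lambda>N. sum C {- int N..<int N}) \<longlonglongrightarrow>
      (1 / z ^ 2 * (of_real pi ^ 2 / 3) * E2 (- 1 / z) - of_real pi ^ 2 / 3) - E" .
  have "sum C {- int N..<int N} = 2 / z * (z / of_nat N - of_real pi * cot (of_real pi * (of_nat N * (1 / z))))"
    if N: "N > 0" for N
  proof -
    have "((\<lambda>m. \<Sum>n\<in>{- int N..<int N}. c m n) has_sum sum C {- int N..<int N}) (UNIV - {0})"
      by (intro has_sum_sum col_c)
    moreover have "(\<Sum>n\<in>{- int N..<int N}. c m n) = 1 / (of_int m * z - of_nat N) - 1 / (of_int m * z + of_nat N)" for m
    proof (induction N)
      case (Suc N)
      have "{- int (Suc N)..<int (Suc N)} = insert (- int (Suc N)) (insert (int N) {- int N..<int N})" by auto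
      then show ?case using Suc by (simp add: c_def algebra_simps)
    qed simp
    ultimately show ?thesis using cot_double_coset_sum[OF z N] by simp
  qed
  then have "\<forall>\<^sub>F N in sequentially. sum C {- int N..<int N} =
      2 / z * (z / of_nat N - of_real pi * cot (of_real pi * (of_nat N * (1 / z))))"
    by (rule eventually_mono[OF eventually_gt_at_top[of 0]])
  moreover have "(\<lambda>N. 2 / z * (z / of_nat N - of_real pi * cot (of_real pi * (of_nat N * (1 / z)))))
      \<longlonglongrightarrow> 2 / z * (0 - of_real pi * \<i>)"
    using z' by (intro tendsto_intros cot_limit_lower lim_const_over_n) (simp add: uhp_def)
  ultimately have lim2: "(\<lambda>N. sum C {- int N..<int N}) \<longlonglongrightarrow> 2 / z * (0 - of_real pi * \<i>)"
    by (simp add: tendsto_cong)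
  have "(1 / z ^ 2 * (of_real pi ^ 2 / 3) * E2 (- 1 / z) - of_real pi ^ 2 / 3) -
      of_real pi ^ 2 / 3 * (E2 z - 1) = 2 / z * (0 - of_real pi * \<i>)"
    using LIMSEQ_unique[OF lim1 lim2] by (simp add: E_eq)
  then have "3 * z ^ 2 * ((1 / z ^ 2 * (of_real pi ^ 2 / 3) * E2 (- 1 / z) - of_real pi ^ 2 / 3) -
      of_real pi ^ 2 / 3 * (E2 z - 1)) = 3 * z ^ 2 * (2 / z * (0 - of_real pi * \<i>))" (is "?l = ?r") by (rule arg_cong)
  also have "?l = of_real pi ^ 2 * E2 (- 1 / z) - of_real pi ^ 2 * (z ^ 2 * E2 z)"
    using z0 by (simp add: field_simps)
  also have "?r = - (6 * of_real pi * \<i> * z)"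
    using z0 by (simp add: power2_eq_square)
  finally have "of_real pi ^ 2 * E2 (- 1 / z) = of_real pi ^ 2 * (z ^ 2 * E2 z) - 6 * of_real pi * \<i> * z"
    by (simp only: diff_eq_eq) simp
  also have "\<dots> = of_real pi ^ 2 * (z ^ 2 * E2 z + 6 * z / (of_real pi * \<i>))"
    by (simp add: field_simps power2_eq_square)
  finally show ?thesis by simp
qed

section \<open>The action of the modular group and the general law for \<open>E2\<close>\<close>

lemma open_uhp: "open uhp"
  unfolding uhp_def by (simp add: open_halfspace_Im_gt)

lemma connected_uhp: "connected uhp"
  unfolding uhp_def by (intro convex_connected convex_halfspace_Im_gt)

lemma moebius_in_uhp:
  fixes a b c d :: int
  assumes "a * d - b * c = 1" "z \<in> uhp"
  shows "of_int c * z + of_int d \<noteq> 0" "(of_int a * z + of_int b) / (of_int c * z + of_int d) \<in> uhp"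
proof -
  have imz: "Im z > 0" using assms by (simp add: uhp_def)
  show nz: "of_int c * z + of_int d \<noteq> 0"
    using imz assms(1) by (auto simp: complex_eq_iff)
  have "real_of_int (a * d - b * c) = 1" using assms(1) by simp
  then have det: "of_int a * of_int d - of_int b * of_int c = (1::real)" by simp
  have "Im ((of_int a * z + of_int b) / (of_int c * z + of_int d)) =
     ((of_int a * of_int d - of_int b * of_int c) * Im z) / (norm (of_int c * z + of_int d))\<^sup>2"
    by (simp add: Im_divide cmod_power2) (simp add: algebra_simps)
  then show "(of_int a * z + of_int b) / (of_int c * z + of_int d) \<in> uhp"
    using imz nz det by (simp add: uhp_def)
qed

lemma qpar_add_of_int [simp]: "qpar (z + of_int n) = qpar z"
  unfolding qpar_def by (simp add: algebra_simps exp_add)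

lemma E2_add_of_int: "E2 (z + of_int n) = E2 z"
  by (simp add: E2_def)

text \<open>Euclidean algorithm on the bottom row: translation by \<open>n = d div c\<close>
  replaces \<open>d\<close> by \<open>d mod c\<close>, and the inversion \<open>w = - 1 / u\<close>
  moves this remainder into the place of \<open>c\<close>. For \<open>c = 0\<close> the matrix is a
  translation up to sign.\<close>

lemma E2_transform:
  assumes "a * d - b * c = 1" "z \<in> uhp"
  shows "E2 ((of_int a * z + of_int b) / (of_int c * z + of_int d)) =
    (of_int c * z + of_int d) ^ 2 * E2 z
      + 6 / (of_real pi * \<i>) * of_int c * (of_int c * z + of_int d)"
  using assms
proof (induction "nat \<bar>c\<bar>" arbitrary: a b c d z rule: less_induct)
  case less
  show ?case
  proof (cases "c = 0")
    case True
    then have "a = 1 \<and> d = 1 \<or> a = -1 \<and> d = -1"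
      using less.prems(1) by (auto simp: zmult_eq_1_iff)
    moreover have "E2 (z - of_int b) = E2 z" using E2_add_of_int[of z "- b"] by simp
    ultimately show ?thesis
      using True E2_add_of_int[of z b] by (auto simp: minus_divide_left[symmetric] divide_simps)
  next
    case False
    define n where "n = d div c"
    define d' where "d' = d - c * n"
    define b' where "b' = b - a * n"
    define u where "u = z + of_int n"
    define w where "w = - 1 / u"
    define \<kappa> where "\<kappa> = 6 / (of_real pi * \<i>)"
    define J where "J = of_int c * z + of_int d"
    have u: "u \<in> uhp" using less.prems(2) by (simp add: u_def uhp_def)
    then have u0: "u \<noteq> 0" by (auto simp: uhp_def)
    have w: "w \<in> uhp" using moebius_in_uhp(2)[of 0 0 "-1" 1 u] u by (simp add: w_def)
    have J0: "J \<noteq> 0" using moebius_in_uhp(1)[OF less.prems] by (simp add: J_def)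
    have J: "J = of_int c * u + of_int d'" by (simp add: J_def u_def d'_def algebra_simps)
    have num: "of_int a * z + of_int b = of_int a * u + of_int b'"
      by (simp add: u_def b'_def algebra_simps)
    have "d' = d mod c" by (simp add: d'_def n_def minus_mult_div_eq_mod)
    then have lt: "nat \<bar>d'\<bar> < nat \<bar>c\<bar>" using False by (simp add: abs_mod_less)
    have "b' * (- c) - (- a) * d' = 1"
      using less.prems(1) by (simp add: b'_def d'_def algebra_simps)
    from less.hyps[OF lt this w]
    have IH: "E2 ((of_int b' * w + of_int (- a)) / (of_int d' * w + of_int (- c))) =
      (of_int d' * w + of_int (- c))\<^sup>2 * E2 w + \<kappa> * of_int d' * (of_int d' * w + of_int (- c))"
      by (simp add: \<kappa>_def)
    have jw: "of_int d' * w + of_int (- c) = - J / u"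
      using u0 by (simp add: w_def J field_simps)
    have "of_int b' * w + of_int (- a) = - (of_int a * u + of_int b') / u"
      using u0 by (simp add: w_def field_simps)
    then have "(of_int b' * w + of_int (- a)) / (of_int d' * w + of_int (- c)) =
        (- (of_int a * z + of_int b) / u) / (- J / u)"
      by (simp only: jw num)
    also have "\<dots> = (of_int a * z + of_int b) / J"
      using u0 by (simp del: minus_add_distrib)
    finally have "(of_int b' * w + of_int (- a)) / (of_int d' * w + of_int (- c)) = (of_int a * z + of_int b) / J" .
    then have "E2 ((of_int a * z + of_int b) / J) = (J / u)\<^sup>2 * E2 w - \<kappa> * of_int d' * (J / u)"
      using IH unfolding jw by simp
    also have "E2 w = u ^ 2 * E2 z + \<kappa> * u"
      using E2_transform_S[OF u] E2_add_of_int[of z n] by (simp add: w_def \<kappa>_def u_def)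
    also have "(J / u)\<^sup>2 * (u ^ 2 * E2 z + \<kappa> * u) - \<kappa> * of_int d' * (J / u) =
        J ^ 2 * E2 z + \<kappa> * ((J - of_int d') / u) * J"
      using u0 by (simp add: field_simps power2_eq_square)
    \<comment> \<open>The defects of the inversion and of the smaller matrix combine to the
      coefficient \<open>c\<close>: the defect is a cocycle.\<close>
    also have "(J - of_int d') / u = of_int c" using u0 by (simp add: J)
    finally show ?thesis by (simp add: J_def \<kappa>_def)
  qed
qed

definition E2_q :: "complex \<Rightarrow> complex" where
  "E2_q w = 1 - 24 * (\<Sum>n. of_nat (sigma1 (Suc n)) * w ^ Suc n)"

lemma E2_eq_E2_q: "E2 z = E2_q (qpar z)"
  by (simp add: E2_def E2_q_def)

lemma holomorphic_E2_q: "E2_q holomorphic_on ball 0 1"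
proof -
  define a :: "nat \<Rightarrow> complex" where "a = (\<lambda>n. if n = 0 then 0 else of_nat (sigma1 n))"
  have "(\<lambda>w. \<Sum>n. of_nat (sigma1 (Suc n)) * w ^ Suc n :: complex) holomorphic_on ball 0 1"
  proof (rule power_series_holomorphic)
    fix w :: complex assume "w \<in> ball 0 1"
    then have "norm w < 1" by simp
    from sum_divisors_double_series(2)[OF this]
    have "(\<lambda>n. a (Suc n) * w ^ Suc n) sums (\<Sum>n. of_nat (sigma1 (Suc n)) * w ^ Suc n)"
      unfolding a_def by (simp add: summable_sums del: power_Suc)
    then show "(\<lambda>n. a n * (w - 0) ^ n) sums (\<Sum>n. of_nat (sigma1 (Suc n)) * w ^ Suc n)"
      by (subst (asm) sums_Suc_iff) (simp add: a_def)
  qed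
  then show ?thesis unfolding E2_q_def by (intro holomorphic_intros)
qed

lemma has_field_derivative_qpar [derivative_intros]:
  "(g has_field_derivative g') (at z within A) \<Longrightarrow>
    ((\<lambda>z. qpar (g z)) has_field_derivative (2 * of_real pi * \<i> * g' * qpar (g z))) (at z within A)"
  unfolding qpar_def by (auto intro!: derivative_eq_intros)

lemma holomorphic_on_qpar: "qpar holomorphic_on A"
  unfolding qpar_def by (intro holomorphic_intros)

lemma holomorphic_E2: "E2 holomorphic_on uhp"
proof -
  have "(E2_q \<circ> qpar) holomorphic_on uhp"
    by (rule holomorphic_on_compose_gen[OF holomorphic_on_qpar holomorphic_E2_q])
       (auto simp: norm_qpar_less_1_iff)
  then show ?thesis by (simp add: o_def E2_eq_E2_q[abs_def])
qed

subsection \<open>The potential and its modularity\<close>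

lemma moebius_has_field_derivative:
  fixes a b c d :: int
  assumes "a * d - b * c = 1" "z \<in> uhp"
  shows "((\<lambda>z. (of_int a * z + of_int b) / (of_int c * z + of_int d)) has_field_derivative
    1 / (of_int c * z + of_int d) ^ 2) (at z)"
proof -
  have nz: "of_int c * z + of_int d \<noteq> 0" using moebius_in_uhp(1)[OF assms] .
  have "of_int (a * d - b * c) = (1 :: complex)" using assms(1) by simp
  then have det: "of_int a * of_int d - of_int b * of_int c = (1::complex)" by simp
  have num: "of_int a * (of_int c * z + of_int d) - (of_int a * z + of_int b) * of_int c = 1"
    using det by (simp add: algebra_simps)
  show ?thesis
    by (rule derivative_eq_intros refl nz)+ (use num in \<open>simp add: power2_eq_square\<close>)
qed

text \<open>Limits and poles at the image point are pulled back along this filter. Punctured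
  neighbourhoods correspond because the map is injective, which is read off from the
  determinant.\<close>

lemma filterlim_moebius_at:
  fixes a b c d :: int
  assumes "a * d - b * c = 1" "z \<in> uhp"
  shows "filterlim (\<lambda>z. (of_int a * z + of_int b) / (of_int c * z + of_int d))
    (at ((of_int a * z + of_int b) / (of_int c * z + of_int d))) (at z)"
proof (rule filterlim_atI)
  let ?\<gamma> = "\<lambda>z. (of_int a * z + of_int b) / (of_int c * z + of_int d) :: complex"
  show "(?\<gamma> \<longlongrightarrow> ?\<gamma> z) (at z)"
    using DERIV_isCont[OF moebius_has_field_derivative[OF assms]] by (simp add: isCont_def)
  have "of_int (a * d - b * c) = (1 :: complex)" using assms(1) by simp
  then have det: "of_int a * of_int d - of_int b * of_int c = (1::complex)" by simp
  have "\<forall>\<^sub>F w in at z. w \<in> uhp - {z}"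
    using assms(2) open_uhp eventually_at_in_open by blast
  then show "\<forall>\<^sub>F w in at z. ?\<gamma> w \<noteq> ?\<gamma> z"
  proof eventually_elim
    case (elim w)
    have nz: "of_int c * z + of_int d \<noteq> 0" "of_int c * w + of_int d \<noteq> 0"
      using moebius_in_uhp(1)[OF assms(1)] elim assms(2) by auto
    have "(of_int a * w + of_int b) * (of_int c * z + of_int d) - (of_int a * z + of_int b) * (of_int c * w + of_int d)
        = (of_int a * of_int d - of_int b * of_int c) * (w - z)"
      by (simp add: algebra_simps)
    then have "(of_int a * w + of_int b) * (of_int c * z + of_int d) \<noteq> (of_int a * z + of_int b) * (of_int c * w + of_int d)"
      using elim det by auto
    then show ?case using nz by (simp add: frac_eq_eq)
  qed
qed

text \<open>\<open>F\<close> and \<open>G\<close> may differ because a matrix carries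
  \<open>f\<close> and \<open>h\<close> to other combinations of the two. The extra term with
  \<open>n c\<close> is the derivative of the automorphy factor.\<close>

lemma deriv_weakly_modular:
  fixes a b c d n :: int
  assumes det: "a * d - b * c = 1" and z: "z \<in> uhp"
    and F: "F holomorphic_on uhp" and G: "G holomorphic_on uhp"
    and eq: "\<And>w. w \<in> uhp \<Longrightarrow> F ((of_int a * w + of_int b) / (of_int c * w + of_int d)) =
               (of_int c * w + of_int d) powi n * G w"
  defines "\<gamma> \<equiv> \<lambda>w. (of_int a * w + of_int b) / (of_int c * w + of_int d)"
    and "j \<equiv> \<lambda>w. of_int c * w + of_int d"
  shows "deriv F (\<gamma> z) = j z powi (n + 2) * (of_int (n * c) / j z * G z + deriv G z)"
proof -
  have j0: "j z \<noteq> 0" and gz: "\<gamma> z \<in> uhp"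
    using moebius_in_uhp[OF det z] by (auto simp: j_def \<gamma>_def)
  have 1: "((\<lambda>w. F (\<gamma> w)) has_field_derivative deriv F (\<gamma> z) * (1 / j z ^ 2)) (at z)"
    using holomorphic_derivI[OF F open_uhp gz] moebius_has_field_derivative[OF det z]
    unfolding \<gamma>_def j_def by (rule DERIV_chain2)
  have "((\<lambda>w. j w powi n * G w) has_field_derivative
      of_int n * j z powi (n - 1) * of_int c * G z + j z powi n * deriv G z) (at z)"
    by (rule derivative_eq_intros refl holomorphic_derivI[OF G open_uhp z] | use j0 in \<open>simp add: j_def\<close>)+
  then have 2: "((\<lambda>w. F (\<gamma> w)) has_field_derivative
      of_int n * j z powi (n - 1) * of_int c * G z + j z powi n * deriv G z) (at z)"
    by (rule has_field_derivative_transform_within_open[OF _ open_uhp z])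
       (simp add: eq \<gamma>_def j_def)
  have "deriv F (\<gamma> z) * (1 / j z ^ 2) = of_int n * j z powi (n - 1) * of_int c * G z + j z powi n * deriv G z"
    using DERIV_unique[OF 1 2] .
  then have "deriv F (\<gamma> z) = j z ^ 2 * (of_int n * j z powi (n - 1) * of_int c * G z + j z powi n * deriv G z)"
    using j0 by (simp add: field_simps)
  also have "\<dots> = j z powi (n + 2) * (of_int (n * c) / j z * G z + deriv G z)"
    using j0 by (simp add: power_int_add power_int_diff field_simps power2_eq_square)
  finally show ?thesis .
qed

lemma open_nonzero_set:
  assumes "F holomorphic_on uhp"
  shows "open {z \<in> uhp. F z \<noteq> (0::complex)}"
proof -
  have "open (uhp \<inter> F -` (- {0}))"
    using assms open_uhp by (intro continuous_open_preimage holomorphic_on_imp_continuous_on) auto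
  also have "uhp \<inter> F -` (- {0}) = {z \<in> uhp. F z \<noteq> 0}" by auto
  finally show ?thesis .
qed

locale quasimodular =
  fixes k :: int and f f0 f1 :: "complex \<Rightarrow> complex"
  assumes modular_f0: "modular_form k f0"
    and modular_f1: "modular_form (k - 2) f1"
    and f_eq: "\<forall>z\<in>uhp. f z = f1 z * E2 z + f0 z"
    and f_nonzero: "\<exists>z\<in>uhp. f z \<noteq> 0"
begin

abbreviation h where "h \<equiv> h_fun f1 f"
abbreviation W where "W \<equiv> W_fun f1 f"

text \<open>The last coefficient of the equation \<open>W y'' - W' y' + V y = 0\<close>, which
  \<open>h\<close> and \<open>f\<close> satisfy.\<close>

definition V where "V z = deriv h z * deriv (deriv f) z - deriv f z * deriv (deriv h) z"

definition \<omega> where "\<omega> z = deriv W z / (2 * W z)"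

text \<open>The potential: every \<open>y / \<surd>W\<close>, with \<open>y\<close> in the span of \<open>h\<close> and \<open>f\<close>, solves \<open>g'' = R g\<close>.\<close>
definition R where "R z = \<omega> z ^ 2 - deriv \<omega> z - V z / W z"

definition comb where "comb \<alpha> \<beta> z = \<alpha> * h z + \<beta> * f z"

text \<open>The logarithmic derivative of \<open>comb \<alpha> \<beta> / \<surd>W\<close>.\<close>
definition L where "L \<alpha> \<beta> z = deriv (comb \<alpha> \<beta>) z / comb \<alpha> \<beta> z - \<omega> z"

lemma holomorphic_f1: "f1 holomorphic_on uhp" and holomorphic_f0: "f0 holomorphic_on uhp"
  using modular_f0 modular_f1 by (auto simp: modular_form_def)

lemma holomorphic_f: "f holomorphic_on uhp"
proof -
  have "(\<lambda>z. f1 z * E2 z + f0 z) holomorphic_on uhp"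
    by (intro holomorphic_intros holomorphic_f1 holomorphic_f0 holomorphic_E2)
  then show ?thesis using f_eq by (simp cong: holomorphic_cong)
qed

lemma holomorphic_h: "h holomorphic_on uhp"
  unfolding h_fun_def by (intro holomorphic_intros holomorphic_f holomorphic_f1)

lemma holomorphic_comb: "comb \<alpha> \<beta> holomorphic_on uhp"
  unfolding comb_def by (intro holomorphic_intros holomorphic_f holomorphic_h)

lemma holomorphic_W: "W holomorphic_on uhp"
  unfolding W_fun_def
  by (intro holomorphic_intros holomorphic_f holomorphic_h holomorphic_deriv open_uhp)

lemma holomorphic_V: "V holomorphic_on uhp"
  unfolding V_def
  by (intro holomorphic_intros holomorphic_f holomorphic_h holomorphic_deriv open_uhp)

lemmas derivs [derivative_intros] =
  holomorphic_derivI[OF holomorphic_f open_uhp]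
  holomorphic_derivI[OF holomorphic_h open_uhp]
  holomorphic_derivI[OF holomorphic_comb open_uhp]
  holomorphic_derivI[OF holomorphic_W open_uhp]
  holomorphic_derivI[OF holomorphic_deriv[OF holomorphic_f open_uhp] open_uhp]
  holomorphic_derivI[OF holomorphic_deriv[OF holomorphic_h open_uhp] open_uhp]
  holomorphic_derivI[OF holomorphic_deriv[OF holomorphic_comb open_uhp] open_uhp]
  holomorphic_derivI[OF holomorphic_deriv[OF holomorphic_W open_uhp] open_uhp]

lemma deriv_comb:
  assumes "z \<in> uhp"
  shows "deriv (comb \<alpha> \<beta>) z = \<alpha> * deriv h z + \<beta> * deriv f z"
  by (rule DERIV_imp_deriv)
     (auto simp: comb_def[abs_def] intro!: derivative_eq_intros assms)

lemma deriv2_comb: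
  assumes "z \<in> uhp"
  shows "deriv (deriv (comb \<alpha> \<beta>)) z = \<alpha> * deriv (deriv h) z + \<beta> * deriv (deriv f) z"
proof (rule DERIV_imp_deriv)
  have "((\<lambda>z. \<alpha> * deriv h z + \<beta> * deriv f z) has_field_derivative
      \<alpha> * deriv (deriv h) z + \<beta> * deriv (deriv f) z) (at z)"
    by (auto intro!: derivative_eq_intros assms)
  then show "(deriv (comb \<alpha> \<beta>) has_field_derivative
      \<alpha> * deriv (deriv h) z + \<beta> * deriv (deriv f) z) (at z)"
    by (rule has_field_derivative_transform_within_open[OF _ open_uhp assms]) (simp add: deriv_comb)
qed

lemma deriv_W:
  assumes "z \<in> uhp"
  shows "deriv W z = h z * deriv (deriv f) z - f z * deriv (deriv h) z"
  by (rule DERIV_imp_deriv)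
     (auto simp: W_fun_def[abs_def] intro!: derivative_eq_intros assms)

text \<open>The three-row Wronskian determinant of \<open>y\<close>, \<open>h\<close> and
  \<open>f\<close> vanishes for \<open>y\<close> in the span; this is its expansion along the column
  of \<open>y\<close>.\<close>

lemma comb_ODE:
  assumes "z \<in> uhp"
  shows "deriv (deriv (comb \<alpha> \<beta>)) z * W z = deriv (comb \<alpha> \<beta>) z * deriv W z - V z * comb \<alpha> \<beta> z"
  unfolding deriv_comb[OF assms] deriv2_comb[OF assms] deriv_W[OF assms] V_def comb_def W_fun_def
  by (simp add: algebra_simps)

lemma holomorphic_\<omega>: "\<omega> holomorphic_on {z \<in> uhp. W z \<noteq> 0}"
  unfolding \<omega>_def
  by (intro holomorphic_intros holomorphic_on_subset[OF holomorphic_W]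
        holomorphic_on_subset[OF holomorphic_deriv[OF holomorphic_W open_uhp]]) auto

lemma \<omega>_has_field_derivative:
  assumes "z \<in> uhp" "W z \<noteq> 0"
  shows "(\<omega> has_field_derivative deriv \<omega> z) (at z)"
  by (rule holomorphic_derivI[OF holomorphic_\<omega> open_nonzero_set[OF holomorphic_W]]) (use assms in auto)

lemma holomorphic_R: "R holomorphic_on {z \<in> uhp. W z \<noteq> 0}"
  unfolding R_def
  by (intro holomorphic_intros holomorphic_\<omega> holomorphic_on_subset[OF holomorphic_W]
        holomorphic_on_subset[OF holomorphic_V] holomorphic_deriv open_nonzero_set) (auto simp: holomorphic_W)

lemma L_has_field_derivative:
  assumes "z \<in> uhp" "W z \<noteq> 0" "comb \<alpha> \<beta> z \<noteq> 0"
  shows "(L \<alpha> \<beta> has_field_derivative R z - L \<alpha> \<beta> z ^ 2) (at z)"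
proof -
  have "(L \<alpha> \<beta> has_field_derivative
     (deriv (deriv (comb \<alpha> \<beta>)) z * comb \<alpha> \<beta> z - deriv (comb \<alpha> \<beta>) z * deriv (comb \<alpha> \<beta>) z) / (comb \<alpha> \<beta> z * comb \<alpha> \<beta> z)
      - deriv \<omega> z) (at z)"
    unfolding L_def[abs_def]
    by (rule derivative_eq_intros \<omega>_has_field_derivative refl assms)+
  moreover have "deriv (deriv (comb \<alpha> \<beta>)) z = 2 * \<omega> z * deriv (comb \<alpha> \<beta>) z - V z / W z * comb \<alpha> \<beta> z"
    using comb_ODE[OF assms(1), of \<alpha> \<beta>] assms(2) by (simp add: \<omega>_def field_simps)
  moreover have "((2 * w * y' - v * y) * y - y' * y') / (y * y) - w' = (w\<^sup>2 - w' - v) - (y' / y - w)\<^sup>2"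
    if "y \<noteq> 0" for w w' y y' v :: complex
    using that by (simp add: field_simps power2_eq_square)
  ultimately show ?thesis
    using assms(3) by (simp only: R_def L_def not_False_eq_True)
qed

text \<open>Division by \<open>s\<close> removes the first-order term of the equation for
  \<open>y\<close>. The branch enters through \<open>s' = \<omega> s\<close>, and
  \<open>\<omega>\<close> is the same for both signs of \<open>s\<close>, so the potential is
  independent of the branch.\<close>

lemma deriv2_normalized:
  assumes "open U" "U \<subseteq> uhp" "s holomorphic_on U" "\<And>w. w \<in> U \<Longrightarrow> W w \<noteq> 0 \<and> (s w)\<^sup>2 = W w" "z \<in> U"
  shows "deriv (deriv (\<lambda>w. comb \<alpha> \<beta> w / s w)) z = R z * (comb \<alpha> \<beta> z / s z)"
proof -
  let ?y = "comb \<alpha> \<beta>"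
  have s0: "s w \<noteq> 0" if "w \<in> U" for w using assms(4)[OF that] by auto
  have ds: "(s has_field_derivative \<omega> w * s w) (at w)" if w: "w \<in> U" for w
  proof -
    have wu: "w \<in> uhp" using w assms(2) by auto
    have d: "(s has_field_derivative deriv s w) (at w)"
      by (rule holomorphic_derivI[OF assms(3,1) w])
    have "((\<lambda>w. (s w)\<^sup>2) has_field_derivative 2 * s w * deriv s w) (at w)"
      by (auto intro!: derivative_eq_intros d)
    then have "(W has_field_derivative 2 * s w * deriv s w) (at w)"
      by (rule has_field_derivative_transform_within_open[OF _ assms(1) w]) (use assms(4) in auto)
    then have "deriv W w = 2 * s w * deriv s w" by (rule DERIV_imp_deriv)
    then have "deriv s w = \<omega> w * s w"
      using s0[OF w] assms(4)[OF w] by (simp add: \<omega>_def power2_eq_square flip: assms(4)[OF w, THEN conjunct2])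
    with d show ?thesis by simp
  qed
  have d1: "((\<lambda>w. ?y w / s w) has_field_derivative (deriv ?y w - ?y w * \<omega> w) / s w) (at w)" if w: "w \<in> U" for w
  proof -
    have wu: "w \<in> uhp" using w assms(2) by auto
    have "((\<lambda>w. ?y w / s w) has_field_derivative
        (deriv ?y w * s w - ?y w * (\<omega> w * s w)) / (s w * s w)) (at w)"
      by (rule derivative_eq_intros ds w wu s0 refl)+
    moreover have "(p * t - q * (x * t)) / (t * t) = (p - q * x) / t" if "t \<noteq> 0" for p q x t :: complex
      using that by (simp add: field_simps)
    ultimately show ?thesis using s0[OF w] by (simp only: not_False_eq_True)
  qed
  have z: "z \<in> uhp" "W z \<noteq> 0" using assms by auto
  have "((\<lambda>w. (deriv ?y w - ?y w * \<omega> w) / s w) has_field_derivative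
     ((deriv (deriv ?y) z - (deriv ?y z * \<omega> z + deriv \<omega> z * ?y z)) * s z
        - (deriv ?y z - ?y z * \<omega> z) * (\<omega> z * s z)) / (s z * s z)) (at z)"
    by (rule derivative_eq_intros \<omega>_has_field_derivative ds assms(5) z s0 refl | simp)+
  then have "(deriv (\<lambda>w. ?y w / s w) has_field_derivative
     ((deriv (deriv ?y) z - (deriv ?y z * \<omega> z + deriv \<omega> z * ?y z)) * s z
        - (deriv ?y z - ?y z * \<omega> z) * (\<omega> z * s z)) / (s z * s z)) (at z)"
    by (rule has_field_derivative_transform_within_open[OF _ assms(1,5)])
       (simp add: DERIV_imp_deriv[OF d1])
  then have "deriv (deriv (\<lambda>w. ?y w / s w)) z =
     ((deriv (deriv ?y) z - (deriv ?y z * \<omega> z + deriv \<omega> z * ?y z)) * s z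
        - (deriv ?y z - ?y z * \<omega> z) * (\<omega> z * s z)) / (s z * s z)"
    by (rule DERIV_imp_deriv)
  also have "deriv (deriv ?y) z = 2 * \<omega> z * deriv ?y z - V z / W z * ?y z"
    using comb_ODE[OF z(1), of \<alpha> \<beta>] z(2) by (simp add: \<omega>_def field_simps)
  also have "((2 * w * y' - v * y - (y' * w + w' * y)) * t - (y' - y * w) * (w * t)) / (t * t) =
     (w\<^sup>2 - w' - v) * (y / t)" if "t \<noteq> 0" for w w' y y' v t :: complex
    using that by (simp add: field_simps power2_eq_square)
  finally show ?thesis using s0[OF assms(5)] by (simp add: R_def)
qed

end

section \<open>Transformation laws of \<open>f\<close>, \<open>h\<close>, \<open>W\<close> and the
  potential\<close>

lemma modular_form_transform:
  assumes "modular_form k F" "a * d - b * c = 1" "z \<in> uhp"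
  shows "F ((of_int a * z + of_int b) / (of_int c * z + of_int d)) = (of_int c * z + of_int d) powi k * F z"
  using assms by (auto simp: modular_form_def weakly_modular_def)

lemma eventually_nonzero:
  assumes "F holomorphic_on uhp" "\<exists>w\<in>uhp. F w \<noteq> 0" "z \<in> uhp"
  shows "\<forall>\<^sub>F w in at z. F w \<noteq> 0 \<and> w \<in> uhp"
  using assms non_zero_neighbour_alt[OF assms(1) open_uhp connected_uhp assms(3)] by blast

context quasimodular
begin

text \<open>The matrix \<open>- 1\<close> fixes every point, so forms of odd weight vanish, and
  \<open>f\<close> with them. The parity of \<open>k\<close> enters later at
  \<open>\<i>\<close>.\<close>

lemma even_k: "even k"
proof (rule ccontr)
  assume odd: "odd k"
  then have odd2: "odd (k - 2)" by simp
  obtain z where z: "z \<in> uhp" "f z \<noteq> 0" using f_nonzero by blast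
  have "F z = 0" if "modular_form n F" "odd n" for F n
  proof -
    have "F ((of_int (- 1) * z + of_int 0) / (of_int 0 * z + of_int (- 1))) =
        (of_int 0 * z + of_int (- 1)) powi n * F z"
      by (rule modular_form_transform[OF that(1) _ z(1)]) simp
    then show ?thesis using that(2) by (simp add: power_int_minus_left)
  qed
  from this[OF modular_f0 odd] this[OF modular_f1 odd2] have "f z = 0"
    using f_eq z(1) by simp
  with z show False by simp
qed

text \<open>The defect of \<open>E2\<close> contributes \<open>c f1\<close> times the constant in
  \<open>h\<close>, which completes \<open>(c z + d) f\<close> to \<open>c h + d f\<close>. This
  combination absorbs one factor \<open>j\<close>, so that \<open>k - 1\<close> remains.\<close>

lemma f_transform:
  assumes det: "a * d - b * c = 1" and z: "z \<in> uhp"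
  shows "f ((of_int a * z + of_int b) / (of_int c * z + of_int d)) =
    (of_int c * z + of_int d) powi (k - 1) * comb (of_int c) (of_int d) z"
proof -
  define \<gamma> where "\<gamma> = (of_int a * z + of_int b) / (of_int c * z + of_int d)"
  define j where "j = of_int c * z + of_int d"
  have j0: "j \<noteq> 0" and gz: "\<gamma> \<in> uhp" using moebius_in_uhp[OF det z] by (auto simp: j_def \<gamma>_def)
  define \<kappa> where "\<kappa> = 6 / (of_real pi * \<i>)"
  define p where "p = j powi (k - 2)"
  have p: "j powi k = p * j ^ 2" "j powi (k - 1) = p * j"
    using j0 by (simp_all add: p_def power_int_diff power2_eq_square)
  have f: "f0 \<gamma> = p * j ^ 2 * f0 z" "f1 \<gamma> = p * f1 z"
    using modular_form_transform[OF modular_f0 det z] modular_form_transform[OF modular_f1 det z]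
    by (simp_all add: \<gamma>_def p_def j_def flip: p(1)[unfolded p_def j_def])
  have E: "E2 \<gamma> = j ^ 2 * E2 z + \<kappa> * of_int c * j"
    unfolding \<gamma>_def j_def \<kappa>_def by (rule E2_transform[OF det z])
  have "f \<gamma> = f1 \<gamma> * E2 \<gamma> + f0 \<gamma>" using f_eq gz by blast
  moreover have "f z = f1 z * E2 z + f0 z" using f_eq z by blast
  ultimately have "f \<gamma> = p * j * (j * f z + \<kappa> * of_int c * f1 z)"
    unfolding f E by (simp add: algebra_simps power2_eq_square)
  also have "j * f z + \<kappa> * of_int c * f1 z = comb (of_int c) (of_int d) z"
    by (simp add: comb_def h_fun_def j_def \<kappa>_def algebra_simps)
  finally show ?thesis by (simp add: \<gamma>_def j_def flip: p(2)[unfolded j_def])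
qed

lemma h_transform:
  assumes det: "a * d - b * c = 1" and z: "z \<in> uhp"
  shows "h ((of_int a * z + of_int b) / (of_int c * z + of_int d)) =
    (of_int c * z + of_int d) powi (k - 1) * comb (of_int a) (of_int b) z"
proof -
  define \<gamma> where "\<gamma> = (of_int a * z + of_int b) / (of_int c * z + of_int d)"
  define j where "j = of_int c * z + of_int d"
  define \<kappa> where "\<kappa> = 6 / (of_real pi * \<i>)"
  have j0: "j \<noteq> 0" using moebius_in_uhp[OF det z] by (auto simp: j_def)
  have "of_int (a * d - b * c) = (1 :: complex)" using det by simp
  \<comment> \<open>The determinant condition in the form that lets a factor \<open>j\<close> be
    split off from both terms of \<open>h\<close> at the image point.\<close>
  then have det': "of_int c * (of_int a * z + of_int b) + 1 = of_int a * j"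
    by (simp add: j_def algebra_simps)
  have f1: "f1 \<gamma> = j powi (k - 2) * f1 z"
    using modular_f1 det z by (auto simp: modular_form_def weakly_modular_def \<gamma>_def j_def)
  have "h \<gamma> = \<gamma> * f \<gamma> + \<kappa> * f1 \<gamma>" by (simp add: h_fun_def \<kappa>_def)
  also have "f \<gamma> = j powi (k - 1) * (j * f z + \<kappa> * of_int c * f1 z)"
    unfolding \<gamma>_def f_transform[OF det z] by (simp add: comb_def h_fun_def j_def \<kappa>_def algebra_simps)
  also have "\<gamma> * (j powi (k - 1) * (j * f z + \<kappa> * of_int c * f1 z)) + \<kappa> * f1 \<gamma> =
      j powi (k - 2) * (j * (of_int a * z + of_int b) * f z
        + \<kappa> * f1 z * (of_int c * (of_int a * z + of_int b) + 1))"
    using j0 unfolding f1 by (simp add: \<gamma>_def power_int_diff power2_eq_square flip: j_def) (simp add: field_simps)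
  also have "\<dots> = j powi (k - 2) * (j * ((of_int a * z + of_int b) * f z + \<kappa> * f1 z * of_int a))"
    unfolding det' by (simp add: algebra_simps)
  also have "\<dots> = j powi (k - 1) * comb (of_int a) (of_int b) z"
    using j0 by (simp add: power_int_diff power2_eq_square comb_def h_fun_def \<kappa>_def) (simp add: field_simps)
  finally show ?thesis by (simp add: \<gamma>_def j_def)
qed

lemma comb_transform:
  assumes det: "a * d - b * c = 1" and z: "z \<in> uhp"
  shows "comb \<alpha> \<beta> ((of_int a * z + of_int b) / (of_int c * z + of_int d)) =
    (of_int c * z + of_int d) powi (k - 1) *
      comb (\<alpha> * of_int a + \<beta> * of_int c) (\<alpha> * of_int b + \<beta> * of_int d) z"
  unfolding comb_def[of \<alpha> \<beta>] f_transform[OF det z] h_transform[OF det z]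
  by (simp add: comb_def algebra_simps)

lemma W_transform:
  assumes det: "a * d - b * c = 1" and z: "z \<in> uhp"
  shows "W ((of_int a * z + of_int b) / (of_int c * z + of_int d)) =
    (of_int c * z + of_int d) powi (2 * k) * W z"
proof -
  define \<gamma> where "\<gamma> = (of_int a * z + of_int b) / (of_int c * z + of_int d)"
  define j where "j = of_int c * z + of_int d"
  define x y x' y' where xy: "x = comb (of_int a) (of_int b) z" "y = comb (of_int c) (of_int d) z"
    "x' = deriv (comb (of_int a) (of_int b)) z" "y' = deriv (comb (of_int c) (of_int d)) z"
  \<comment> \<open>Contribution of the differentiated automorphy factor. It adds the same multiple
    of each function to its derivative, so it cancels in the Wronskian, and the exponents add up to
    \<open>(k - 1) + (k + 1)\<close>.\<close>
  define t where "t = of_int ((k - 1) * c) / j"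
  have j0: "j \<noteq> 0" using moebius_in_uhp[OF det z] by (auto simp: j_def)
  have "of_int (a * d - b * c) = (1 :: complex)" using det by simp
  then have det': "of_int a * of_int d - of_int b * of_int c = (1::complex)" by simp
  have "deriv f \<gamma> = j powi (k - 1 + 2) * (t * y + y')"
    unfolding \<gamma>_def j_def t_def xy
    by (rule deriv_weakly_modular[OF det z holomorphic_f holomorphic_comb f_transform[OF det]])
  moreover have "deriv h \<gamma> = j powi (k - 1 + 2) * (t * x + x')"
    unfolding \<gamma>_def j_def t_def xy
    by (rule deriv_weakly_modular[OF det z holomorphic_h holomorphic_comb h_transform[OF det]])
  moreover have "f \<gamma> = j powi (k - 1) * y" "h \<gamma> = j powi (k - 1) * x"
    unfolding \<gamma>_def j_def xy by (rule f_transform[OF det z], rule h_transform[OF det z])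
  ultimately have "W \<gamma> = (j powi (k - 1) * j powi (k - 1 + 2)) * (x * y' - y * x')"
    by (simp add: W_fun_def algebra_simps)
  also have "j powi (k - 1) * j powi (k - 1 + 2) = j powi (2 * k)"
    using j0 by (simp flip: power_int_add)
  also have "x * y' - y * x' = (of_int a * of_int d - of_int b * of_int c) * W z"
    unfolding xy deriv_comb[OF z] by (simp add: comb_def W_fun_def algebra_simps)
  finally show ?thesis by (simp add: det' \<gamma>_def j_def)
qed

lemma periodic: "z \<in> uhp \<Longrightarrow> f (z + 1) = f z" "z \<in> uhp \<Longrightarrow> h (z + 1) = h z + f z"
  using f_transform[of 1 1 1 0 z] h_transform[of 1 1 1 0 z] by (simp_all add: comb_def)

text \<open>If \<open>W\<close> vanished, \<open>h\<close> would be a multiple of \<open>f\<close>, contradicting \<open>h (z + 1) = h z + f z\<close>.\<close>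
lemma W_nonzero: "\<exists>z\<in>uhp. W z \<noteq> 0"
proof (rule ccontr)
  assume "\<not> ?thesis"
  then have W0: "W z = 0" if "z \<in> uhp" for z using that by auto
  obtain z1 where z1: "z1 \<in> uhp" "f z1 \<noteq> 0" using f_nonzero by blast
  have "open {z \<in> uhp. f z \<noteq> 0}" by (rule open_nonzero_set[OF holomorphic_f])
  then obtain e where e: "e > 0" "ball z1 e \<subseteq> {z \<in> uhp. f z \<noteq> 0}"
    using z1 by (auto simp: open_contains_ball)
  have "\<exists>l. \<forall>z\<in>ball z1 e. h z / f z = l"
  proof (rule has_field_derivative_zero_constant)
    fix z assume "z \<in> ball z1 e"
    then have z: "z \<in> uhp" "f z \<noteq> 0" using e by auto
    have "((\<lambda>z. h z / f z) has_field_derivative (deriv h z * f z - h z * deriv f z) / (f z * f z)) (at z)"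
      by (rule derivative_eq_intros refl z)+
    then have "((\<lambda>z. h z / f z) has_field_derivative 0) (at z)"
      using W0[OF z(1)] by (simp add: W_fun_def mult.commute)
    then show "((\<lambda>z. h z / f z) has_field_derivative 0) (at z within ball z1 e)"
      by (rule has_field_derivative_at_within)
  qed auto
  then obtain l where l: "\<And>z. z \<in> ball z1 e \<Longrightarrow> h z = l * f z"
  proof -
    assume *: "\<And>l. (\<And>z. z \<in> ball z1 e \<Longrightarrow> h z = l * f z) \<Longrightarrow> thesis"
    obtain l where "\<forall>z\<in>ball z1 e. h z / f z = l" using \<open>\<exists>l. _\<close> by blast
    moreover have "f z \<noteq> 0" if "z \<in> ball z1 e" for z using e(2) that by auto
    ultimately show thesis by (intro *[of l]) (metis nonzero_divide_eq_eq)
  qed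
  have hl: "h z - l * f z = 0" if "z \<in> uhp" for z
  proof (rule analytic_continuation_open[of "ball z1 e" uhp "\<lambda>z. h z - l * f z" "\<lambda>_. 0" z])
    show "(\<lambda>z. h z - l * f z) holomorphic_on uhp"
      by (intro holomorphic_intros holomorphic_f holomorphic_h)
  qed (use e l that open_uhp connected_uhp in auto)
  have "z1 + 1 \<in> uhp" using z1 by (simp add: uhp_def)
  from hl[OF this] hl[OF z1(1)] periodic[OF z1(1)] z1(2) show False by simp
qed

text \<open>Linear independence of \<open>h\<close> and \<open>f\<close>: a vanishing combination
  has vanishing derivative, and \<open>W\<close> is the determinant of the resulting linear system
  for the coefficients.\<close>

lemma comb_nonzero:
  assumes "\<alpha> \<noteq> 0 \<or> \<beta> \<noteq> 0"
  shows "\<exists>z\<in>uhp. comb \<alpha> \<beta> z \<noteq> 0"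
proof (rule ccontr)
  assume "\<not> ?thesis"
  then have c0: "\<And>z. z \<in> uhp \<Longrightarrow> comb \<alpha> \<beta> z = 0" by auto
  obtain z where z: "z \<in> uhp" "W z \<noteq> 0" using W_nonzero by auto
  have "deriv (comb \<alpha> \<beta>) z = deriv (\<lambda>_. 0) z"
    by (rule complex_derivative_transform_within_open[OF holomorphic_comb _ open_uhp z(1)]) (auto simp: c0)
  then have "\<alpha> * deriv h z + \<beta> * deriv f z = 0" "\<alpha> * h z + \<beta> * f z = 0"
    using c0[OF z(1)] deriv_comb[OF z(1)] by (auto simp: comb_def)
  then have "\<alpha> * W z = 0" "\<beta> * W z = 0"
    unfolding W_fun_def by algebra+
  with z assms show False by auto
qed

text \<open>\<open>L\<close> transforms with an additive term \<open>- c j\<close>, but the terms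
  with \<open>c\<close> cancel in \<open>L' + L^2\<close>. The logarithmic derivative of
  \<open>f\<close> is carried to that of \<open>c h + d f\<close>, whose zeros are excluded here and
  reached later by continuity.\<close>

lemma R_transform_generic:
  assumes det: "a * d - b * c = 1" and z: "z \<in> uhp" and Wz: "W z \<noteq> 0"
    and cz: "comb (of_int c) (of_int d) z \<noteq> 0"
  shows "R ((of_int a * z + of_int b) / (of_int c * z + of_int d)) = (of_int c * z + of_int d) ^ 4 * R z"
proof -
  define \<gamma> where "\<gamma> = (\<lambda>w::complex. (of_int a * w + of_int b) / (of_int c * w + of_int d))"
  define j where "j = (\<lambda>w::complex. of_int c * w + of_int d)"
  define U where "U = {w \<in> uhp. W w \<noteq> 0} \<inter> {w \<in> uhp. comb (of_int c) (of_int d) w \<noteq> 0}"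
  define l where "l = L (of_int c) (of_int d)"
  have U: "open U" unfolding U_def by (intro open_Int open_nonzero_set holomorphic_W holomorphic_comb)
  have zU: "z \<in> U" using z Wz cz by (simp add: U_def)
  have j0: "j w \<noteq> 0" and gw: "\<gamma> w \<in> uhp" if "w \<in> U" for w
    using moebius_in_uhp[OF det] that by (auto simp: j_def \<gamma>_def U_def)
  have fg: "comb 0 1 (\<gamma> w) = j w powi (k - 1) * comb (of_int c) (of_int d) w" if "w \<in> U" for w
    using f_transform[OF det, of w] that by (simp add: \<gamma>_def j_def U_def comb_def)
  have Wg: "W (\<gamma> w) = j w powi (2 * k) * W w" if "w \<in> U" for w
    using W_transform[OF det, of w] that by (simp add: \<gamma>_def j_def U_def)
  have Lg: "L 0 1 (\<gamma> w) = j w ^ 2 * l w - of_int c * j w" if w: "w \<in> U" for w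
  proof -
    have w': "w \<in> uhp" "W w \<noteq> 0" "comb (of_int c) (of_int d) w \<noteq> 0" using w by (auto simp: U_def)
    have "deriv (comb 0 1) (\<gamma> w) = j w powi (k - 1 + 2) *
        (of_int ((k - 1) * c) / j w * comb (of_int c) (of_int d) w + deriv (comb (of_int c) (of_int d)) w)"
      unfolding \<gamma>_def j_def
      by (rule deriv_weakly_modular[OF det w'(1) holomorphic_comb holomorphic_comb])
         (simp add: comb_transform[OF det])
    then have "deriv (comb 0 1) (\<gamma> w) / comb 0 1 (\<gamma> w) = j w ^ 2 * (of_int ((k - 1) * c) / j w
        + deriv (comb (of_int c) (of_int d)) w / comb (of_int c) (of_int d) w)"
    proof -
      have "j w powi (k - 1 + 2) = j w powi (k - 1) * j w ^ 2"
        by (subst power_int_add) (use j0[OF w] in auto)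
      then show ?thesis using j0[OF w] w'(3) \<open>deriv (comb 0 1) (\<gamma> w) = _\<close>
        unfolding fg[OF w] by (simp add: add_divide_distrib distrib_left del: of_int_mult)
    qed
    moreover have "deriv W (\<gamma> w) = j w powi (2 * k + 2) * (of_int ((2 * k) * c) / j w * W w + deriv W w)"
      unfolding \<gamma>_def j_def
      by (rule deriv_weakly_modular[OF det w'(1) holomorphic_W holomorphic_W])
         (simp add: W_transform[OF det])
    then have "\<omega> (\<gamma> w) = j w ^ 2 * (of_int (k * c) / j w + \<omega> w)"
      using j0[OF w] w'(2) unfolding \<omega>_def Wg[OF w] by (simp add: power_int_add field_simps)
    ultimately have "L 0 1 (\<gamma> w) = j w ^ 2 * ((of_int ((k - 1) * c) - of_int (k * c)) / j w + l w)"
      by (simp add: L_def l_def algebra_simps diff_divide_distrib)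
    also have "\<dots> = j w ^ 2 * l w - of_int c * j w"
      using j0[OF w] by (simp add: field_simps power2_eq_square)
    finally show ?thesis .
  qed
  have gz: "W (\<gamma> z) \<noteq> 0" "comb 0 1 (\<gamma> z) \<noteq> 0"
    using fg[OF zU] Wg[OF zU] j0[OF zU] Wz cz by simp_all
  have "((\<lambda>w. L 0 1 (\<gamma> w)) has_field_derivative (R (\<gamma> z) - L 0 1 (\<gamma> z) ^ 2) * (1 / j z ^ 2)) (at z)"
    unfolding \<gamma>_def j_def
    by (rule DERIV_chain2[OF L_has_field_derivative moebius_has_field_derivative[OF det z]])
       (use gz gw[OF zU] in \<open>simp_all add: \<gamma>_def\<close>)
  moreover have "((\<lambda>w. j w ^ 2 * l w - of_int c * j w) has_field_derivative
      2 * j z * of_int c * l z + j z ^ 2 * (R z - l z ^ 2) - of_int c * of_int c) (at z)"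
    unfolding j_def l_def
    by (auto intro!: derivative_eq_intros L_has_field_derivative z Wz cz simp: algebra_simps)
  then have "((\<lambda>w. L 0 1 (\<gamma> w)) has_field_derivative
      2 * j z * of_int c * l z + j z ^ 2 * (R z - l z ^ 2) - of_int c * of_int c) (at z)"
    by (rule has_field_derivative_transform_within_open[OF _ U zU]) (simp add: Lg)
  ultimately have "(R (\<gamma> z) - L 0 1 (\<gamma> z) ^ 2) * (1 / j z ^ 2) =
      2 * j z * of_int c * l z + j z ^ 2 * (R z - l z ^ 2) - of_int c * of_int c"
    by (rule DERIV_unique)
  then have "R (\<gamma> z) - L 0 1 (\<gamma> z) ^ 2 =
      j z ^ 2 * (2 * j z * of_int c * l z + j z ^ 2 * (R z - l z ^ 2) - of_int c * of_int c)"
    using j0[OF zU] by (simp add: field_simps)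
  then have "R (\<gamma> z) = j z ^ 4 * R z"
    unfolding Lg[OF zU] by algebra
  then show ?thesis by (simp add: \<gamma>_def j_def)
qed

end

subsection \<open>Local exponents\<close>

text \<open>Two admissible leading coefficients would make a nonzero multiple of
  \<open>1 / (z - z0)^2\<close> of order \<open>O(1 / (z - z0))\<close>. Hence the existential
  quantifier in the definition has only one witness.\<close>

lemma local_exponents_eq:
  assumes "(\<lambda>z. Q z - A / (z - z0)\<^sup>2) \<in> O[at z0](\<lambda>z. 1 / (z - z0))"
  shows "local_exponents Q z0 = {x. x * (x - 1) = - 4 * of_real pi ^ 2 * A}"
proof -
  have "B = A" if B: "(\<lambda>z. Q z - B / (z - z0)\<^sup>2) \<in> O[at z0](\<lambda>z. 1 / (z - z0))" for B
  proof -
    have "(\<lambda>z. (Q z - B / (z - z0)\<^sup>2) - (Q z - A / (z - z0)\<^sup>2)) \<in> O[at z0](\<lambda>z. 1 / (z - z0))"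
      by (rule sum_in_bigo(2)[OF B assms])
    then obtain C where "\<forall>\<^sub>F z in at z0. norm ((Q z - B / (z - z0)\<^sup>2) - (Q z - A / (z - z0)\<^sup>2)) \<le> C * norm (1 / (z - z0))"
      by (elim landau_o.bigE)
    moreover have "\<forall>\<^sub>F z in at z0. z \<noteq> z0" by (simp add: eventually_at_filter)
    ultimately have ev: "\<forall>\<^sub>F z in at z0. norm (A - B) \<le> C * norm (z - z0)"
    proof eventually_elim
      case (elim z)
      have "(Q z - B / (z - z0)\<^sup>2) - (Q z - A / (z - z0)\<^sup>2) = (A - B) / (z - z0)\<^sup>2"
        by (simp add: diff_divide_distrib)
      then have "norm (A - B) / norm (z - z0) ^ 2 \<le> C * (1 / norm (z - z0))"
        using elim by (simp add: norm_divide norm_power)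
      then show ?case using elim by (simp add: field_simps power2_eq_square)
    qed
    have "((\<lambda>z. C * norm (z - z0)) \<longlongrightarrow> C * norm (z0 - z0)) (at z0)"
      by (intro tendsto_intros)
    then have "norm (A - B) \<le> C * norm (z0 - z0)"
      by (rule tendsto_lowerbound[OF _ ev]) auto
    then show ?thesis by simp
  qed
  with assms show ?thesis unfolding local_exponents_def by blast
qed

lemma mult_minus_one_eq_iff: "x * (x - 1) = y * (y - 1) \<longleftrightarrow> x = y \<or> x = 1 - (y::complex)"
proof -
  have eq: "x * (x - 1) - y * (y - 1) = (x - y) * (x - (1 - y))" by (simp add: algebra_simps)
  show ?thesis
  proof
    assume "x * (x - 1) = y * (y - 1)"
    then have "(x - y) * (x - (1 - y)) = 0" unfolding eq[symmetric] by simp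
    then show "x = y \<or> x = 1 - y" by auto
  next
    assume "x = y \<or> x = 1 - y"
    then have "x * (x - 1) - y * (y - 1) = 0" unfolding eq by auto
    then show "x * (x - 1) = y * (y - 1)" by simp
  qed
qed

lemma exponent_pair_half_integer:
  fixes m :: int
  shows "{1 / 2 + of_int m / 2, 1 / 2 - of_int m / 2 :: complex} =
     {1 / 2 + of_nat (nat \<bar>m\<bar>) / 2, 1 / 2 - of_nat (nat \<bar>m\<bar>) / 2}"
proof -
  have n: "of_nat (nat \<bar>m\<bar>) = (of_int \<bar>m\<bar> :: complex)" by (simp add: of_nat_nat)
  show ?thesis
  proof (cases "m \<ge> 0")
    case True
    then show ?thesis unfolding n by simp
  next
    case False
    then have "of_int \<bar>m\<bar> = (- of_int m :: complex)" by simp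
    then show ?thesis unfolding n by (simp add: insert_commute)
  qed
qed

text \<open>
  The potential in the next two lemmas is \<open>- (l' + l\<^sup>2) / (4 \<pi>\<^sup>2)\<close> for \<open>l z = x / (z - z0) + \<rho> z\<close>,
  the logarithmic derivative of a solution with exponent \<open>x\<close> at \<open>z0\<close>.
\<close>
lemma riccati_local_exponents:
  assumes "r > 0" "\<rho> holomorphic_on ball z0 r"
    and Q: "\<And>z. z \<in> ball z0 r - {z0} \<Longrightarrow>
       Q z = - ((x * (x - 1)) / (z - z0)\<^sup>2 + 2 * x * \<rho> z / (z - z0) + (\<rho> z)\<^sup>2 + deriv \<rho> z) / (4 * of_real pi ^ 2)"
  shows "local_exponents Q z0 = {x, 1 - x}"
proof -
  define A where "A = - (x * (x - 1)) / (4 * of_real pi ^ 2)"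
  define P :: complex where "P = - 1 / (4 * of_real pi ^ 2)"
  define G where "G = (\<lambda>z. P * (2 * x * \<rho> z + (z - z0) * ((\<rho> z)\<^sup>2 + deriv \<rho> z)))"
  have G: "G holomorphic_on ball z0 r"
    unfolding G_def by (intro holomorphic_intros assms holomorphic_deriv open_ball)
  have "isCont G z0"
    using holomorphic_on_imp_continuous_on[OF G] assms(1)
    by (simp add: continuous_on_eq_continuous_at)
  then have lim: "(G \<longlongrightarrow> G z0) (at z0)" by (simp add: isCont_def)
  have ev: "\<forall>\<^sub>F z in at z0. z \<in> ball z0 r - {z0}"
    using assms(1) by (intro eventually_at_in_open) auto
  have "(\<lambda>z. Q z - A / (z - z0)\<^sup>2) \<in> O[at z0](\<lambda>z. 1 / (z - z0))"
  proof (rule bigoI_tendsto)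
    show "((\<lambda>z. (Q z - A / (z - z0)\<^sup>2) / (1 / (z - z0))) \<longlongrightarrow> G z0) (at z0)"
    proof (rule Lim_transform_eventually[OF lim])
      show "\<forall>\<^sub>F z in at z0. G z = (Q z - A / (z - z0)\<^sup>2) / (1 / (z - z0))"
        using ev
      proof eventually_elim
        case (elim z)
        have QP: "Q z = P * ((x * (x - 1)) / (z - z0)\<^sup>2 + 2 * x * \<rho> z / (z - z0) + ((\<rho> z)\<^sup>2 + deriv \<rho> z))"
        proof -
          have gen: "- S / p = - 1 / p * S" for S p :: complex by simp
          show ?thesis unfolding Q[OF elim] P_def add.assoc by (rule gen)
        qed
        have AP: "A = P * (x * (x - 1))" by (simp add: A_def P_def)
        have "(P * (X / t\<^sup>2 + Y / t + Z) - (P * X) / t\<^sup>2) / (1 / t) = P * (Y + t * Z)" if "t \<noteq> 0" for X Y Z t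
          using that by (simp add: field_simps power2_eq_square)
        then show ?case using elim unfolding QP AP G_def by simp
      qed
    qed
    show "\<forall>\<^sub>F z in at z0. 1 / (z - z0) \<noteq> 0" using ev by eventually_elim auto
  qed
  from local_exponents_eq[OF this] show ?thesis
    by (auto simp: A_def mult_minus_one_eq_iff)
qed

lemma riccati_zorder:
  assumes "r > 0" "\<rho> holomorphic_on ball z0 r"
    and Q: "\<And>z. z \<in> ball z0 r - {z0} \<Longrightarrow>
       Q z = - ((x * (x - 1)) / (z - z0)\<^sup>2 + 2 * x * \<rho> z / (z - z0) + (\<rho> z)\<^sup>2 + deriv \<rho> z) / (4 * of_real pi ^ 2)"
    and mero: "Q meromorphic_on {z0}" and pole: "is_pole Q z0"
  shows "zorder Q z0 \<ge> - 2"
proof -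
  define G where "G = (\<lambda>z. - (x * (x - 1) + 2 * x * \<rho> z * (z - z0) + (z - z0)\<^sup>2 * ((\<rho> z)\<^sup>2 + deriv \<rho> z)) / (4 * of_real pi ^ 2))"
  have G: "G holomorphic_on ball z0 r"
    unfolding G_def by (intro holomorphic_intros assms holomorphic_deriv open_ball) auto
  have ev: "\<forall>\<^sub>F z in at z0. z \<in> ball z0 r - {z0}"
    using assms(1) by (intro eventually_at_in_open) auto
  have QG: "\<forall>\<^sub>F z in at z0. Q z * (z - z0) ^ 2 = G z"
    using ev
  proof eventually_elim
    case (elim z)
    have gen: "- (X / t\<^sup>2 + Y / t + Z + Z') / p * t\<^sup>2 = - (X + Y * t + t\<^sup>2 * (Z + Z')) / p"
      if "t \<noteq> 0" for X Y Z Z' t p :: complex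
      using that by (cases "p = 0") (simp_all add: field_simps power2_eq_square)
    show ?case unfolding Q[OF elim] G_def by (rule gen) (use elim in auto)
  qed
  have nz: "\<exists>\<^sub>F z in at z0. Q z \<noteq> 0"
    using non_zero_neighbour_pole[OF pole] by (simp add: eventually_frequently)
  have nz2: "\<exists>\<^sub>F z in at z0. (z - z0) ^ 2 \<noteq> 0"
    using ev by (intro eventually_frequently) (auto elim: eventually_mono)
  have nzG: "\<exists>\<^sub>F z in at z0. G z \<noteq> 0"
  proof (rule eventually_frequently)
    show "\<forall>\<^sub>F z in at z0. G z \<noteq> 0"
      using non_zero_neighbour_pole[OF pole] ev QG by eventually_elim auto
  qed auto
  have m2: "(\<lambda>z. (z - z0) ^ 2) meromorphic_on {z0}" by (intro meromorphic_intros)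
  have "zorder (\<lambda>z. Q z * (z - z0) ^ 2) z0 = zorder Q z0 + zorder (\<lambda>z. (z - z0) ^ 2) z0"
    by (rule zorder_mult[OF mero nz m2 nz2])
  also have "zorder (\<lambda>z. (z - z0) ^ 2) z0 = 2"
    by (rule zorder_eqI[where S = UNIV and g = "\<lambda>_. 1"]) auto
  also have "zorder (\<lambda>z. Q z * (z - z0) ^ 2) z0 = zorder G z0"
    by (rule zorder_cong[OF QG refl])
  finally have "zorder G z0 = zorder Q z0 + 2" .
  moreover have "zorder G z0 \<ge> 0"
    using G assms(1) nzG by (intro zorder_ge_0) (auto simp: analytic_on_holomorphic analytic_at intro!: exI[of _ "ball z0 r"])
  ultimately show ?thesis by simp
qed

lemma zero_factor_logderiv:
  assumes "F holomorphic_on S" "open S" "connected S" "z0 \<in> S" "\<exists>w\<in>S. F w \<noteq> 0"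
  obtains r u where "r > 0" "ball z0 r \<subseteq> S" "u holomorphic_on ball z0 r"
    "\<And>z. z \<in> ball z0 r \<Longrightarrow> u z \<noteq> 0"
    "\<And>z. z \<in> ball z0 r \<Longrightarrow> F z = u z * (z - z0) ^ nat (zorder F z0)"
    "\<And>z. z \<in> ball z0 r - {z0} \<Longrightarrow>
       deriv F z / F z = of_nat (nat (zorder F z0)) / (z - z0) + deriv u z / u z"
proof -
  define n where "n = nat (zorder F z0)"
  define u where "u = zor_poly F z0"
  have "\<exists>r>0. cball z0 r \<subseteq> S \<and> u holomorphic_on cball z0 r \<and>
      (\<forall>w\<in>cball z0 r. F w = u w * (w - z0) ^ n \<and> u w \<noteq> 0)"
    using zorder_exist_zero[OF assms] unfolding u_def n_def by (rule conjunct2)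
  then obtain r where r: "r > 0" "cball z0 r \<subseteq> S"
    "u holomorphic_on cball z0 r" "\<And>w. w \<in> cball z0 r \<Longrightarrow> F w = u w * (w - z0) ^ n \<and> u w \<noteq> 0"
    by blast
  have hol: "u holomorphic_on ball z0 r" using r(3) by (rule holomorphic_on_subset) auto
  have dF: "deriv F z / F z = of_nat n / (z - z0) + deriv u z / u z" if z: "z \<in> ball z0 r - {z0}" for z
  proof -
    have z': "z \<in> ball z0 r" using z by auto
    have "((\<lambda>w. u w * (w - z0) ^ n) has_field_derivative
        deriv u z * (z - z0) ^ n + of_nat n * (z - z0) ^ (n - 1) * u z) (at z)"
      by (auto intro!: derivative_eq_intros holomorphic_derivI[OF hol open_ball z'])
    then have "(F has_field_derivative deriv u z * (z - z0) ^ n + of_nat n * (z - z0) ^ (n - 1) * u z) (at z)"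
      by (rule has_field_derivative_transform_within_open[OF _ open_ball z']) (use r(4) in auto)
    then have "deriv F z = deriv u z * (z - z0) ^ n + of_nat n * (z - z0) ^ (n - 1) * u z"
      by (rule DERIV_imp_deriv)
    \<comment> \<open>For \<open>n = 0\<close> the truncated exponent \<open>n - 1\<close> does no
      harm: the factor \<open>n\<close> makes both sides zero.\<close>
    moreover have "of_nat n * (z - z0) ^ (n - 1) = of_nat n * (z - z0) ^ n / (z - z0)"
      using z by (cases n) auto
    ultimately show ?thesis
      using r(4)[of z] z by (simp add: add_divide_distrib)
  qed
  show thesis
    by (rule that[of r u]) (use r hol dF in \<open>auto simp: n_def\<close>)
qed

section \<open>The potential \<open>Q\<close>: existence, uniqueness, weight and exponents\<close>

context quasimodular
begin

lemma meromorphic_R: "R meromorphic_on uhp"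
proof -
  have "F meromorphic_on uhp" if "F holomorphic_on uhp" for F
    using that by (intro analytic_on_imp_meromorphic_on) (simp add: analytic_on_open open_uhp)
  from this[OF holomorphic_W] this[OF holomorphic_V]
  show ?thesis unfolding R_def[abs_def] \<omega>_def[abs_def]
    by (intro meromorphic_intros)
qed

lemma W_sqrt_ball:
  assumes "z \<in> uhp" "W z \<noteq> 0"
  obtains e s where "e > 0" "ball z e \<subseteq> uhp" "s holomorphic_on ball z e"
    "\<And>w. w \<in> ball z e \<Longrightarrow> W w \<noteq> 0 \<and> (s w)\<^sup>2 = W w"
proof -
  have "z \<in> {z \<in> uhp. W z \<noteq> 0}" using assms by simp
  then obtain e where e: "e > 0" "ball z e \<subseteq> {z \<in> uhp. W z \<noteq> 0}"
    using open_nonzero_set[OF holomorphic_W] by (meson open_contains_ball)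
  have "W holomorphic_on ball z e" using holomorphic_W by (rule holomorphic_on_subset) (use e in auto)
  then obtain s where "s holomorphic_on ball z e" "\<And>w. w \<in> ball z e \<Longrightarrow> W w = s w ^ 2"
    by (rule contractible_imp_holomorphic_sqrt) (use e in \<open>auto intro: convex_imp_contractible\<close>)
  with e show thesis by (intro that[of e s]) auto
qed

lemma is_Q_of_imp_R:
  assumes Q: "is_Q_of f1 f Q" and z: "z \<in> uhp" "W z \<noteq> 0"
  shows "Q z = - R z / (4 * of_real pi ^ 2)"
proof -
  obtain e s where es: "e > 0" "ball z e \<subseteq> uhp" "s holomorphic_on ball z e"
    "\<And>w. w \<in> ball z e \<Longrightarrow> W w \<noteq> 0 \<and> (s w)\<^sup>2 = W w"
    using W_sqrt_ball[OF z] by metis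
  have zb: "z \<in> ball z e" using es(1) by simp
  have s0: "s z \<noteq> 0" using es(4)[OF zb] by auto
  have hf: "(h z / s z \<noteq> 0 \<longrightarrow> Q z = - 1 / (4 * of_real pi ^ 2) * ((deriv ^^ 2) (\<lambda>z. h z / s z) z / (h z / s z))) \<and>
     (f z / s z \<noteq> 0 \<longrightarrow> Q z = - 1 / (4 * of_real pi ^ 2) * ((deriv ^^ 2) (\<lambda>z. f z / s z) z / (f z / s z)))"
    using Q[unfolded is_Q_of_def Let_def, THEN conjunct2, rule_format, of "ball z e" s z] zb es(2-4)
    by simp
  have dh: "(deriv ^^ 2) (\<lambda>z. h z / s z) z = R z * (h z / s z)"
    using deriv2_normalized[OF open_ball es(2-4) zb, of 1 0] by (simp add: comb_def numeral_2_eq_2)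
  have df: "(deriv ^^ 2) (\<lambda>z. f z / s z) z = R z * (f z / s z)"
    using deriv2_normalized[OF open_ball es(2-4) zb, of 0 1] by (simp add: comb_def numeral_2_eq_2)
  show ?thesis
  proof (cases "f z = 0")
    case True
    \<comment> \<open>Where \<open>W\<close> does not vanish, \<open>h\<close> and \<open>f\<close>
      have no common zero, so one of the two formulas always determines \<open>Q\<close>.\<close>
    then have "h z \<noteq> 0" using z(2) by (auto simp: W_fun_def)
    then show ?thesis using hf s0 by (simp add: dh)
  next
    case False
    then show ?thesis using hf s0 by (simp add: df)
  qed
qed

text \<open>At a zero of \<open>W\<close>, \<open>remove_sings\<close> takes the limit if the
  potential has one and 0 at a pole, as nice meromorphy demands. Elsewhere it changes
  nothing.\<close>

lemma is_Q_of_remove_sings: "is_Q_of f1 f (remove_sings (\<lambda>z. - R z / (4 * of_real pi ^ 2)))"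
  unfolding is_Q_of_def
proof (intro conjI allI impI)
  have "(\<lambda>z. - R z / (4 * of_real pi ^ 2)) meromorphic_on uhp"
    by (intro meromorphic_intros meromorphic_R)
  then show "remove_sings (\<lambda>z. - R z / (4 * of_real pi ^ 2)) nicely_meromorphic_on uhp"
    by (rule remove_sings_nicely_meromorphic)
next
  fix U s
  assume *: "open U \<and> U \<subseteq> uhp \<and> s holomorphic_on U \<and> (\<forall>z\<in>U. W z \<noteq> 0 \<and> (s z)\<^sup>2 = W z)"
  then have U: "open U" "U \<subseteq> uhp" "s holomorphic_on U" "\<And>w. w \<in> U \<Longrightarrow> W w \<noteq> 0 \<and> (s w)\<^sup>2 = W w"
    by auto
  have Q: "remove_sings (\<lambda>z. - R z / (4 * of_real pi ^ 2)) z = - R z / (4 * of_real pi ^ 2)" if "z \<in> U" for z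
  proof (rule remove_sings_at_analytic)
    have "(\<lambda>z. - R z / (4 * of_real pi ^ 2)) holomorphic_on U"
      using U by (intro holomorphic_intros holomorphic_on_subset[OF holomorphic_R]) auto
    then show "(\<lambda>z. - R z / (4 * of_real pi ^ 2)) analytic_on {z}"
      using U(1) that by (auto simp: analytic_at)
  qed
  define q where "q = remove_sings (\<lambda>z. - R z / (4 * of_real pi ^ 2))"
  have d: "(deriv ^^ 2) (\<lambda>z. h z / s z) z = R z * (h z / s z)"
          "(deriv ^^ 2) (\<lambda>z. f z / s z) z = R z * (f z / s z)" if "z \<in> U" for z
    using deriv2_normalized[OF U that, of 1 0] deriv2_normalized[OF U that, of 0 1]
    by (simp_all add: comb_def numeral_2_eq_2)
  show "let g1 = \<lambda>z. h z / s z; g2 = \<lambda>z. f z / s z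
           in \<forall>z\<in>U. (g1 z \<noteq> 0 \<longrightarrow> remove_sings (\<lambda>z. - R z / (4 * of_real pi ^ 2)) z =
                      - 1 / (4 * of_real pi ^ 2) * ((deriv ^^ 2) g1 z / g1 z)) \<and>
               (g2 z \<noteq> 0 \<longrightarrow> remove_sings (\<lambda>z. - R z / (4 * of_real pi ^ 2)) z =
                      - 1 / (4 * of_real pi ^ 2) * ((deriv ^^ 2) g2 z / g2 z))"
    using Q unfolding Let_def q_def [symmetric] by (simp add: d)
qed

end

locale quasimodular_potential = quasimodular +
  fixes Q :: "complex \<Rightarrow> complex"
  assumes is_Q: "is_Q_of f1 f Q"
begin

lemma nicely_meromorphic_Q: "Q nicely_meromorphic_on uhp"
  using is_Q by (simp add: is_Q_of_def)

lemma Q_eq_R: "z \<in> uhp \<Longrightarrow> W z \<noteq> 0 \<Longrightarrow> Q z = - R z / (4 * of_real pi ^ 2)"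
  by (rule is_Q_of_imp_R[OF is_Q])

lemma Q_limit_or_pole:
  assumes "z \<in> uhp"
  shows "(Q \<longlongrightarrow> Q z) (at z) \<or> (is_pole Q z \<and> Q z = 0)"
  using nicely_meromorphic_Q assms by (auto simp: nicely_meromorphic_on_def)

text \<open>The law holds on a punctured neighbourhood of every point. At the point itself, either
  \<open>Q\<close> has limits at \<open>z\<close> and at its image, and they obey the law, or both
  are poles, where nice meromorphy sets both values to 0.\<close>

lemma weakly_modular_Q: "weakly_modular 4 Q"
  unfolding weakly_modular_def
proof (intro allI impI ballI)
  fix a b c d :: int and z assume det: "a * d - b * c = 1" and z: "z \<in> uhp"
  define \<gamma> where "\<gamma> = (\<lambda>w::complex. (of_int a * w + of_int b) / (of_int c * w + of_int d))"
  define j where "j = (\<lambda>w::complex. of_int c * w + of_int d)"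
  have gz: "\<gamma> z \<in> uhp" and j0: "j z \<noteq> 0"
    using moebius_in_uhp[OF det z] by (auto simp: \<gamma>_def j_def)
  have cd: "of_int c \<noteq> (0::complex) \<or> of_int d \<noteq> (0::complex)" using det by auto
  have "\<forall>\<^sub>F w in at z. W w \<noteq> 0 \<and> w \<in> uhp"
    by (rule eventually_nonzero[OF holomorphic_W W_nonzero z])
  moreover have "\<forall>\<^sub>F w in at z. comb (of_int c) (of_int d) w \<noteq> 0 \<and> w \<in> uhp"
    by (rule eventually_nonzero[OF holomorphic_comb comb_nonzero[OF cd] z])
  ultimately have ev: "\<forall>\<^sub>F w in at z. Q (\<gamma> w) = j w ^ 4 * Q w \<and> j w \<noteq> 0"
  proof eventually_elim
    case (elim w)
    then have w: "w \<in> uhp" "W w \<noteq> 0" "comb (of_int c) (of_int d) w \<noteq> 0" by auto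
    have j: "j w \<noteq> 0" and gw: "\<gamma> w \<in> uhp" using moebius_in_uhp[OF det w(1)] by (auto simp: \<gamma>_def j_def)
    have "W (\<gamma> w) \<noteq> 0" using W_transform[OF det w(1)] j w(2) by (simp add: \<gamma>_def j_def)
    from Q_eq_R[OF gw this] Q_eq_R[OF w(1,2)] R_transform_generic[OF det w]
    show ?case using j by (simp add: \<gamma>_def j_def)
  qed
  have lim: "filterlim \<gamma> (at (\<gamma> z)) (at z)"
    unfolding \<gamma>_def by (rule filterlim_moebius_at[OF det z])
  have jl: "(j \<longlongrightarrow> j z) (at z)" unfolding j_def by (intro tendsto_intros)
  have "Q (\<gamma> z) = j z ^ 4 * Q z"
  proof (cases "(Q \<longlongrightarrow> Q (\<gamma> z)) (at (\<gamma> z))")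
    case True
    then have "((\<lambda>w. Q (\<gamma> w)) \<longlongrightarrow> Q (\<gamma> z)) (at z)"
      by (rule filterlim_compose[OF _ lim])
    then have "((\<lambda>w. Q (\<gamma> w) / j w ^ 4) \<longlongrightarrow> Q (\<gamma> z) / j z ^ 4) (at z)"
      using jl j0 by (intro tendsto_intros) auto
    then have Ql: "(Q \<longlongrightarrow> Q (\<gamma> z) / j z ^ 4) (at z)"
      by (rule Lim_transform_eventually) (use ev in \<open>auto elim: eventually_mono\<close>)
    then have "\<not> is_pole Q z"
      unfolding is_pole_def using not_tendsto_and_filterlim_at_infinity[of "at z"] by auto
    then have "(Q \<longlongrightarrow> Q z) (at z)" using Q_limit_or_pole[OF z] by auto
    with Ql have "Q (\<gamma> z) / j z ^ 4 = Q z" by (intro tendsto_unique[of "at z"]) auto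
    then show ?thesis using j0 by (simp add: field_simps)
  next
    case False
    then have p: "is_pole Q (\<gamma> z)" "Q (\<gamma> z) = 0" using Q_limit_or_pole[OF gz] by auto
    have "\<not> (Q \<longlongrightarrow> Q z) (at z)"
    proof
      assume "(Q \<longlongrightarrow> Q z) (at z)"
      then have "((\<lambda>w. j w ^ 4 * Q w) \<longlongrightarrow> j z ^ 4 * Q z) (at z)" by (intro tendsto_intros jl)
      then have "((\<lambda>w. Q (\<gamma> w)) \<longlongrightarrow> j z ^ 4 * Q z) (at z)"
        by (rule Lim_transform_eventually) (use ev in \<open>auto elim: eventually_mono\<close>)
      moreover have "filterlim (\<lambda>w. Q (\<gamma> w)) at_infinity (at z)"
        using p(1) lim unfolding is_pole_def by (rule filterlim_compose)
      ultimately show False using not_tendsto_and_filterlim_at_infinity[of "at z"] by auto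
    qed
    then show ?thesis using Q_limit_or_pole[OF z] p(2) by auto
  qed
  then show "Q ((of_int a * z + of_int b) / (of_int c * z + of_int d)) = (of_int c * z + of_int d) powi 4 * Q z"
    by (simp add: \<gamma>_def j_def)
qed

lemma local_riccati:
  assumes z0: "z0 \<in> uhp" and nz: "\<alpha> \<noteq> 0 \<or> \<beta> \<noteq> 0"
  defines "x \<equiv> of_nat (nat (zorder (comb \<alpha> \<beta>) z0)) - of_nat (nat (zorder W z0)) / 2"
  obtains r \<rho> where "r > 0" "\<rho> holomorphic_on ball z0 r"
    "\<And>z. z \<in> ball z0 r - {z0} \<Longrightarrow>
       Q z = - ((x * (x - 1)) / (z - z0)\<^sup>2 + 2 * x * \<rho> z / (z - z0) + (\<rho> z)\<^sup>2 + deriv \<rho> z) / (4 * of_real pi ^ 2)"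
proof -
  obtain r1 u where u: "r1 > 0" "ball z0 r1 \<subseteq> uhp" "u holomorphic_on ball z0 r1"
    "\<And>z. z \<in> ball z0 r1 \<Longrightarrow> u z \<noteq> 0"
    "\<And>z. z \<in> ball z0 r1 \<Longrightarrow> comb \<alpha> \<beta> z = u z * (z - z0) ^ nat (zorder (comb \<alpha> \<beta>) z0)"
    "\<And>z. z \<in> ball z0 r1 - {z0} \<Longrightarrow>
       deriv (comb \<alpha> \<beta>) z / comb \<alpha> \<beta> z = of_nat (nat (zorder (comb \<alpha> \<beta>) z0)) / (z - z0) + deriv u z / u z"
    using zero_factor_logderiv[OF holomorphic_comb open_uhp connected_uhp z0 comb_nonzero[OF nz]] by metis
  obtain r2 e where e: "r2 > 0" "ball z0 r2 \<subseteq> uhp" "e holomorphic_on ball z0 r2"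
    "\<And>z. z \<in> ball z0 r2 \<Longrightarrow> e z \<noteq> 0"
    "\<And>z. z \<in> ball z0 r2 \<Longrightarrow> W z = e z * (z - z0) ^ nat (zorder W z0)"
    "\<And>z. z \<in> ball z0 r2 - {z0} \<Longrightarrow>
       deriv W z / W z = of_nat (nat (zorder W z0)) / (z - z0) + deriv e z / e z"
    using zero_factor_logderiv[OF holomorphic_W open_uhp connected_uhp z0 W_nonzero] by metis
  define r where "r = min r1 r2"
  have sub: "ball z0 r \<subseteq> ball z0 r1" "ball z0 r \<subseteq> ball z0 r2" by (auto simp: r_def)
  \<comment> \<open>The regular part of \<open>L \<alpha> \<beta>\<close>: the zero-free cofactors
    \<open>u\<close> of \<open>y\<close> and \<open>e\<close> of \<open>W\<close> have holomorphic
    logarithmic derivatives, the latter halved by the square root.\<close>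
  define \<rho> where "\<rho> = (\<lambda>z. deriv u z / u z - deriv e z / e z / 2)"
  have "r > 0" using u e by (simp add: r_def)
  moreover have \<rho>: "\<rho> holomorphic_on ball z0 r"
    unfolding \<rho>_def using u(4) e(4) sub
    by (intro holomorphic_intros holomorphic_on_subset[OF holomorphic_deriv[OF u(3) open_ball] sub(1)]
          holomorphic_on_subset[OF holomorphic_deriv[OF e(3) open_ball] sub(2)]
          holomorphic_on_subset[OF u(3) sub(1)] holomorphic_on_subset[OF e(3) sub(2)]) auto
  moreover have "Q z = - ((x * (x - 1)) / (z - z0)\<^sup>2 + 2 * x * \<rho> z / (z - z0) + (\<rho> z)\<^sup>2 + deriv \<rho> z) / (4 * of_real pi ^ 2)"
    if z: "z \<in> ball z0 r - {z0}" for z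
  proof -
    have L: "L \<alpha> \<beta> w = x / (w - z0) + \<rho> w" if w: "w \<in> ball z0 r - {z0}" for w
    proof -
      have "w \<in> ball z0 r1 - {z0}" "w \<in> ball z0 r2 - {z0}" using w sub by auto
      then show ?thesis
      proof -
        have half: "deriv W w / (2 * W w) = deriv W w / W w / 2" by simp
        have "n / t + p - (m / t + q) / 2 = (n - m / 2) / t + (p - q / 2)" if "t \<noteq> 0" for n m p q t :: complex
          using that by (simp add: field_simps)
        then show ?thesis
          unfolding L_def \<omega>_def half u(6)[OF \<open>w \<in> ball z0 r1 - {z0}\<close>] e(6)[OF \<open>w \<in> ball z0 r2 - {z0}\<close>]
            \<rho>_def x_def using w by simp
      qed
    qed
    have zz: "z \<in> uhp" "W z \<noteq> 0" "comb \<alpha> \<beta> z \<noteq> 0"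
      using z sub u(2) u(4,5)[of z] e(4,5)[of z] by auto
    have "((\<lambda>w. x / (w - z0) + \<rho> w) has_field_derivative - x / (z - z0)\<^sup>2 + deriv \<rho> z) (at z)"
      using z by (auto intro!: derivative_eq_intros holomorphic_derivI[OF \<rho> open_ball] simp: power2_eq_square)
    then have "(L \<alpha> \<beta> has_field_derivative - x / (z - z0)\<^sup>2 + deriv \<rho> z) (at z)"
      by (rule has_field_derivative_transform_within_open[where S = "ball z0 r - {z0}"])
         (use z L in \<open>auto simp: open_delete\<close>)
    from DERIV_unique[OF this L_has_field_derivative[OF zz]]
    have "R z = (x / (z - z0) + \<rho> z)\<^sup>2 + (- x / (z - z0)\<^sup>2 + deriv \<rho> z)"
      using L[OF z] by (simp add: algebra_simps)
    also have "\<dots> = (x * (x - 1)) / (z - z0)\<^sup>2 + 2 * x * \<rho> z / (z - z0) + (\<rho> z)\<^sup>2 + deriv \<rho> z"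
      by (simp add: power2_eq_square algebra_simps add_divide_distrib diff_divide_distrib)
    finally show ?thesis using Q_eq_R[OF zz(1,2)] by simp
  qed
  ultimately show thesis by (rule that)
qed

text \<open>Every nonzero \<open>y\<close> gives the same set, so \<open>y\<close> can be chosen to
  suit the point. With \<open>m = 2 ord y - ord W - 1\<close> the residue is
  \<open>1 / 2 + m / 2\<close>, and the sign of \<open>m\<close> only exchanges the two
  exponents.\<close>

lemma local_exponents_Q:
  assumes z0: "z0 \<in> uhp" and nz: "\<alpha> \<noteq> 0 \<or> \<beta> \<noteq> 0"
  defines "n \<equiv> nat \<bar>2 * zorder (comb \<alpha> \<beta>) z0 - zorder W z0 - 1\<bar>"
  shows "local_exponents Q z0 = {1 / 2 + of_nat n / 2, 1 / 2 - of_nat n / 2}"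
proof -
  obtain w where "w \<in> uhp" "comb \<alpha> \<beta> w \<noteq> 0" using comb_nonzero[OF nz] by blast
  then have "zorder (comb \<alpha> \<beta>) z0 \<ge> 0"
    using zorder_exist_zero[OF holomorphic_comb open_uhp connected_uhp z0] by (metis order.refl less_imp_le)
  moreover have "zorder W z0 \<ge> 0"
    using zorder_exist_zero[OF holomorphic_W open_uhp connected_uhp z0 W_nonzero] by (metis order.refl less_imp_le)
  ultimately have nat: "of_nat (nat (zorder (comb \<alpha> \<beta>) z0)) = (of_int (zorder (comb \<alpha> \<beta>) z0) :: complex)"
    "of_nat (nat (zorder W z0)) = (of_int (zorder W z0) :: complex)"
    by (simp_all add: of_nat_nat)
  define x :: complex where "x = of_nat (nat (zorder (comb \<alpha> \<beta>) z0)) - of_nat (nat (zorder W z0)) / 2"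
  define m where "m = 2 * zorder (comb \<alpha> \<beta>) z0 - zorder W z0 - 1"
  obtain r \<rho> where "r > 0" "\<rho> holomorphic_on ball z0 r"
    "\<And>z. z \<in> ball z0 r - {z0} \<Longrightarrow>
       Q z = - ((x * (x - 1)) / (z - z0)\<^sup>2 + 2 * x * \<rho> z / (z - z0) + (\<rho> z)\<^sup>2 + deriv \<rho> z) / (4 * of_real pi ^ 2)"
    using local_riccati[OF z0 nz] unfolding x_def by metis
  then have "local_exponents Q z0 = {x, 1 - x}" by (rule riccati_local_exponents)
  also have "x = of_int (zorder (comb \<alpha> \<beta>) z0) - of_int (zorder W z0) / 2"
    unfolding x_def nat by (rule refl)
  also have "\<dots> = 1 / 2 + of_int m / 2" by (simp add: m_def diff_divide_distrib)
  also have "1 - (1 / 2 + of_int m / 2) = (1 / 2 - of_int m / 2 :: complex)" by simp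
  also note exponent_pair_half_integer[of m]
  finally show ?thesis by (simp only: n_def m_def)
qed

lemma fuchsian_on_uhp_Q: "fuchsian_on_uhp Q"
  unfolding fuchsian_on_uhp_def
proof (intro ballI impI)
  fix z0 assume z0: "z0 \<in> uhp" and pole: "is_pole Q z0"
  have mero: "Q meromorphic_on {z0}"
    using nicely_meromorphic_Q z0 by (auto simp: nicely_meromorphic_on_def intro: meromorphic_on_subset)
  show "zorder Q z0 \<ge> - 2"
  proof (rule local_riccati[OF z0, of 0 1])
    fix r \<rho> assume "0 < r" "\<rho> holomorphic_on ball z0 r"
      "\<And>z. z \<in> ball z0 r - {z0} \<Longrightarrow> Q z = - (
        (of_nat (nat (zorder (comb 0 1) z0)) - of_nat (nat (zorder W z0)) / 2) *
        (of_nat (nat (zorder (comb 0 1) z0)) - of_nat (nat (zorder W z0)) / 2 - 1) / (z - z0)\<^sup>2 +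
        2 * (of_nat (nat (zorder (comb 0 1) z0)) - of_nat (nat (zorder W z0)) / 2) * \<rho> z / (z - z0) +
        (\<rho> z)\<^sup>2 + deriv \<rho> z) / (4 * of_real pi ^ 2)"
    then show ?thesis using mero pole by (rule riccati_zorder)
  qed simp
qed

end

subsection \<open>Absence of logarithms\<close>

text \<open>Continue along \<open>w \<mapsto> w + 2\<pi>\<i>\<close> in the coordinate \<open>z = z0 + exp w\<close>: the right-hand side does not change.\<close>
lemma log_expansion_single_valued:
  assumes r: "r > 0" and hol: "u holomorphic_on ball z0 r" "v holomorphic_on ball z0 r" "p holomorphic_on ball z0 r"
    and eq: "\<And>w. Re w < ln r \<Longrightarrow> \<bar>Im w\<bar> < pi / 2 \<Longrightarrow>
        exp (\<beta> * w) * (w * u (z0 + exp w) + v (z0 + exp w)) = p (z0 + exp w)"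
    and z: "z \<in> ball z0 r"
  shows "u z = 0"
proof -
  define H where "H = {w. Re w < ln r}"
  define T where "T = H \<inter> {w. \<bar>Im w\<bar> < pi / 2}"
  have H: "open H" "connected H"
    unfolding H_def by (auto intro: open_halfspace_Re_lt convex_connected convex_halfspace_Re_lt)
  have "T = H \<inter> {w. Im w < pi / 2} \<inter> {w. Im w > - (pi / 2)}" by (auto simp: T_def)
  also have "open \<dots>" by (intro open_Int H open_halfspace_Im_lt open_halfspace_Im_gt)
  finally have T: "open T" .
  have "of_real (ln r - 1) \<in> T" by (auto simp: T_def H_def)
  then have T': "T \<noteq> {}" "T \<subseteq> H" by (auto simp: T_def)
  have inb: "z0 + exp w \<in> ball z0 r" if "w \<in> H" for w
  proof -
    have "exp (Re w) < exp (ln r)" using that by (simp add: H_def)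
    then show ?thesis using r by (simp add: dist_norm)
  qed
  have cmp: "(\<lambda>w. F (z0 + exp w)) holomorphic_on H" if "F holomorphic_on ball z0 r" for F
  proof -
    have "(\<lambda>w. z0 + exp w) holomorphic_on H" by (intro holomorphic_intros)
    moreover have "(\<lambda>w. z0 + exp w) ` H \<subseteq> ball z0 r" using inb by blast
    ultimately show ?thesis
      using holomorphic_on_compose_gen[of "\<lambda>w. z0 + exp w" H F "ball z0 r"] that by (simp add: o_def)
  qed
  \<comment> \<open>The strip \<open>|Im w| < \<pi> / 2\<close> covers only the right half of the
    disc. The identity theorem carries the equation to the whole half-plane \<open>H\<close>, where
    \<open>w\<close> can move by \<open>2 \<pi> \<i>\<close>.\<close>
  have E: "exp (\<beta> * w) * (w * u (z0 + exp w) + v (z0 + exp w)) = p (z0 + exp w)" if "w \<in> H" for w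
  proof (rule analytic_continuation_open[OF T H(1) T'(1) H(2) T'(2) _ _ _ that])
    show "(\<lambda>w. exp (\<beta> * w) * (w * u (z0 + exp w) + v (z0 + exp w))) holomorphic_on H"
      by (intro holomorphic_intros cmp hol)
  qed (use eq cmp[OF hol(3)] in \<open>auto simp: T_def H_def\<close>)
  define \<tau> where "\<tau> = 2 * of_real pi * \<i>"
  have exp\<tau>: "exp (w + \<tau>) = exp w" for w by (simp add: \<tau>_def exp_add)
  have H\<tau>: "w + \<tau> \<in> H" if "w \<in> H" for w using that by (simp add: H_def \<tau>_def)
  define \<mu> where "\<mu> = exp (\<beta> * \<tau>)"
  \<comment> \<open>The equation at \<open>w + \<tau>\<close> compared with the one at
    \<open>w\<close>: \<open>\<mu>\<close> is the multiplier of the power, and the last term is the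
    increment of the logarithm.\<close>
  have step: "(\<mu> - 1) * (w * u (z0 + exp w) + v (z0 + exp w)) + \<mu> * \<tau> * u (z0 + exp w) = 0" if w: "w \<in> H" for w
  proof -
    have "exp (\<beta> * (w + \<tau>)) * ((w + \<tau>) * u (z0 + exp w) + v (z0 + exp w)) =
        exp (\<beta> * w) * (w * u (z0 + exp w) + v (z0 + exp w))"
      using E[OF H\<tau>[OF w]] E[OF w] by (simp add: exp\<tau>)
    moreover have "exp (\<beta> * (w + \<tau>)) = exp (\<beta> * w) * \<mu>" by (simp add: \<mu>_def distrib_left exp_add)
    ultimately have "exp (\<beta> * w) * (\<mu> * ((w + \<tau>) * u (z0 + exp w) + v (z0 + exp w))) =
        exp (\<beta> * w) * (w * u (z0 + exp w) + v (z0 + exp w))" by (simp add: mult.assoc)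
    then have "\<mu> * ((w + \<tau>) * u (z0 + exp w) + v (z0 + exp w)) = w * u (z0 + exp w) + v (z0 + exp w)"
      by simp
    then show ?thesis by (simp add: algebra_simps)
  qed
  have u0: "u (z0 + exp w) = 0" if w: "w \<in> H" for w
  proof -
    define U where "U = u (z0 + exp w)"
    define X where "X = v (z0 + exp w)"
    \<comment> \<open>A second turn eliminates the unknown \<open>X\<close> and forces
      \<open>u = 0\<close> if \<open>\<mu> \<noteq> 1\<close>; for \<open>\<mu> = 1\<close> a single
      turn already does.\<close>
    have "(\<mu> - 1) * ((w + \<tau>) * U + X) + \<mu> * \<tau> * U = 0"
      using step[OF H\<tau>[OF w]] unfolding exp\<tau> U_def X_def .
    moreover have "(\<mu> - 1) * (w * U + X) + \<mu> * \<tau> * U = 0"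
      using step[OF w] unfolding U_def X_def .
    ultimately have "(\<mu> - 1) * ((w + \<tau>) * U + X) - (\<mu> - 1) * (w * U + X) = 0"
      by (simp add: add_eq_0_iff2)
    then have "(\<mu> - 1) * \<tau> * u (z0 + exp w) = 0"
      by (simp only: U_def [symmetric]) (simp add: algebra_simps)
    moreover have "\<tau> \<noteq> 0" by (simp add: \<tau>_def)
    moreover have "u (z0 + exp w) = 0" if "\<mu> = 1" using step[OF w] that \<open>\<tau> \<noteq> 0\<close> by simp
    ultimately show ?thesis by auto
  qed
  have punct: "u x = 0" if "x \<in> ball z0 r" "x \<noteq> z0" for x
  proof -
    have "norm (x - z0) < r" "x - z0 \<noteq> 0" using that by (auto simp: dist_norm norm_minus_commute)
    then have "Ln (x - z0) \<in> H" using r by (simp add: H_def)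
    from u0[OF this] \<open>x - z0 \<noteq> 0\<close> show ?thesis by simp
  qed
  show ?thesis
  proof (cases "z = z0")
    case True
    have "isCont u z0"
      using holomorphic_on_imp_continuous_on[OF hol(1)] r by (simp add: continuous_on_eq_continuous_at)
    then have "(u \<longlongrightarrow> u z0) (at z0)" by (simp add: isCont_def)
    moreover have "\<forall>\<^sub>F x in at z0. x \<in> ball z0 r - {z0}" using r by (intro eventually_at_in_open) auto
    then have "\<forall>\<^sub>F x in at z0. u x = 0" by eventually_elim (use punct in auto)
    then have "(u \<longlongrightarrow> 0) (at z0)" by (rule tendsto_eventually)
    ultimately show ?thesis using True tendsto_unique[of "at z0"] by auto
  next
    case False then show ?thesis using punct z by blast
  qed
qed

context quasimodular_potential
begin

text \<open>Without a first-order term in the equation, the Wronskian of two solutions is constant.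
  The constants formed with \<open>h / s\<close> and \<open>f / s\<close> give the coordinates of
  \<open>y\<close>, since those two have Wronskian \<open>W / s^2 = 1\<close>.\<close>

lemma solution_in_span:
  assumes D: "open D" "convex D" "D \<subseteq> uhp" and s: "s holomorphic_on D" "\<And>w. w \<in> D \<Longrightarrow> W w \<noteq> 0 \<and> (s w)\<^sup>2 = W w"
    and y: "solution_on Q D y"
  obtains \<alpha> \<beta> where "\<And>z. z \<in> D \<Longrightarrow> y z * s z = comb \<alpha> \<beta> z"
proof -
  define g where "g = (\<lambda>\<alpha> \<beta> w. comb \<alpha> \<beta> w / s w)"
  have s0: "s w \<noteq> 0" if "w \<in> D" for w using s(2)[OF that] by auto
  have hol: "g \<alpha> \<beta> holomorphic_on D" for \<alpha> \<beta>
    unfolding g_def by (intro holomorphic_intros holomorphic_on_subset[OF holomorphic_comb] D s s0)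
  have yh: "y holomorphic_on D" and y2: "\<And>z. z \<in> D \<Longrightarrow> deriv (deriv y) z = R z * y z"
  proof -
    show "y holomorphic_on D" using y by (simp add: solution_on_def)
    fix z assume z: "z \<in> D"
    then have "deriv (deriv y) z = - 4 * of_real pi ^ 2 * Q z * y z"
      using y by (simp add: solution_on_def numeral_2_eq_2)
    also have "Q z = - R z / (4 * of_real pi ^ 2)" using Q_eq_R z D s(2) by blast
    finally show "deriv (deriv y) z = R z * y z" by simp
  qed
  have g2: "deriv (deriv (g \<alpha> \<beta>)) z = R z * g \<alpha> \<beta> z" if "z \<in> D" for \<alpha> \<beta> z
    unfolding g_def by (rule deriv2_normalized[OF D(1,3) s that])
  have const: "\<exists>c. \<forall>z\<in>D. p z * deriv q z - deriv p z * q z = c"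
    if p: "p holomorphic_on D" "\<And>z. z \<in> D \<Longrightarrow> deriv (deriv p) z = R z * p z"
      and q: "q holomorphic_on D" "\<And>z. z \<in> D \<Longrightarrow> deriv (deriv q) z = R z * q z" for p q
  proof (rule has_field_derivative_zero_constant[OF D(2)])
    fix z assume z: "z \<in> D"
    have "((\<lambda>z. p z * deriv q z - deriv p z * q z) has_field_derivative
        (deriv p z * deriv q z + deriv (deriv q) z * p z - (deriv (deriv p) z * q z + deriv q z * deriv p z))) (at z)"
      by (rule derivative_eq_intros refl holomorphic_derivI[OF p(1) D(1) z] holomorphic_derivI[OF q(1) D(1) z]
            holomorphic_derivI[OF holomorphic_deriv[OF p(1) D(1)] D(1) z]
            holomorphic_derivI[OF holomorphic_deriv[OF q(1) D(1)] D(1) z])+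
    then have "((\<lambda>z. p z * deriv q z - deriv p z * q z) has_field_derivative 0) (at z)"
      by (simp add: p(2)[OF z] q(2)[OF z] algebra_simps)
    then show "((\<lambda>z. p z * deriv q z - deriv p z * q z) has_field_derivative 0) (at z within D)"
      by (rule has_field_derivative_at_within)
  qed
  have "\<exists>B. \<forall>z\<in>D. g 1 0 z * deriv y z - deriv (g 1 0) z * y z = B"
    by (rule const[OF hol g2 yh y2])
  then obtain B where B: "\<And>z. z \<in> D \<Longrightarrow> g 1 0 z * deriv y z - deriv (g 1 0) z * y z = B"
    by auto
  have "\<exists>C. \<forall>z\<in>D. g 0 1 z * deriv y z - deriv (g 0 1) z * y z = C"
    by (rule const[OF hol g2 yh y2])
  then obtain C where C: "\<And>z. z \<in> D \<Longrightarrow> g 0 1 z * deriv y z - deriv (g 0 1) z * y z = C"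
    by auto
  have wr: "g 1 0 z * deriv (g 0 1) z - deriv (g 1 0) z * g 0 1 z = 1" if z: "z \<in> D" for z
  proof -
    have zu: "z \<in> uhp" using z D by auto
    have dg: "deriv (g \<alpha> \<beta>) z = (deriv (comb \<alpha> \<beta>) z * s z - comb \<alpha> \<beta> z * deriv s z) / (s z * s z)" for \<alpha> \<beta>
      unfolding g_def
      by (rule DERIV_imp_deriv, (rule derivative_eq_intros refl zu s0[OF z] holomorphic_derivI[OF s(1) D(1) z])+)
    have "g 1 0 z * deriv (g 0 1) z - deriv (g 1 0) z * g 0 1 z =
       (comb 1 0 z * deriv (comb 0 1) z - deriv (comb 1 0) z * comb 0 1 z) / (s z)\<^sup>2"
      unfolding dg unfolding g_def using s0[OF z] by (simp add: field_simps power2_eq_square)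
    also have "comb 1 0 z * deriv (comb 0 1) z - deriv (comb 1 0) z * comb 0 1 z = W z"
      using zu by (simp add: deriv_comb) (simp add: comb_def W_fun_def mult.commute)
    finally show ?thesis using s(2)[OF z] by simp
  qed
  have "y z * s z = comb (- C) B z" if z: "z \<in> D" for z
  proof -
    have "y z = y z * (g 1 0 z * deriv (g 0 1) z - deriv (g 1 0) z * g 0 1 z)" using wr[OF z] by simp
    also have "\<dots> = B * g 0 1 z - C * g 1 0 z"
      unfolding B[OF z, symmetric] C[OF z, symmetric] by (simp add: algebra_simps)
    finally have "y z * s z = (B * g 0 1 z - C * g 1 0 z) * s z" by simp
    also have "\<dots> = comb (- C) B z"
      using s0[OF z] by (simp add: g_def comb_def algebra_simps)
    finally show ?thesis .
  qed
  then show thesis by (rule that)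
qed

text \<open>A solution times \<open>s\<close> lies in the span and is therefore single-valued on the
  full disc, whereas a genuine logarithm would survive multiplication by a power of
  \<open>z - z0\<close> and a zero-free holomorphic factor.\<close>

lemma no_log_solution:
  assumes z0: "z0 \<in> uhp"
  shows "\<not> has_log_solution Q z0"
proof
  assume "has_log_solution Q z0"
  then obtain r y \<alpha> u v where r: "r > 0" and sol: "solution_on Q (slit_ball z0 r) y"
    and uv: "u holomorphic_on ball z0 r" "v holomorphic_on ball z0 r"
    and unz: "\<exists>z\<in>ball z0 r. u z \<noteq> 0"
    and y: "\<And>z. z \<in> slit_ball z0 r \<Longrightarrow> y z = (z - z0) powr \<alpha> * (Ln (z - z0) * u z + v z)"
    unfolding has_log_solution_def by blast
  define N where "N = nat (zorder W z0)"
  obtain r2 e where e: "r2 > 0" "ball z0 r2 \<subseteq> uhp" "e holomorphic_on ball z0 r2"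
    "\<And>z. z \<in> ball z0 r2 \<Longrightarrow> e z \<noteq> 0"
    "\<And>z. z \<in> ball z0 r2 \<Longrightarrow> W z = e z * (z - z0) ^ N"
    using zero_factor_logderiv[OF holomorphic_W open_uhp connected_uhp z0 W_nonzero] unfolding N_def by metis
  define \<rho> where "\<rho> = min r r2"
  have \<rho>: "\<rho> > 0" "ball z0 \<rho> \<subseteq> ball z0 r" "ball z0 \<rho> \<subseteq> ball z0 r2"
    using r e by (auto simp: \<rho>_def)
  obtain t where t: "t holomorphic_on ball z0 r2" "\<And>z. z \<in> ball z0 r2 \<Longrightarrow> e z = t z ^ 2"
    using contractible_imp_holomorphic_sqrt[OF e(3) convex_imp_contractible[OF convex_ball] e(4)] by metis
  \<comment> \<open>The right half of a small disc: convex, as the Wronskian argument requires, and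
    disjoint from the cut of \<open>Ln (z - z0)\<close>.\<close>
  define D where "D = ball z0 \<rho> \<inter> {z. Re z > Re z0}"
  have D: "open D" "convex D" "D \<subseteq> uhp"
    using e(2) \<rho>(3) by (auto simp: D_def intro: open_halfspace_Re_gt convex_Int convex_halfspace_Re_gt)
  have Dslit: "D \<subseteq> slit_ball z0 r"
    using \<rho>(2) by (auto simp: D_def slit_ball_def complex_nonpos_Reals_iff)
  have Dnz: "z - z0 \<noteq> 0" "z - z0 \<notin> \<real>\<^sub>\<le>\<^sub>0" "z \<in> ball z0 r2" "z \<in> ball z0 r" if "z \<in> D" for z
    using that \<rho> by (auto simp: D_def complex_nonpos_Reals_iff)
  define s where "s = (\<lambda>z. exp (of_nat N / 2 * Ln (z - z0)) * t z)"
  have s: "s holomorphic_on D" unfolding s_def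
    by (intro holomorphic_intros holomorphic_on_subset[OF t(1)]) (use Dnz in auto)
  have sW: "W w \<noteq> 0 \<and> (s w)\<^sup>2 = W w" if w: "w \<in> D" for w
  proof
    show "W w \<noteq> 0" using e(4,5) Dnz[OF w] by simp
    have "(exp (of_nat N / 2 * Ln (w - z0)))\<^sup>2 = exp (of_nat N * Ln (w - z0))"
      by (simp flip: exp_double)
    also have "\<dots> = (w - z0) ^ N" using Dnz(1)[OF w] by (simp add: exp_of_nat_mult)
    finally show "(s w)\<^sup>2 = W w"
      using e(5) t(2) Dnz[OF w] by (simp add: s_def power_mult_distrib mult.commute)
  qed
  have sol': "solution_on Q D y"
    using sol Dslit by (auto simp: solution_on_def intro: holomorphic_on_subset)
  obtain A B where AB: "\<And>z. z \<in> D \<Longrightarrow> y z * s z = comb A B z"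
    using solution_in_span[OF D s sW sol'] by metis
  have ut0: "u z * t z = 0" if z: "z \<in> ball z0 \<rho>" for z
  proof (rule log_expansion_single_valued[OF \<rho>(1) _ _ _ _ z])
    show "(\<lambda>z. u z * t z) holomorphic_on ball z0 \<rho>" "(\<lambda>z. v z * t z) holomorphic_on ball z0 \<rho>"
      by (intro holomorphic_intros holomorphic_on_subset[OF uv(1) \<rho>(2)] holomorphic_on_subset[OF uv(2) \<rho>(2)]
           holomorphic_on_subset[OF t(1) \<rho>(3)])+
    show "comb A B holomorphic_on ball z0 \<rho>"
      using holomorphic_comb by (rule holomorphic_on_subset) (use e(2) \<rho>(3) in auto)
    fix w assume w: "Re w < ln \<rho>" "\<bar>Im w\<bar> < pi / 2"
    have "exp (Re w) < exp (ln \<rho>)" using w by simp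
    then have "norm (exp w) < \<rho>" using \<rho>(1) by simp
    moreover have "Re (exp w) > 0" using w(2) by (auto simp: Re_exp intro!: mult_pos_pos cos_gt_zero_pi)
    ultimately have wD: "z0 + exp w \<in> D" by (simp add: D_def dist_norm)
    have ln: "Ln (exp w) = w" using w(2) pi_gt_zero by (intro Ln_exp) linarith+
    have "y (z0 + exp w) = exp (\<alpha> * w) * (w * u (z0 + exp w) + v (z0 + exp w))"
      using y[of "z0 + exp w"] wD Dslit by (auto simp: powr_def ln)
    moreover have "s (z0 + exp w) = exp (of_nat N / 2 * w) * t (z0 + exp w)"
      by (simp add: s_def ln)
    ultimately show "exp ((\<alpha> + of_nat N / 2) * w) * (w * (u (z0 + exp w) * t (z0 + exp w)) + v (z0 + exp w) * t (z0 + exp w)) =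
        comb A B (z0 + exp w)"
      using AB[OF wD] by (simp add: distrib_right exp_add algebra_simps)
  qed
  have u0: "u z = 0" if "z \<in> ball z0 \<rho>" for z
    using ut0[OF that] t(2)[of z] e(4)[of z] that \<rho>(3) by auto
  have "u z = 0" if "z \<in> ball z0 r" for z
    by (rule analytic_continuation_open[of "ball z0 \<rho>" "ball z0 r" u "\<lambda>_. 0" z])
       (use uv(1) \<rho> u0 that in auto)
  with unz show False by blast
qed

lemma apparent_at_Q:
  assumes "z0 \<in> uhp"
  shows "apparent_at Q z0"
  unfolding apparent_at_def
  by (intro conjI no_log_solution[OF assms] exI, rule local_exponents_Q[OF assms, of 0 1]) simp

end

subsection \<open>Elliptic points\<close>

definition rho :: complex where "rho = (1 + \<i> * of_real (sqrt 3)) / 2"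

lemma rho_square: "rho ^ 2 = rho - 1"
proof (rule complex_eqI)
  have "sqrt 3 * sqrt 3 = 3" by simp
  then show "Re (rho ^ 2) = Re (rho - 1)" by (simp add: rho_def power2_eq_square)
  show "Im (rho ^ 2) = Im (rho - 1)" by (simp add: rho_def power2_eq_square)
qed

lemma rho_in_uhp: "rho \<in> uhp"
  by (simp add: uhp_def rho_def)

lemma rho_nonzero: "rho \<noteq> 0"
  using rho_in_uhp by (auto simp: uhp_def)

text \<open>\<open>rho\<close> is a primitive sixth root of unity. By \<open>rho^3 = - 1\<close> the
  exponent reduces modulo 3 up to a sign, and for the residues 1 and 2 the power is not
  real.\<close>

lemma rho_power_eq_1:
  assumes "rho powi m = 1"
  shows "3 dvd m"
proof -
  have nz: "rho \<noteq> 0" by (rule rho_nonzero)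
  have "rho ^ 3 = rho * rho ^ 2" by (simp add: power3_eq_cube power2_eq_square)
  also have "\<dots> = rho * (rho - 1)" by (simp only: rho_square)
  also have "\<dots> = rho ^ 2 - rho" by (simp add: algebra_simps power2_eq_square)
  also have "\<dots> = - 1" by (simp only: rho_square) simp
  finally have r3: "rho ^ 3 = - 1" .
  define s where "s = nat (m mod 3)"
  have s: "s < 3" "m = 3 * (m div 3) + int s" by (auto simp: s_def)
  have "rho powi m = (rho powi 3) powi (m div 3) * rho powi (int s)"
    using nz by (subst s(2)) (simp only: power_int_add power_int_mult simp_thms)
  also have "rho powi 3 = - 1" using r3 by simp
  finally have eq: "(- 1) powi (m div 3) * rho ^ s = 1" using assms by simp
  have "(- 1 :: complex) powi (m div 3) \<in> {1, - 1}" by (simp add: power_int_minus_left)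
  then have "rho ^ s = 1 \<or> rho ^ s = - 1" using eq by (auto simp: minus_equation_iff)
  then have im: "Im (rho ^ s) = 0" by auto
  consider "s = 0" | "s = 1" | "s = 2" using s(1) by linarith
  then show ?thesis
  proof cases
    case 1 then show ?thesis using s(2) by presburger
  next
    case 2 then show ?thesis using im rho_in_uhp by (simp add: uhp_def)
  next
    case 3 then show ?thesis using im rho_in_uhp unfolding 3 rho_square by (simp add: uhp_def)
  qed
qed

text \<open>Comparison of leading terms at \<open>z0\<close>: the substitution has derivative
  \<open>j^(-2)\<close> there, so a zero of order \<open>N\<close> picks up \<open>j^(-2 N)\<close>.
  The multiplier \<open>\<mu>\<close> admits eigenvectors in the span of \<open>h\<close> and
  \<open>f\<close>.\<close>

lemma zorder_fixed_point:
  fixes a b c d n :: int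
  assumes det: "a * d - b * c = 1" and z0: "z0 \<in> uhp"
    and fix_z0: "(of_int a * z0 + of_int b) / (of_int c * z0 + of_int d) = z0"
    and F: "F holomorphic_on uhp" "\<exists>w\<in>uhp. F w \<noteq> 0"
    and trans: "\<And>w. w \<in> uhp \<Longrightarrow> F ((of_int a * w + of_int b) / (of_int c * w + of_int d)) =
        (of_int c * w + of_int d) powi n * \<mu> * F w"
  shows "(of_int c * z0 + of_int d) powi (- 2 * zorder F z0) = (of_int c * z0 + of_int d) powi n * \<mu>"
proof -
  define \<gamma> where "\<gamma> = (\<lambda>w::complex. (of_int a * w + of_int b) / (of_int c * w + of_int d))"
  define j where "j = (\<lambda>w::complex. of_int c * w + of_int d)"
  define N where "N = nat (zorder F z0)"
  have j0: "j z0 \<noteq> 0" using moebius_in_uhp(1)[OF det z0] by (simp add: j_def)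
  have gz: "\<gamma> z0 = z0" using fix_z0 by (simp add: \<gamma>_def)
  have "zorder F z0 \<ge> 0"
    using zorder_exist_zero[OF F(1) open_uhp connected_uhp z0 F(2)] by (metis order.refl less_imp_le)
  then have N: "zorder F z0 = int N" by (simp add: N_def)
  obtain r u where u: "r > 0" "ball z0 r \<subseteq> uhp" "u holomorphic_on ball z0 r"
    "\<And>z. z \<in> ball z0 r \<Longrightarrow> u z \<noteq> 0" "\<And>z. z \<in> ball z0 r \<Longrightarrow> F z = u z * (z - z0) ^ N"
    using zero_factor_logderiv[OF F(1) open_uhp connected_uhp z0 F(2)] unfolding N_def by metis
  have dg: "(\<gamma> has_field_derivative 1 / j z0 ^ 2) (at z0)"
    unfolding \<gamma>_def j_def by (rule moebius_has_field_derivative[OF det z0])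
  have g: "(\<gamma> \<longlongrightarrow> z0) (at z0)" using DERIV_isCont[OF dg] gz by (simp add: isCont_def)
  have quot: "((\<lambda>w. (\<gamma> w - z0) / (w - z0)) \<longlongrightarrow> 1 / j z0 ^ 2) (at z0)"
    using dg gz by (simp add: has_field_derivative_iff)
  have uc: "isCont u z0"
    using holomorphic_on_imp_continuous_on[OF u(3)] u(1) by (simp add: continuous_on_eq_continuous_at)
  then have "((\<lambda>w. u (\<gamma> w)) \<longlongrightarrow> u z0) (at z0)" using g by (rule isCont_tendsto_compose)
  moreover have "(u \<longlongrightarrow> u z0) (at z0)" using uc by (simp add: isCont_def)
  ultimately have lim: "((\<lambda>w. u (\<gamma> w) / u w * ((\<gamma> w - z0) / (w - z0)) ^ N) \<longlongrightarrow> u z0 / u z0 * (1 / j z0 ^ 2) ^ N) (at z0)"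
    using u(1,4) by (intro tendsto_intros quot) auto
  have lim': "((\<lambda>w. j w powi n * \<mu>) \<longlongrightarrow> j z0 powi n * \<mu>) (at z0)"
    using j0 unfolding j_def by (intro tendsto_intros) auto
  have "\<forall>\<^sub>F w in at z0. j w powi n * \<mu> = u (\<gamma> w) / u w * ((\<gamma> w - z0) / (w - z0)) ^ N"
  proof -
    have "\<forall>\<^sub>F w in at z0. \<gamma> w \<in> ball z0 r"
      using g u(1) by (intro topological_tendstoD) auto
    moreover have "\<forall>\<^sub>F w in at z0. w \<in> ball z0 r - {z0}"
      using u(1) by (intro eventually_at_in_open) auto
    ultimately show ?thesis
    proof eventually_elim
      case (elim w)
      then have w: "w \<in> ball z0 r" "w - z0 \<noteq> 0" by auto
      have "F (\<gamma> w) = j w powi n * \<mu> * F w"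
        using trans[of w] w(1) u(2) by (auto simp: \<gamma>_def j_def)
      then have "u (\<gamma> w) * (\<gamma> w - z0) ^ N = j w powi n * \<mu> * (u w * (w - z0) ^ N)"
        using u(5)[OF elim(1)] u(5)[OF w(1)] by simp
      then show ?case using w(2) u(4)[OF w(1)] by (simp add: power_divide field_simps)
    qed
  qed
  then have "((\<lambda>w. j w powi n * \<mu>) \<longlongrightarrow> u z0 / u z0 * (1 / j z0 ^ 2) ^ N) (at z0)"
    using lim by (rule tendsto_cong[THEN iffD2])
  with lim' have "u z0 / u z0 * (1 / j z0 ^ 2) ^ N = j z0 powi n * \<mu>"
    by (intro tendsto_unique[of "at z0"]) auto
  moreover have "(1 / j z0 ^ 2) ^ N = j z0 powi (- 2 * zorder F z0)"
  proof -
    have "j z0 powi (- 2 * zorder F z0) = (j z0 powi (- 2)) powi int N"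
      unfolding N by (rule power_int_mult)
    also have "j z0 powi (- 2) = 1 / j z0 ^ 2" by (simp add: power_int_minus inverse_eq_divide)
    finally show ?thesis by (simp only: power_int_of_nat)
  qed
  ultimately show ?thesis using u(1,4) by (simp add: j_def)
qed

context quasimodular
begin

text \<open>The inversion has \<open>j = \<i>\<close> at its fixed point, so \<open>ord W\<close>
  and \<open>k\<close> have the same parity.\<close>

lemma zorder_W_i_even: "even (zorder W \<i>)"
proof -
  have i: "\<i> \<in> uhp" by (simp add: uhp_def)
  have "(of_int 1 * \<i> + of_int 0) powi (- 2 * zorder W \<i>) = (of_int 1 * \<i> + of_int 0) powi (2 * k) * 1"
    by (rule zorder_fixed_point[OF _ i, where a = 0 and b = "-1"])
       (use holomorphic_W W_nonzero W_transform[of 0 0 "-1" 1] in auto)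
  then have "\<i> powi (2 * (- zorder W \<i>)) = \<i> powi (2 * k)" by simp
  then have "(- 1 :: complex) powi (- zorder W \<i>) = (- 1) powi k"
    by (simp only: power_int_mult) simp
  then show ?thesis using even_k by (simp add: power_int_minus_one_minus power_int_minus_left split: if_splits)
qed

text \<open>The matrix with rows \<open>(1, -1)\<close> and \<open>(1, 0)\<close> fixes
  \<open>rho\<close>, with \<open>j = rho\<close> there. It has \<open>h - rho f\<close> as an
  eigenvector with eigenvalue \<open>1 - rho = 1 / rho\<close>, which lowers the exponent
  \<open>k - 1\<close> of \<open>j\<close> at \<open>rho\<close> to \<open>k - 2\<close>.\<close>

lemma zorder_at_rho:
  "3 dvd zorder W rho + k" "3 dvd 2 * zorder (comb 1 (- rho)) rho + k - 2"
proof -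
  have nz: "rho \<noteq> 0" by (rule rho_nonzero)
  have sq: "rho * rho = rho - 1" using rho_square by (simp only: power2_eq_square)
  have fix_rho: "(of_int 1 * rho + of_int (- 1)) / (of_int 1 * rho + of_int 0) = rho"
    using nz sq by (simp only: divide_eq_eq) simp
  have inv: "rho * (1 - rho) = 1" using sq by (simp only: right_diff_distrib) simp
  have "(of_int 1 * rho + of_int 0) powi (- 2 * zorder W rho) = (of_int 1 * rho + of_int 0) powi (2 * k) * 1"
    by (rule zorder_fixed_point[OF _ rho_in_uhp fix_rho])
       (use holomorphic_W W_nonzero W_transform[of 1 0 "-1" 1] in auto)
  then have "rho powi (2 * k) * rho powi (2 * zorder W rho) = rho powi (- 2 * zorder W rho) * rho powi (2 * zorder W rho)"
    by (simp only: of_int_1 of_int_0 mult_1 add_0_right mult_1_right)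
  then have "rho powi (2 * k + 2 * zorder W rho) = 1"
    using nz by (simp only: power_int_add[symmetric] simp_thms) simp
  from rho_power_eq_1[OF this] show "3 dvd zorder W rho + k" by presburger
  define Z where "Z = zorder (comb 1 (- rho)) rho"
  have "(of_int 1 * rho + of_int 0) powi (- 2 * Z) = (of_int 1 * rho + of_int 0) powi (k - 1) * (1 - rho)"
    unfolding Z_def
  proof (rule zorder_fixed_point[OF _ rho_in_uhp fix_rho holomorphic_comb comb_nonzero])
    fix w assume w: "w \<in> uhp"
    have "comb 1 (- rho) ((of_int 1 * w + of_int (- 1)) / (of_int 1 * w + of_int 0)) =
      (of_int 1 * w + of_int 0) powi (k - 1) * comb (1 * of_int 1 + (- rho) * of_int 1) (1 * of_int (- 1) + (- rho) * of_int 0) w"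
      by (rule comb_transform[OF _ w]) simp
    also have "comb (1 * of_int 1 + (- rho) * of_int 1) (1 * of_int (- 1) + (- rho) * of_int 0) w = (1 - rho) * comb 1 (- rho) w"
    proof -
      have "(1 - rho) * (h w - rho * f w) = (1 - rho) * h w - (rho * (1 - rho)) * f w" by (simp only: algebra_simps)
      then show ?thesis unfolding inv by (simp add: comb_def)
    qed
    finally show "comb 1 (- rho) ((of_int 1 * w + of_int (- 1)) / (of_int 1 * w + of_int 0)) =
      (of_int 1 * w + of_int 0) powi (k - 1) * (1 - rho) * comb 1 (- rho) w" by simp
  qed simp_all
  then have "rho powi (- 2 * Z) = rho powi (k - 1) * (1 - rho)"
    by (simp only: of_int_1 of_int_0 mult_1 add_0_right)
  also have "1 - rho = rho powi (- 1)" using inverse_unique[OF inv] by (simp add: power_int_minus)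
  also have "rho powi (k - 1) * rho powi (- 1) = rho powi (k - 2)"
    using nz by (subst power_int_add[symmetric]) auto
  finally have "rho powi (k - 2) * rho powi (2 * Z) = rho powi (- 2 * Z) * rho powi (2 * Z)" by simp
  then have "rho powi (k - 2 + 2 * Z) = 1"
    using nz by (simp only: power_int_add[symmetric] simp_thms) simp
  from rho_power_eq_1[OF this] show "3 dvd 2 * zorder (comb 1 (- rho)) rho + k - 2"
    unfolding Z_def by (simp add: algebra_simps)
qed

end

context quasimodular_potential
begin

lemma exponents_at_i:
  obtains n :: nat where "n > 0" "gcd n 2 = 1"
    "local_exponents Q \<i> = {1 / 2 + of_nat n / 2, 1 / 2 - of_nat n / 2}"
proof -
  define n where "n = nat \<bar>2 * zorder (comb 0 1) \<i> - zorder W \<i> - 1\<bar>"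
  have "odd (2 * zorder (comb 0 1) \<i> - zorder W \<i> - 1)" using zorder_W_i_even by simp
  then have "odd n" unfolding n_def by (simp add: even_nat_iff)
  then have "n > 0" "gcd n 2 = 1" by (auto simp: odd_pos coprime_right_2_iff_odd simp flip: coprime_iff_gcd_eq_1)
  moreover have "local_exponents Q \<i> = {1 / 2 + of_nat n / 2, 1 / 2 - of_nat n / 2}"
    unfolding n_def by (rule local_exponents_Q) (auto simp: uhp_def)
  ultimately show thesis by (rule that)
qed

lemma exponents_at_rho:
  obtains n :: nat where "n > 0" "gcd n 3 = 1"
    "local_exponents Q rho = {1 / 2 + of_nat n / 2, 1 / 2 - of_nat n / 2}"
proof -
  define n where "n = nat \<bar>2 * zorder (comb 1 (- rho)) rho - zorder W rho - 1\<bar>"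
  \<comment> \<open>Modulo 3 one has \<open>2 ord y = 2 - k\<close> and \<open>ord W = - k\<close>,
    so the number is congruent to 1.\<close>
  have "\<not> 3 dvd 2 * zorder (comb 1 (- rho)) rho - zorder W rho - 1" using zorder_at_rho by presburger
  then have "\<not> int 3 dvd int n" unfolding n_def by simp
  then have n3: "\<not> 3 dvd n" using int_dvd_int_iff[of 3 n] by simp
  then have "n > 0" by (cases n) auto
  have "\<not> m dvd 3" if "m \<in> {2..<3}" for m :: nat
  proof -
    from that have "m = 2" by simp
    then show ?thesis by simp
  qed
  then have "prime (3 :: nat)" by (simp add: prime_nat_iff')
  then have "coprime 3 n" using n3 by (rule prime_imp_coprime)
  then have "gcd n 3 = 1" by (simp add: gcd.commute coprime_iff_gcd_eq_1)
  have "local_exponents Q rho = {1 / 2 + of_nat n / 2, 1 / 2 - of_nat n / 2}"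
    unfolding n_def by (rule local_exponents_Q[OF rho_in_uhp]) auto
  show thesis by (rule that) fact+
qed

end

subsection \<open>The cusp\<close>

lemma open_qpar_ball: "open {z. qpar z \<in> ball 0 r}"
proof -
  have "continuous_on UNIV qpar" by (intro holomorphic_on_imp_continuous_on holomorphic_on_qpar)
  then have "open (UNIV \<inter> qpar -` ball 0 r)"
    by (intro continuous_open_preimage) auto
  then show ?thesis by (simp add: vimage_def)
qed

lemma qpar_in_ball_iff: "r > 0 \<Longrightarrow> qpar z \<in> ball 0 r \<longleftrightarrow> Im z > - ln r / (2 * pi)"
proof -
  assume r: "r > 0"
  have "qpar z \<in> ball 0 r \<longleftrightarrow> exp (- 2 * pi * Im z) < exp (ln r)" using r by (simp add: norm_qpar)
  also have "\<dots> \<longleftrightarrow> - 2 * pi * Im z < ln r" by (simp only: exp_less_cancel_iff)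
  also have "\<dots> \<longleftrightarrow> Im z > - ln r / (2 * pi)"
    by (subst pos_divide_less_eq) (auto simp: mult_ac)
  finally show ?thesis .
qed

lemma qpar_surj: "w \<noteq> 0 \<Longrightarrow> \<exists>z. qpar z = w"
  by (rule exI[of _ "Ln w / (2 * of_real pi * \<i>)"]) (simp add: qpar_def)

lemma holomorphic_at_cuspE:
  assumes "holomorphic_at_cusp g"
  obtains F r where "r > 0" "r \<le> 1" "F holomorphic_on ball 0 r" "\<And>z. qpar z \<in> ball 0 r \<Longrightarrow> g z = F (qpar z)"
proof -
  obtain F M where F: "F analytic_on {0}" "\<And>z. Im z > M \<Longrightarrow> g z = F (qpar z)"
    using assms by (auto simp: holomorphic_at_cusp_def q_expansion_def)
  then obtain e where e: "e > 0" "F holomorphic_on ball 0 e" by (auto simp: analytic_on_def)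
  define r where "r = Min {e, 1, exp (- 2 * pi * M)}"
  have r: "r > 0" "r \<le> 1" "r \<le> e" "r \<le> exp (- 2 * pi * M)" using e by (auto simp: r_def)
  have "g z = F (qpar z)" if "qpar z \<in> ball 0 r" for z
  proof (rule F(2))
    have "norm (qpar z) < exp (- 2 * pi * M)" using that r(4) by simp
    then have "pi * M < pi * Im z" by (simp add: norm_qpar)
    then show "Im z > M" by simp
  qed
  moreover have "F holomorphic_on ball 0 r" using e(2) by (rule holomorphic_on_subset) (use r in auto)
  ultimately show thesis using that r by blast
qed

lemma holomorphic_at_cuspI:
  assumes "r > 0" "F holomorphic_on ball 0 r" "\<And>z. qpar z \<in> ball 0 r \<Longrightarrow> g z = F (qpar z)"
  shows "F analytic_on {0}" "q_expansion g F"
proof -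
  show "F analytic_on {0}" unfolding analytic_on_def using assms by auto
  show "q_expansion g F" unfolding q_expansion_def
    using assms(3) qpar_in_ball_iff[OF assms(1)] by blast
qed

lemma qpar_comp_deriv:
  assumes "F holomorphic_on ball 0 r" "\<And>z. qpar z \<in> ball 0 r \<Longrightarrow> g z = F (qpar z)" "qpar z \<in> ball 0 r"
  shows "(g has_field_derivative 2 * of_real pi * \<i> * qpar z * deriv F (qpar z)) (at z)"
proof -
  have "(qpar has_field_derivative 2 * of_real pi * \<i> * 1 * qpar z) (at z)"
    by (rule has_field_derivative_qpar) (rule DERIV_ident)
  from DERIV_chain2[OF holomorphic_derivI[OF assms(1) open_ball assms(3)] this]
  have "((\<lambda>z. F (qpar z)) has_field_derivative 2 * of_real pi * \<i> * qpar z * deriv F (qpar z)) (at z)"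
    by (simp add: mult_ac)
  then show ?thesis
    by (rule has_field_derivative_transform_within_open[OF _ open_qpar_ball[of r]]) (use assms in auto)
qed

lemma cusp_nonzero:
  assumes g: "g holomorphic_on uhp" "\<exists>z\<in>uhp. g z \<noteq> 0" and r: "r > 0" "r \<le> 1"
    and G: "\<And>z. qpar z \<in> ball 0 r \<Longrightarrow> g z = G (qpar z)"
  shows "\<exists>w\<in>ball 0 r. G w \<noteq> 0"
proof (rule ccontr)
  assume "\<not> ?thesis"
  then have 0: "\<And>z. z \<in> {z. qpar z \<in> ball 0 r} \<Longrightarrow> g z = 0" using G by auto
  obtain z1 where "qpar z1 = of_real (r / 2)" using qpar_surj[of "of_real (r / 2)"] r by auto
  then have "norm (qpar z1) = r / 2" using r by (simp only: norm_of_real)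
  then have "z1 \<in> {z. qpar z \<in> ball 0 r}" using r by simp
  then have ne: "{z. qpar z \<in> ball 0 r} \<noteq> {}" by blast
  have sub: "{z. qpar z \<in> ball 0 r} \<subseteq> uhp" using r by (auto simp flip: norm_qpar_less_1_iff)
  have "g z = 0" if "z \<in> uhp" for z
    by (rule analytic_continuation_open[OF open_qpar_ball open_uhp ne connected_uhp sub g(1) _ 0 that]) auto
  with g(2) show False by blast
qed

context quasimodular_potential
begin

lemma cusp_expansions:
  obtains r \<phi> \<phi>1 where "r > 0" "r \<le> 1" "\<phi> holomorphic_on ball 0 r" "\<phi>1 holomorphic_on ball 0 r"
    "\<And>z. qpar z \<in> ball 0 r \<Longrightarrow> z \<in> uhp"
    "\<And>z. qpar z \<in> ball 0 r \<Longrightarrow> f z = \<phi> (qpar z)" "\<And>z. qpar z \<in> ball 0 r \<Longrightarrow> f1 z = \<phi>1 (qpar z)"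
proof -
  have "holomorphic_at_cusp f0" "holomorphic_at_cusp f1"
    using modular_f0 modular_f1 by (auto simp: modular_form_def)
  then obtain F0 r0 F1 r1 where F: "r0 > 0" "r0 \<le> 1" "F0 holomorphic_on ball 0 r0"
    "\<And>z. qpar z \<in> ball 0 r0 \<Longrightarrow> f0 z = F0 (qpar z)"
    "r1 > 0" "r1 \<le> 1" "F1 holomorphic_on ball 0 r1" "\<And>z. qpar z \<in> ball 0 r1 \<Longrightarrow> f1 z = F1 (qpar z)"
    by (metis holomorphic_at_cuspE)
  define r where "r = min r0 r1"
  have sub: "ball 0 r \<subseteq> ball (0::complex) r0" "ball 0 r \<subseteq> ball (0::complex) r1" "ball 0 r \<subseteq> ball (0::complex) 1"
    using F by (auto simp: r_def)
  have u: "z \<in> uhp" if "qpar z \<in> ball 0 r" for z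
    using that sub(3) by (auto simp flip: norm_qpar_less_1_iff)
  show thesis
  proof (rule that[of r "\<lambda>w. F1 w * E2_q w + F0 w" F1])
    show "r > 0" "r \<le> 1" using F by (auto simp: r_def)
    show "(\<lambda>w. F1 w * E2_q w + F0 w) holomorphic_on ball 0 r" "F1 holomorphic_on ball 0 r"
      by (intro holomorphic_intros holomorphic_on_subset[OF F(3) sub(1)] holomorphic_on_subset[OF F(7) sub(2)]
            holomorphic_on_subset[OF holomorphic_E2_q sub(3)])+
    fix z assume z: "qpar z \<in> ball 0 r"
    show "z \<in> uhp" by (rule u[OF z])
    show "f z = F1 (qpar z) * E2_q (qpar z) + F0 (qpar z)" "f1 z = F1 (qpar z)"
    proof -
      have "qpar z \<in> ball 0 r0" "qpar z \<in> ball 0 r1" using z sub by blast+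
      note F(4)[OF this(1)] F(8)[OF this(2)]
      then show "f z = F1 (qpar z) * E2_q (qpar z) + F0 (qpar z)" "f1 z = F1 (qpar z)"
        using f_eq u[OF z] by (simp_all add: E2_eq_E2_q)
    qed
  qed
qed

text \<open>The explicit \<open>z\<close> in \<open>h\<close> cancels in the Wronskian, so
  \<open>W\<close> has a q-expansion. \<open>\<Lambda>\<close> is the logarithmic derivative of
  \<open>f / sqrt W\<close> with respect to \<open>q d/dq\<close>, and \<open>m\<close> and
  \<open>N\<close> are the orders of \<open>f\<close> and \<open>W\<close> in
  \<open>q\<close>.\<close>

lemma cusp_factorization:
  obtains r \<phi> \<phi>1 e \<Lambda> and m N :: nat where "r > 0" "r \<le> 1"
    "\<phi> holomorphic_on ball 0 r" "\<phi>1 holomorphic_on ball 0 r"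
    "e holomorphic_on ball 0 r" "\<Lambda> holomorphic_on ball 0 r" "\<Lambda> 0 = of_nat m - of_nat N / 2"
    "\<And>w. w \<in> ball 0 r \<Longrightarrow> e w \<noteq> 0" "\<exists>w\<in>ball 0 r. \<phi> w \<noteq> 0"
    "\<And>z. qpar z \<in> ball 0 r \<Longrightarrow> z \<in> uhp"
    "\<And>z. qpar z \<in> ball 0 r \<Longrightarrow> f z = \<phi> (qpar z)" "\<And>z. qpar z \<in> ball 0 r \<Longrightarrow> f1 z = \<phi>1 (qpar z)"
    "\<And>z. qpar z \<in> ball 0 r \<Longrightarrow> W z = e (qpar z) * qpar z ^ N"
    "\<And>z. qpar z \<in> ball 0 r \<Longrightarrow> comb 0 1 z \<noteq> 0 \<and> L 0 1 z = 2 * of_real pi * \<i> * \<Lambda> (qpar z)"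
proof -
  obtain r \<phi> \<phi>1 where r: "r > 0" "r \<le> 1" and \<phi>: "\<phi> holomorphic_on ball 0 r" "\<phi>1 holomorphic_on ball 0 r"
    and u: "\<And>z. qpar z \<in> ball 0 r \<Longrightarrow> z \<in> uhp"
    and f\<phi>: "\<And>z. qpar z \<in> ball 0 r \<Longrightarrow> f z = \<phi> (qpar z)" and f1\<phi>: "\<And>z. qpar z \<in> ball 0 r \<Longrightarrow> f1 z = \<phi>1 (qpar z)"
    using cusp_expansions by metis
  define \<kappa> where "\<kappa> = 6 / (of_real pi * \<i>)"
  \<comment> \<open>\<open>W\<close> as a function of \<open>q\<close>. The constant 12 is
    \<open>6 / (\<pi> \<i>)\<close> times the \<open>2 \<pi> \<i>\<close> in
    \<open>d/dz = 2 \<pi> \<i> q d/dq\<close>; the square comes from differentiating the explicit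
    \<open>z\<close> in \<open>h\<close>.\<close>
  define G where "G = (\<lambda>w. 12 * (\<phi>1 w * (w * deriv \<phi> w) - \<phi> w * (w * deriv \<phi>1 w)) - \<phi> w ^ 2)"
  have G: "G holomorphic_on ball 0 r"
    unfolding G_def by (intro holomorphic_intros \<phi> holomorphic_deriv open_ball)
  have WG: "W z = G (qpar z)" if z: "qpar z \<in> ball 0 r" for z
  proof -
    have df: "(f has_field_derivative 2 * of_real pi * \<i> * qpar z * deriv \<phi> (qpar z)) (at z)"
      by (rule qpar_comp_deriv[OF \<phi>(1) f\<phi> z])
    have df1: "(f1 has_field_derivative 2 * of_real pi * \<i> * qpar z * deriv \<phi>1 (qpar z)) (at z)"
      by (rule qpar_comp_deriv[OF \<phi>(2) f1\<phi> z])
    have "(h has_field_derivative 1 * f z + (2 * of_real pi * \<i> * qpar z * deriv \<phi> (qpar z)) * z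
        + \<kappa> * (2 * of_real pi * \<i> * qpar z * deriv \<phi>1 (qpar z))) (at z)"
      unfolding h_fun_def[abs_def] \<kappa>_def[symmetric]
      by (intro DERIV_add DERIV_mult DERIV_ident DERIV_cmult df df1)
    then have "W z = \<kappa> * (2 * of_real pi * \<i>) * (\<phi>1 (qpar z) * (qpar z * deriv \<phi> (qpar z))
        - \<phi> (qpar z) * (qpar z * deriv \<phi>1 (qpar z))) - \<phi> (qpar z) ^ 2"
      unfolding W_fun_def using df
      by (simp add: DERIV_imp_deriv h_fun_def f\<phi>[OF z] f1\<phi>[OF z] flip: \<kappa>_def)
         (simp add: algebra_simps power2_eq_square)
    also have "\<kappa> * (2 * of_real pi * \<i>) = 12" by (simp add: \<kappa>_def)
    finally show ?thesis by (simp add: G_def)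
  qed
  have nz: "\<exists>w\<in>ball 0 r. \<phi> w \<noteq> 0" "\<exists>w\<in>ball 0 r. G w \<noteq> 0"
    using cusp_nonzero[OF holomorphic_f f_nonzero r f\<phi>] cusp_nonzero[OF holomorphic_W W_nonzero r WG]
    by blast+
  have zb: "0 \<in> ball (0::complex) r" using r by simp
  define m where "m = nat (zorder \<phi> 0)"
  define N where "N = nat (zorder G 0)"
  obtain r1 v where v: "r1 > 0" "ball 0 r1 \<subseteq> ball (0::complex) r" "v holomorphic_on ball 0 r1"
    "\<And>w. w \<in> ball 0 r1 \<Longrightarrow> v w \<noteq> 0" "\<And>w. w \<in> ball 0 r1 \<Longrightarrow> \<phi> w = v w * (w - 0) ^ m"
    "\<And>w. w \<in> ball 0 r1 - {0} \<Longrightarrow> deriv \<phi> w / \<phi> w = of_nat m / (w - 0) + deriv v w / v w"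
    using zero_factor_logderiv[OF \<phi>(1) open_ball connected_ball zb nz(1)] unfolding m_def by metis
  obtain r2 e where e: "r2 > 0" "ball 0 r2 \<subseteq> ball (0::complex) r" "e holomorphic_on ball 0 r2"
    "\<And>w. w \<in> ball 0 r2 \<Longrightarrow> e w \<noteq> 0" "\<And>w. w \<in> ball 0 r2 \<Longrightarrow> G w = e w * (w - 0) ^ N"
    "\<And>w. w \<in> ball 0 r2 - {0} \<Longrightarrow> deriv G w / G w = of_nat N / (w - 0) + deriv e w / e w"
    using zero_factor_logderiv[OF G open_ball connected_ball zb nz(2)] unfolding N_def by metis
  define r' where "r' = min r1 r2"
  have r': "r' > 0" and sub: "ball 0 r' \<subseteq> ball (0::complex) r1" "ball 0 r' \<subseteq> ball (0::complex) r2"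
    using v(1) e(1) by (auto simp: r'_def)
  have sub0: "ball 0 r' \<subseteq> ball (0::complex) r" using sub(1) v(2) by blast
  have "r' \<le> 1"
  proof (rule ccontr)
    assume "\<not> r' \<le> 1"
    then have "1 \<in> ball (0::complex) r'" by simp
    then have "1 \<in> ball (0::complex) r" using sub0 by blast
    then show False using r(2) by simp
  qed
  define \<Lambda> where "\<Lambda> = (\<lambda>w. of_nat m - of_nat N / 2 + w * (deriv v w / v w - deriv e w / e w / 2))"
  have \<Lambda>: "\<Lambda> holomorphic_on ball 0 r'"
    unfolding \<Lambda>_def using v(4) e(4) sub
    by (intro holomorphic_intros holomorphic_on_subset[OF holomorphic_deriv[OF v(3) open_ball] sub(1)]
          holomorphic_on_subset[OF holomorphic_deriv[OF e(3) open_ball] sub(2)]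
          holomorphic_on_subset[OF v(3) sub(1)] holomorphic_on_subset[OF e(3) sub(2)]) auto
  have L: "comb 0 1 z \<noteq> 0 \<and> L 0 1 z = 2 * of_real pi * \<i> * \<Lambda> (qpar z)" if z: "qpar z \<in> ball 0 r'" for z
  proof
    define q where "q = qpar z"
    have q: "q \<in> ball 0 r1 - {0}" "q \<in> ball 0 r2 - {0}" "q \<in> ball 0 r" "q \<noteq> 0"
      using z sub sub0 by (auto simp: q_def)
    have zu: "z \<in> uhp" using u q(3) by (simp add: q_def)
    have c: "comb 0 1 = f" by (simp add: comb_def fun_eq_iff)
    show "comb 0 1 z \<noteq> 0" using v(4,5)[of q] q f\<phi>[of z] by (simp add: c q_def)
    have "deriv f z = 2 * of_real pi * \<i> * q * deriv \<phi> q"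
      using qpar_comp_deriv[OF \<phi>(1) f\<phi>] q(3) unfolding q_def by (intro DERIV_imp_deriv) blast
    then have fl: "deriv f z / f z = 2 * of_real pi * \<i> * (q * (deriv \<phi> q / \<phi> q))"
      using f\<phi>[of z] q(3) by (simp add: q_def)
    have "deriv W z = 2 * of_real pi * \<i> * q * deriv G q"
      using qpar_comp_deriv[OF G WG] q(3) unfolding q_def by (intro DERIV_imp_deriv) blast
    then have Wl: "\<omega> z = 2 * of_real pi * \<i> * (q * (deriv G q / G q)) / 2"
      using WG[of z] q(3) by (simp add: \<omega>_def q_def)
    have "L 0 1 z = 2 * of_real pi * \<i> * (q * (deriv \<phi> q / \<phi> q) - q * (deriv G q / G q) / 2)"
      unfolding L_def c fl Wl by (simp add: algebra_simps)
    also have "q * (deriv \<phi> q / \<phi> q) - q * (deriv G q / G q) / 2 = \<Lambda> q"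
    proof -
      have "q * (a / (q - 0) + b) - q * (c / (q - 0) + d) / 2 = a - c / 2 + q * (b - d / 2)" for a b c d
        using q(4) by (simp add: field_simps)
      then show ?thesis unfolding v(6)[OF q(1)] e(6)[OF q(2)] \<Lambda>_def by simp
    qed
    finally show "L 0 1 z = 2 * of_real pi * \<i> * \<Lambda> (qpar z)" by (simp add: q_def)
  qed
  show thesis
  proof (rule that[of r' \<phi> \<phi>1 e \<Lambda> m N])
    show "\<phi> holomorphic_on ball 0 r'" "\<phi>1 holomorphic_on ball 0 r'" "e holomorphic_on ball 0 r'"
      using \<phi> e(3) sub0 sub by (auto intro: holomorphic_on_subset)
    show "\<Lambda> 0 = of_nat m - of_nat N / 2" by (simp add: \<Lambda>_def)
    have "of_real (r' / 2) \<in> ball (0::complex) r'" using r' by simp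
    moreover from this have "of_real (r' / 2) \<in> ball (0::complex) r1" using sub(1) by blast
    from v(4,5)[OF this] have "\<phi> (of_real (r' / 2)) \<noteq> 0" using r' by simp
    ultimately show "\<exists>w\<in>ball 0 r'. \<phi> w \<noteq> 0" by blast
    fix z assume z: "qpar z \<in> ball 0 r'"
    then have z': "qpar z \<in> ball 0 r" using sub0 by blast
    show "z \<in> uhp" "f z = \<phi> (qpar z)" "f1 z = \<phi>1 (qpar z)" using u f\<phi> f1\<phi> z' by auto
    show "W z = e (qpar z) * qpar z ^ N" using WG[OF z'] e(5)[of "qpar z"] z sub(2) by auto
    show "comb 0 1 z \<noteq> 0 \<and> L 0 1 z = 2 * of_real pi * \<i> * \<Lambda> (qpar z)" by (rule L[OF z])
  qed (use r' \<open>r' \<le> 1\<close> \<Lambda> e(4) sub in auto)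
qed

lemma cusp_regular_log:
  shows "\<exists>F. \<exists>n::nat. F analytic_on {0} \<and> q_expansion Q F \<and> F 0 = (of_nat n / 2)\<^sup>2"
    and "has_log_solution_at_cusp Q"
proof -
  obtain r \<phi> \<phi>1 e \<Lambda> and m N :: nat where r: "r > 0" "r \<le> 1"
    and hol: "\<phi> holomorphic_on ball 0 r" "\<phi>1 holomorphic_on ball 0 r"
    "e holomorphic_on ball 0 r" "\<Lambda> holomorphic_on ball 0 r" and \<Lambda>0: "\<Lambda> 0 = of_nat m - of_nat N / 2"
    and e0: "\<And>w. w \<in> ball 0 r \<Longrightarrow> e w \<noteq> 0" and \<phi>0: "\<exists>w\<in>ball 0 r. \<phi> w \<noteq> 0"
    and u: "\<And>z. qpar z \<in> ball 0 r \<Longrightarrow> z \<in> uhp"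
    and f\<phi>: "\<And>z. qpar z \<in> ball 0 r \<Longrightarrow> f z = \<phi> (qpar z)" and f1\<phi>: "\<And>z. qpar z \<in> ball 0 r \<Longrightarrow> f1 z = \<phi>1 (qpar z)"
    and We: "\<And>z. qpar z \<in> ball 0 r \<Longrightarrow> W z = e (qpar z) * qpar z ^ N"
    and L: "\<And>z. qpar z \<in> ball 0 r \<Longrightarrow> comb 0 1 z \<noteq> 0 \<and> L 0 1 z = 2 * of_real pi * \<i> * \<Lambda> (qpar z)"
    by (rule cusp_factorization) (rule that; (assumption | simp del: mem_ball))
  \<comment> \<open>The Riccati equation in \<open>q\<close>: with
    \<open>L = 2 \<pi> \<i> \<Lambda>\<close> and \<open>R = (2 \<pi> \<i>)^2 Q\<close> it reads
    \<open>Q = q \<Lambda>' + \<Lambda>^2\<close>. At \<open>q = 0\<close> only the square of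
    \<open>m - N / 2\<close> remains.\<close>
  define F where "F = (\<lambda>w. w * deriv \<Lambda> w + \<Lambda> w ^ 2)"
  have F: "F holomorphic_on ball 0 r"
    unfolding F_def by (intro holomorphic_intros hol holomorphic_deriv open_ball)
  have W0: "W z \<noteq> 0" if "qpar z \<in> ball 0 r" for z using We[OF that] e0[OF that] by simp
  have QF: "Q z = F (qpar z)" if z: "qpar z \<in> ball 0 r" for z
  proof -
    have "((\<lambda>w. 2 * of_real pi * \<i> * \<Lambda> w) holomorphic_on ball 0 r)" by (intro holomorphic_intros hol)
    then have "(L 0 1 has_field_derivative
        2 * of_real pi * \<i> * qpar z * deriv (\<lambda>w. 2 * of_real pi * \<i> * \<Lambda> w) (qpar z)) (at z)"
      by (rule qpar_comp_deriv) (use L z in auto)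
    also have "deriv (\<lambda>w. 2 * of_real pi * \<i> * \<Lambda> w) (qpar z) = 2 * of_real pi * \<i> * deriv \<Lambda> (qpar z)"
      by (rule DERIV_imp_deriv, rule DERIV_cmult, rule holomorphic_derivI[OF hol(4) open_ball z])
    finally have "R z - L 0 1 z ^ 2 = 2 * of_real pi * \<i> * qpar z * (2 * of_real pi * \<i> * deriv \<Lambda> (qpar z))"
      using DERIV_unique L_has_field_derivative[OF u[OF z] W0[OF z]] L[OF z] by blast
    then have "R z = (2 * of_real pi * \<i>) ^ 2 * F (qpar z)"
      using L[OF z] by (simp add: F_def algebra_simps power2_eq_square)
    then have "R z = - (4 * of_real pi ^ 2) * F (qpar z)" by (simp add: power_mult_distrib)
    with Q_eq_R[OF u[OF z] W0[OF z]] show ?thesis by simp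
  qed
  have F0: "F 0 = (of_nat (nat \<bar>2 * int m - int N\<bar>) / 2)\<^sup>2"
  proof -
    define i where "i = 2 * int m - int N"
    have "\<Lambda> 0 = of_int i / 2" by (simp add: \<Lambda>0 i_def diff_divide_distrib)
    have "F 0 = \<Lambda> 0 ^ 2" by (simp add: F_def)
    also have "\<dots> = (of_int i / 2) ^ 2" by (simp only: \<open>\<Lambda> 0 = of_int i / 2\<close>)
    also have "\<dots> = of_int (i ^ 2) / 4" by (simp add: power_divide)
    also have "i ^ 2 = \<bar>i\<bar> ^ 2" by simp
    also have "of_int (\<bar>i\<bar> ^ 2) / 4 = (of_nat (nat \<bar>i\<bar>) / 2 :: complex)\<^sup>2"
    proof -
      have "of_nat (nat \<bar>i\<bar>) = (of_int \<bar>i\<bar> :: complex)" by (simp add: of_nat_nat)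
      then show ?thesis by (simp only: power_divide of_int_power) simp
    qed
    finally show ?thesis by (simp add: i_def)
  qed
  show "\<exists>F. \<exists>n::nat. F analytic_on {0} \<and> q_expansion Q F \<and> F 0 = (of_nat n / 2)\<^sup>2"
    using holomorphic_at_cuspI[OF r(1) F QF] F0 by blast
  obtain t where t: "t holomorphic_on ball 0 r" "\<And>w. w \<in> ball 0 r \<Longrightarrow> e w = t w ^ 2"
    using contractible_imp_holomorphic_sqrt[OF hol(3) convex_imp_contractible[OF convex_ball] e0] by metis
  have t0: "t w \<noteq> 0" if "w \<in> ball 0 r" for w using t(2)[OF that] e0[OF that] by auto
  define U where "U = {z. qpar z \<in> ball 0 r}"
  have U: "open U" "U \<subseteq> uhp" "U = {z \<in> uhp. qpar z \<in> ball 0 r}"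
    using u open_qpar_ball unfolding U_def by blast+
  \<comment> \<open>The branch of \<open>sqrt W\<close> for \<open>W = e q^N\<close>, with
    \<open>q^(N / 2)\<close> written as \<open>exp (N \<pi> \<i> z)\<close>.\<close>
  define s where "s = (\<lambda>z. exp (of_nat N * (of_real pi * \<i> * z)) * t (qpar z))"
  have "(t \<circ> qpar) holomorphic_on U"
    by (rule holomorphic_on_compose_gen[OF holomorphic_on_qpar t(1)]) (auto simp: U_def)
  then have s: "s holomorphic_on U"
    unfolding s_def o_def by (intro holomorphic_intros)
  have sW: "W w \<noteq> 0 \<and> (s w)\<^sup>2 = W w" if w: "w \<in> U" for w
  proof
    have q: "qpar w \<in> ball 0 r" using w by (simp add: U_def)
    show "W w \<noteq> 0" by (rule W0[OF q])
    have "(exp (of_nat N * (of_real pi * \<i> * w)))\<^sup>2 = (exp (of_real pi * \<i> * w) ^ 2) ^ N"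
      by (simp add: exp_of_nat_mult mult.commute flip: power_mult)
    also have "exp (of_real pi * \<i> * w) ^ 2 = qpar w"
      by (simp add: qpar_def flip: exp_double) (simp add: algebra_simps)
    finally show "(s w)\<^sup>2 = W w" using We[OF q] t(2)[OF q] by (simp add: s_def power_mult_distrib)
  qed
  have s0: "s w \<noteq> 0" if "w \<in> U" for w using sW[OF that] by auto
  \<comment> \<open>The solution that shows the logarithm: after division of \<open>h\<close> by
    \<open>s\<close>, the coefficient of \<open>z\<close> is \<open>q^(- N / 2)\<close> times
    \<open>\<phi> / t\<close>, and \<open>\<phi>\<close> is not identically zero because
    \<open>f\<close> is not.\<close>
  define y where "y = (\<lambda>z. comb 1 0 z / s z)"
  have sol: "solution_on Q U y"
    unfolding solution_on_def
  proof
    show "y holomorphic_on U"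
      unfolding y_def by (intro holomorphic_intros holomorphic_on_subset[OF holomorphic_comb] s s0 U)
    show "\<forall>z\<in>U. (deriv ^^ 2) y z = - 4 * of_real pi ^ 2 * Q z * y z"
    proof
      fix z assume z: "z \<in> U"
      have "(deriv ^^ 2) y z = R z * y z"
        using deriv2_normalized[OF U(1,2) s sW z, of 1 0] by (simp add: y_def numeral_2_eq_2)
      also have "R z = - 4 * of_real pi ^ 2 * Q z" using Q_eq_R[of z] z U(2) sW[OF z] by auto
      finally show "(deriv ^^ 2) y z = - 4 * of_real pi ^ 2 * Q z * y z" .
    qed
  qed
  define \<kappa> where "\<kappa> = 6 / (of_real pi * \<i>)"
  show "has_log_solution_at_cusp Q"
    unfolding has_log_solution_at_cusp_def
  proof (intro exI conjI)
    show "0 < r" by fact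
    show "solution_on Q {z \<in> uhp. qpar z \<in> ball 0 r} y" using sol U(3) by simp
    show "(\<lambda>w. \<phi> w / t w) holomorphic_on ball 0 r" "(\<lambda>w. \<kappa> * \<phi>1 w / t w) holomorphic_on ball 0 r"
      by (intro holomorphic_intros hol t t0; assumption)+
    show "\<exists>w\<in>ball 0 r. \<phi> w / t w \<noteq> 0" using \<phi>0 t0 by (auto simp del: mem_ball)
    show "\<forall>z\<in>uhp. qpar z \<in> ball 0 r \<longrightarrow> y z =
       exp (2 * of_real pi * \<i> * (- of_nat N / 2) * z) * (z * (\<phi> (qpar z) / t (qpar z)) + \<kappa> * \<phi>1 (qpar z) / t (qpar z))"
    proof (intro ballI impI)
      fix z assume q: "qpar z \<in> ball 0 r"
      have "2 * of_real pi * \<i> * (- of_nat N / 2) * z = - (of_nat N * (of_real pi * \<i> * z))" by simp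
      then have "exp (2 * of_real pi * \<i> * (- of_nat N / 2) * z) = inverse (exp (of_nat N * (of_real pi * \<i> * z)))"
        by (simp only: exp_minus)
      moreover have "comb 1 0 z = z * \<phi> (qpar z) + \<kappa> * \<phi>1 (qpar z)"
        using f\<phi>[OF q] f1\<phi>[OF q] by (simp add: comb_def h_fun_def \<kappa>_def)
      ultimately show "y z = exp (2 * of_real pi * \<i> * (- of_nat N / 2) * z) *
          (z * (\<phi> (qpar z) / t (qpar z)) + \<kappa> * \<phi>1 (qpar z) / t (qpar z))"
        using t0[OF q] by (simp add: y_def s_def field_simps)
    qed
  qed
qed

lemma holomorphic_at_cusp_Q: "holomorphic_at_cusp Q"
  using cusp_regular_log(1) unfolding holomorphic_at_cusp_def by blast

lemma meromorphic_modular_form_Q: "meromorphic_modular_form 4 Q"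
proof -
  have "meromorphic_at_cusp Q"
    using holomorphic_at_cusp_Q analytic_on_imp_meromorphic_on
    unfolding holomorphic_at_cusp_def meromorphic_at_cusp_def by blast
  then show ?thesis
    using nicely_meromorphic_Q weakly_modular_Q by (simp add: meromorphic_modular_form_def)
qed

text \<open>The weight 4 transform of \<open>Q\<close> under any matrix is \<open>Q\<close> itself,
  so every cusp has the expansion found at infinity.\<close>

lemma fuchsian_at_cusps_Q: "fuchsian_at_cusps Q"
  unfolding fuchsian_at_cusps_def
proof (intro allI impI)
  fix a b c d :: int assume det: "a * d - b * c = 1"
  let ?g = "\<lambda>z. (of_int c * z + of_int d) powi (- 4) * Q ((of_int a * z + of_int b) / (of_int c * z + of_int d))"
  obtain F r where F: "r > 0" "r \<le> 1" "F holomorphic_on ball 0 r" "\<And>z. qpar z \<in> ball 0 r \<Longrightarrow> Q z = F (qpar z)"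
    using holomorphic_at_cuspE[OF holomorphic_at_cusp_Q] by metis
  have "?g z = F (qpar z)" if q: "qpar z \<in> ball 0 r" for z
  proof -
    have z: "z \<in> uhp" using q F(2) by (auto simp flip: norm_qpar_less_1_iff)
    have "Q ((of_int a * z + of_int b) / (of_int c * z + of_int d)) = (of_int c * z + of_int d) powi 4 * Q z"
      using weakly_modular_Q det z unfolding weakly_modular_def by blast
    then show ?thesis using F(4)[OF q] moebius_in_uhp(1)[OF det z] by (simp add: power_int_minus)
  qed
  from holomorphic_at_cuspI[OF F(1,3) this] show "holomorphic_at_cusp ?g"
    unfolding holomorphic_at_cusp_def by blast
qed

end

theorem theorem1p1:
  fixes k :: int and f f0 f1 :: "complex \<Rightarrow> complex"
  assumes "modular_form k f0"
    and "modular_form (k - 2) f1"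
    and "\<forall>z\<in>uhp. f z = f1 z * E2 z + f0 z"
    and "\<exists>z\<in>uhp. f z \<noteq> 0"
  shows "(\<exists>Q. is_Q_of f1 f Q) \<and>
    (\<forall>Q. is_Q_of f1 f Q \<longrightarrow>
       meromorphic_modular_form 4 Q \<and>
       (fuchsian_on_uhp Q \<and> fuchsian_at_cusps Q) \<and>
       (\<forall>z\<in>uhp. is_pole Q z \<longrightarrow> apparent_at Q z) \<and>
       cusp_not_apparent Q \<and>
       (\<exists>n_i n_rho :: nat. n_i > 0 \<and> n_rho > 0 \<and>
          local_exponents Q \<i> = {1/2 + of_nat n_i / 2, 1/2 - of_nat n_i / 2} \<and>
          local_exponents Q ((1 + \<i> * of_real (sqrt 3)) / 2) =
            {1/2 + of_nat n_rho / 2, 1/2 - of_nat n_rho / 2} \<and>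
          gcd n_i 2 = 1 \<and> gcd n_rho 3 = 1))"
proof -
  interpret quasimodular k f f0 f1 by unfold_locales (use assms in auto)
  show ?thesis
  proof (intro conjI allI impI ballI)
    show "\<exists>Q. is_Q_of f1 f Q" using is_Q_of_remove_sings by blast
  next
    fix Q assume "is_Q_of f1 f Q"
    then interpret quasimodular_potential k f f0 f1 Q by unfold_locales
    show "meromorphic_modular_form 4 Q" by (rule meromorphic_modular_form_Q)
    show "fuchsian_on_uhp Q" by (rule fuchsian_on_uhp_Q)
    show "fuchsian_at_cusps Q" by (rule fuchsian_at_cusps_Q)
    show "apparent_at Q z" if "z \<in> uhp" for z by (rule apparent_at_Q[OF that])
    show "cusp_not_apparent Q" unfolding cusp_not_apparent_def using cusp_regular_log by blast
    obtain n_i :: nat where i: "n_i > 0" "gcd n_i 2 = 1"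
      "local_exponents Q \<i> = {1 / 2 + of_nat n_i / 2, 1 / 2 - of_nat n_i / 2}" by (rule exponents_at_i)
    obtain n_rho :: nat where rho: "n_rho > 0" "gcd n_rho 3 = 1"
      "local_exponents Q ((1 + \<i> * of_real (sqrt 3)) / 2) = {1 / 2 + of_nat n_rho / 2, 1 / 2 - of_nat n_rho / 2}"
      by (rule exponents_at_rho[unfolded rho_def])
    show "\<exists>n_i n_rho :: nat. n_i > 0 \<and> n_rho > 0 \<and>
          local_exponents Q \<i> = {1/2 + of_nat n_i / 2, 1/2 - of_nat n_i / 2} \<and>
          local_exponents Q ((1 + \<i> * of_real (sqrt 3)) / 2) =
            {1/2 + of_nat n_rho / 2, 1/2 - of_nat n_rho / 2} \<and>
          gcd n_i 2 = 1 \<and> gcd n_rho 3 = 1"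
      by (rule exI[of _ n_i], rule exI[of _ n_rho]) (intro conjI i rho)
  qed
qed

end
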